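(* Let $n\geq 2$ and $1/2\leq\sigma<1$. Let $\Omega\subset\mathbb{R}^n$ be a bounded open set with $C^1$ boundary and assume that $$0<S_{n,\sigma}(\Omega)<S_{n,\sigma}(\mathbb{R}^n_+).$$ Then any minimizing sequence $(u_k)\subset\mathring H^\sigma(\Omega)$ for $S_{n,\sigma}(\Omega)$ with $I_{n,\sigma,\Omega}[u_k]=1$ for all $k$ is relatively compact in $\mathring H^\sigma(\Omega)$. In particular, the infimum $S_{n,\sigma}(\Omega)$ is attained.
   Context: $\mathbb{R}^n_+=\{(x',x_n)\in\mathbb{R}^{n-1}\times\mathbb{R}:x_n>0\}$. For an open set $\Omega\subset\mathbb{R}^n$ let $I_{n,\sigma,\Omega}[u]=\iint_{\Omega\times\Omega}\frac{(u(x)-u(y))^2}{|x-y|^{n+2\sigma}}\,dx\,dy$, let $\mathring H^\sigma(\Omega)$ be the completion of $C^1_c(\Omega)$ with respect to $I_{n,\sigma,\Omega}$, and $S_{n,\sigma}(\Omega)=\inf_{0\not\equiv u\in C^1_c(\Omega)} I_{n,\sigma,\Omega}[u]\big/\big(\int_\Omega|u|^{\frac{2n}{n-2\sigma}}dx\big)^{\frac{n-2\sigma}{n}}$. When $S_{n,\sigma}(\Omega)>0$, $\mathring H^\sigma(\Omega)$ is a space of functions embedded in $L^{\frac{2n}{n-2\sigma}}(\Omega)$ and the infimum may equivalently be taken over nonzero $u\in\mathring H^\sigma(\Omega)$. A minimizing sequence is a sequence of nonzero elements along which the quotient tends to $S_{n,\sigma}(\Omega)$. *)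

theory Defs
  imports "HOL-Analysis.Analysis"
begin

definition C1_fun :: "('a::euclidean_space \<Rightarrow> real) \<Rightarrow> bool" where
  "C1_fun u \<longleftrightarrow> (\<exists>D :: 'a \<Rightarrow> ('a \<Rightarrow>\<^sub>L real).
      (\<forall>x. (u has_derivative blinfun_apply (D x)) (at x)) \<and> continuous_on UNIV D)"

definition C1c :: "'a::euclidean_space set \<Rightarrow> ('a \<Rightarrow> real) set" where
  "C1c \<Omega> = {u. C1_fun u \<and> compact (closure {x. u x \<noteq> 0}) \<and> closure {x. u x \<noteq> 0} \<subseteq> \<Omega>}"

definition crit_exp :: "nat \<Rightarrow> real \<Rightarrow> real" where
  "crit_exp n \<sigma> = 2 * real n / (real n - 2 * \<sigma>)"

definition gagliardo :: "real \<Rightarrow> 'a::euclidean_space set \<Rightarrow> ('a \<Rightarrow> real) \<Rightarrow> ennreal" where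
  "gagliardo \<sigma> \<Omega> u = (\<integral>\<^sup>+ x. \<integral>\<^sup>+ y. indicator \<Omega> x * indicator \<Omega> y *
       ennreal ((u x - u y)\<^sup>2 / norm (x - y) powr (real DIM('a) + 2 * \<sigma>)) \<partial>lborel \<partial>lborel)"

definition lp_pow :: "real \<Rightarrow> 'a::euclidean_space set \<Rightarrow> ('a \<Rightarrow> real) \<Rightarrow> ennreal" where
  "lp_pow p \<Omega> u = (\<integral>\<^sup>+ x. indicator \<Omega> x * ennreal (\<bar>u x\<bar> powr p) \<partial>lborel)"

definition sob_quot :: "real \<Rightarrow> 'a::euclidean_space set \<Rightarrow> ('a \<Rightarrow> real) \<Rightarrow> real" where
  "sob_quot \<sigma> \<Omega> u = enn2real (gagliardo \<sigma> \<Omega> u) /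
      (enn2real (lp_pow (crit_exp DIM('a) \<sigma>) \<Omega> u)) powr ((real DIM('a) - 2 * \<sigma>) / real DIM('a))"

text \<open>S_{n,sigma}(Omega), infimum over nonzero C^1_c functions (value +infinity if there are none).\<close>
definition S_const :: "real \<Rightarrow> 'a::euclidean_space set \<Rightarrow> ereal" where
  "S_const \<sigma> \<Omega> = (INF u \<in> {u \<in> C1c \<Omega>. \<exists>x. u x \<noteq> 0}. ereal (sob_quot \<sigma> \<Omega> u))"

definition half_space :: "'a::euclidean_space set" where
  "half_space = {x. 0 < x \<bullet> (SOME b. b \<in> Basis)}"

text \<open>The completion of C^1_c(Omega) w.r.t. I, realised (as is legitimate when S(Omega) > 0)
  as the functions in L^p(Omega) approximable by C^1_c functions both in I and in L^p.\<close>
definition H0 :: "real \<Rightarrow> 'a::euclidean_space set \<Rightarrow> ('a \<Rightarrow> real) set" where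
  "H0 \<sigma> \<Omega> = {u. (\<lambda>x. indicator \<Omega> x * u x) \<in> borel_measurable lborel \<and>
      lp_pow (crit_exp DIM('a) \<sigma>) \<Omega> u < \<infinity> \<and>
      (\<exists>\<phi>. (\<forall>k. \<phi> k \<in> C1c \<Omega>) \<and>
         (\<lambda>k. gagliardo \<sigma> \<Omega> (\<lambda>x. \<phi> k x - u x)) \<longlonglongrightarrow> 0 \<and>
         (\<lambda>k. lp_pow (crit_exp DIM('a) \<sigma>) \<Omega> (\<lambda>x. \<phi> k x - u x)) \<longlonglongrightarrow> 0)}"

text \<open>Bounded open set with C^1 boundary: near each boundary point Omega is the
  supergraph of a C^1 function in some direction nu.\<close>
definition C1_boundary :: "'a::euclidean_space set \<Rightarrow> bool" where
  "C1_boundary \<Omega> \<longleftrightarrow> (\<forall>p \<in> frontier \<Omega>. \<exists>r>0. \<exists>\<nu> \<gamma>. norm \<nu> = 1 \<and> C1_fun \<gamma> \<and>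
      (\<forall>x t. \<gamma> (x + t *\<^sub>R \<nu>) = \<gamma> x) \<and>
      \<Omega> \<inter> ball p r = {x \<in> ball p r. x \<bullet> \<nu> > \<gamma> x})"

end

theory Submission
  imports Defs "HOL-Complex_Analysis.Great_Picard"
begin

text \<open>
  Let \<open>u\<^sub>k\<close> be a normalized minimizing sequence with a.e. limit \<open>u\<close>, and write \<open>p\<close> for the critical
  exponent. The Brezis--Lieb lemma, applied in \<open>L\<^sup>p(\<Omega>)\<close> and, with exponent 2, to the
  difference quotients on \<open>\<Omega> \<times> \<Omega>\<close>, splits both the norm and the energy asymptotically into the parts
  carried by \<open>u\<close> and by \<open>u\<^sub>k - u\<close>. The second part tends to 0 in \<open>L\<^sup>2\<close>, and up to an \<open>L\<^sup>2\<close> term every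
  function on \<open>\<Omega>\<close> satisfies the Sobolev inequality with any constant below that of the half-space:
  localize with a quadratic partition of unity and flatten the boundary by nearly isometric \<open>C\<^sup>1\<close>
  charts. As the half-space constant is strictly larger than \<open>S(\<Omega>)\<close>,
  subadditivity of \<open>t \<mapsto> t powr (2/p)\<close> leaves no mass for \<open>u\<^sub>k - u\<close>.

  Compactness in \<open>L\<^sup>2\<close> comes from the Poincare inequality on a finite disjoint family of small
  balls that exhausts \<open>\<Omega>\<close> up to small measure, so no extension operator is needed.
\<close>

section \<open>Continuously differentiable maps\<close>

text \<open>The only compactness extracted from a minimizing sequence is convergence almost
  everywhere along a subsequence; no weak topology on the completion enters. The two splittings then
  become statements about four numbers. If \<open>P\<close> is the limit of the norm integrals and
  the limit function has norm integral \<open>ag\<close> and energy \<open>eg\<close>, the remainder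
  carries \<open>P - ag\<close> and \<open>1 - eg\<close>. Testing the limit against
  \<open>S\<close> and the remainder against a constant \<open>S2 > S\<close> leaves no alternative
  to \<open>ag = P\<close>, and a vanishing limit needs no separate exclusion. Two obstacles shape
  the rest. Membership in \<open>H0\<close> demands approximation by \<open>C1c\<close> functions in
  energy and in norm, which pointwise convergence does not give; it comes from averages of the
  tails, and these averages also stand in for the limit wherever an inequality is known for
  \<open>C1c\<close> only. Secondly, the energy is nonlocal: pairs of points of which only one lies
  in a chart still interact, and cutoffs do not commute with differences. Both effects have a less
  singular kernel and are absorbed into the square norm, while the leading constant stays
  arbitrarily close to that of the half-space.\<close>

definition C1_map :: "('a::real_normed_vector \<Rightarrow> 'b::real_normed_vector) \<Rightarrow> bool" where
  "C1_map f \<longleftrightarrow> (\<exists>D :: 'a \<Rightarrow> ('a \<Rightarrow>\<^sub>L 'b).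
      (\<forall>x. (f has_derivative blinfun_apply (D x)) (at x)) \<and> continuous_on UNIV D)"

lemma C1_fun_iff_C1_map: "C1_fun u \<longleftrightarrow> C1_map u"
  by (simp add: C1_fun_def C1_map_def)

lemma C1_mapI:
  assumes "\<And>x. (f has_derivative blinfun_apply (D x)) (at x)" "continuous_on UNIV D"
  shows "C1_map f"
  using assms unfolding C1_map_def by blast

lemma C1_map_continuous_on: "C1_map f \<Longrightarrow> continuous_on S f"
  unfolding C1_map_def
  by (meson continuous_at_imp_continuous_on has_derivative_continuous)

lemma C1_map_bounded_linear: "bounded_linear f \<Longrightarrow> C1_map f"
  by (rule C1_mapI[of f "\<lambda>x. Blinfun f"])
    (auto simp: bounded_linear_Blinfun_apply bounded_linear_imp_has_derivative)

lemma C1_map_const: "C1_map (\<lambda>x. c)"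
  by (rule C1_mapI[of _ "\<lambda>x. 0"]) (auto simp: zero_blinfun.rep_eq)

lemma C1_map_compose:
  assumes "C1_map f" "C1_map g"
  shows "C1_map (\<lambda>x. g (f x))"
proof -
  obtain D where D: "\<And>x. (f has_derivative blinfun_apply (D x)) (at x)" "continuous_on UNIV D"
    using assms(1) unfolding C1_map_def by blast
  obtain E where E: "\<And>x. (g has_derivative blinfun_apply (E x)) (at x)" "continuous_on UNIV E"
    using assms(2) unfolding C1_map_def by blast
  show ?thesis
  proof (rule C1_mapI[of _ "\<lambda>x. E (f x) o\<^sub>L D x"])
    show "((\<lambda>x. g (f x)) has_derivative blinfun_apply (E (f x) o\<^sub>L D x)) (at x)" for x
      using diff_chain_at[OF D(1) E(1)] by (simp add: o_def blinfun_compose.rep_eq)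
    have "continuous_on UNIV (\<lambda>x. E (f x))"
      by (rule continuous_on_compose2[OF E(2) C1_map_continuous_on[OF assms(1)]]) auto
    then show "continuous_on UNIV (\<lambda>x. E (f x) o\<^sub>L D x)"
      using D(2) by (intro continuous_intros)
  qed
qed

lemma C1_map_add:
  assumes "C1_map f" "C1_map g"
  shows "C1_map (\<lambda>x. f x + g x)"
proof -
  obtain D where D: "\<And>x. (f has_derivative blinfun_apply (D x)) (at x)" "continuous_on UNIV D"
    using assms(1) unfolding C1_map_def by blast
  obtain E where E: "\<And>x. (g has_derivative blinfun_apply (E x)) (at x)" "continuous_on UNIV E"
    using assms(2) unfolding C1_map_def by blast
  show ?thesis
    by (rule C1_mapI[of _ "\<lambda>x. D x + E x"])
      (use D E in \<open>auto simp: plus_blinfun.rep_eq intro!: has_derivative_add continuous_intros\<close>)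
qed

lemma C1_map_scaleR:
  assumes "C1_map f" "C1_map g"
  shows "C1_map (\<lambda>x. f x *\<^sub>R g x)"
proof -
  obtain D where D: "\<And>x. (f has_derivative blinfun_apply (D x)) (at x)" "continuous_on UNIV D"
    using assms(1) unfolding C1_map_def by blast
  obtain E where E: "\<And>x. (g has_derivative blinfun_apply (E x)) (at x)" "continuous_on UNIV E"
    using assms(2) unfolding C1_map_def by blast
  show ?thesis
  proof (rule C1_mapI[of _ "\<lambda>x. f x *\<^sub>R E x + (blinfun_scaleR_left (g x) o\<^sub>L D x)"])
    show "((\<lambda>x. f x *\<^sub>R g x) has_derivative
        blinfun_apply (f x *\<^sub>R E x + (blinfun_scaleR_left (g x) o\<^sub>L D x))) (at x)" for x
      using has_derivative_scaleR[OF D(1) E(1), of x]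
      by (simp add: plus_blinfun.rep_eq scaleR_blinfun.rep_eq blinfun_compose.rep_eq o_def)
    show "continuous_on UNIV (\<lambda>x. f x *\<^sub>R E x + (blinfun_scaleR_left (g x) o\<^sub>L D x))"
      using D(2) E(2) C1_map_continuous_on[OF assms(1), of UNIV] C1_map_continuous_on[OF assms(2), of UNIV]
      by (intro continuous_intros bounded_linear.continuous_on[OF bounded_linear_blinfun_scaleR_left])
  qed
qed

lemma C1_map_mult: "C1_map f \<Longrightarrow> C1_map g \<Longrightarrow> C1_map (\<lambda>x. f x * g x :: real)"
  using C1_map_scaleR[of f g] by simp

lemma C1_map_diff: "C1_map f \<Longrightarrow> C1_map g \<Longrightarrow> C1_map (\<lambda>x. f x - g x)"
  using C1_map_add[of f "\<lambda>x. (-1) *\<^sub>R g x"] C1_map_scaleR[OF C1_map_const, of g "-1"] by simp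

lemma C1_map_sum:
  assumes "finite I" "\<And>i. i \<in> I \<Longrightarrow> C1_map (f i)"
  shows "C1_map (\<lambda>x. \<Sum>i\<in>I. f i x)"
  using assms by (induction I rule: finite_induct) (auto intro: C1_map_const C1_map_add)

lemma C1_map_real_compose:
  fixes f :: "'a::real_normed_vector \<Rightarrow> real"
  assumes "C1_map f" "\<And>x. (g has_real_derivative g' (f x)) (at (f x))" "continuous_on (range f) g'"
  shows "C1_map (\<lambda>x. g (f x))"
proof -
  obtain D where D: "\<And>x. (f has_derivative blinfun_apply (D x)) (at x)" "continuous_on UNIV D"
    using assms(1) unfolding C1_map_def by blast
  show ?thesis
  proof (rule C1_mapI[of _ "\<lambda>x. g' (f x) *\<^sub>R D x"])
    show "((\<lambda>x. g (f x)) has_derivative blinfun_apply (g' (f x) *\<^sub>R D x)) (at x)" for x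
      using diff_chain_at[OF D(1) has_field_derivative_imp_has_derivative[OF assms(2)], of x]
      by (simp add: o_def scaleR_blinfun.rep_eq)
    have "continuous_on UNIV (\<lambda>x. g' (f x))"
      by (rule continuous_on_compose2[OF assms(3) C1_map_continuous_on[OF assms(1)]]) auto
    then show "continuous_on UNIV (\<lambda>x. g' (f x) *\<^sub>R D x)"
      using D(2) by (intro continuous_intros)
  qed
qed

text \<open>Squaring makes the positive part continuously differentiable. This supplies both the
  bump functions and the positive floor under the denominator in the partition of unity.\<close>

lemma has_real_derivative_max_0_power2: "((\<lambda>t::real. (max 0 t)\<^sup>2) has_real_derivative 2 * max 0 t) (at t)"
proof -
  consider "t > 0" | "t < 0" | "t = 0" by linarith
  then show ?thesis
  proof cases
    case 1
    have "((\<lambda>t::real. t\<^sup>2) has_real_derivative 2 * max 0 t) (at t)"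
      using 1 by (auto intro!: derivative_eq_intros)
    moreover have "eventually (\<lambda>s. s\<^sup>2 = (max 0 s)\<^sup>2) (nhds t)"
      using eventually_nhds_in_open[of "{0<..}" t] 1 by (auto elim!: eventually_mono)
    ultimately show ?thesis by (subst (asm) DERIV_cong_ev[OF refl _ refl])
  next
    case 2
    have "((\<lambda>t::real. 0) has_real_derivative 2 * max 0 t) (at t)"
      using 2 by (auto intro!: derivative_eq_intros)
    moreover have "eventually (\<lambda>s. 0 = (max 0 s)\<^sup>2) (nhds t)"
      using eventually_nhds_in_open[of "{..<0}" t] 2 by (auto elim!: eventually_mono)
    ultimately show ?thesis by (subst (asm) DERIV_cong_ev[OF refl _ refl])
  next
    case 3
    have "((\<lambda>s::real. (max 0 s)\<^sup>2 / s) \<longlongrightarrow> 0) (at 0)"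
    proof (rule Lim_null_comparison)
      show "\<forall>\<^sub>F s in at 0. norm ((max 0 s)\<^sup>2 / s) \<le> \<bar>s :: real\<bar>"
      proof (rule always_eventually, rule allI)
        fix s :: real
        show "norm ((max 0 s)\<^sup>2 / s) \<le> \<bar>s\<bar>"
          by (cases "s > 0") (auto simp: power2_eq_square max_def)
      qed
      show "((\<lambda>s::real. \<bar>s\<bar>) \<longlongrightarrow> 0) (at 0)"
        by (rule tendsto_rabs_zero) (rule tendsto_ident_at)
    qed
    then show ?thesis using 3 by (simp add: DERIV_def)
  qed
qed

lemma C1_map_max_0_power2: "C1_map f \<Longrightarrow> C1_map (\<lambda>x. (max 0 (f x :: real))\<^sup>2)"
  by (rule C1_map_real_compose[where g = "\<lambda>t. (max 0 t)\<^sup>2" and g' = "\<lambda>t. 2 * max 0 t"])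
    (auto intro!: has_real_derivative_max_0_power2 continuous_intros)

lemma C1_map_divide_sqrt:
  assumes "C1_map f" "C1_map g" "\<And>x. 0 < g x"
  shows "C1_map (\<lambda>x. f x / sqrt (g x) :: real)"
proof -
  have "C1_map (\<lambda>x. 1 / sqrt (g x))"
  proof (rule C1_map_real_compose[where g = "\<lambda>t. 1 / sqrt t" and g' = "\<lambda>t. - (inverse (sqrt t) / 2) / (sqrt t * sqrt t)"])
    show "((\<lambda>t. 1 / sqrt t) has_real_derivative - (inverse (sqrt (g x)) / 2) / (sqrt (g x) * sqrt (g x))) (at (g x))" for x
      using assms(3)[of x] by (auto intro!: derivative_eq_intros simp: field_simps)
    show "continuous_on (range g) (\<lambda>t. - (inverse (sqrt t) / 2) / (sqrt t * sqrt t))"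
      using assms(3) by (intro continuous_intros) (auto simp: less_imp_neq[symmetric])
  qed (rule assms(2))
  then have "C1_map (\<lambda>x. f x * (1 / sqrt (g x)))"
    by (rule C1_map_mult[OF assms(1)])
  then show ?thesis by simp
qed

section \<open>The class of compactly supported C^1 functions\<close>

lemma C1cI:
  assumes "C1_map u" "{x. u x \<noteq> 0} \<subseteq> K" "compact K" "K \<subseteq> \<Omega>"
  shows "u \<in> C1c \<Omega>"
proof -
  have "closure {x. u x \<noteq> 0} \<subseteq> K"
    using assms(2,3) by (simp add: closure_minimal compact_imp_closed)
  then show ?thesis
    using assms unfolding C1c_def C1_fun_iff_C1_map
    by (auto simp: compact_eq_bounded_closed intro: bounded_subset)
qed

lemma C1cE:
  assumes "u \<in> C1c \<Omega>"
  obtains K where "C1_map u" "{x. u x \<noteq> 0} \<subseteq> K" "compact K" "K \<subseteq> \<Omega>"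
  using assms closure_subset[of "{x. u x \<noteq> 0}"] unfolding C1c_def C1_fun_iff_C1_map by blast

lemma C1c_zero_outside: "u \<in> C1c \<Omega> \<Longrightarrow> x \<notin> \<Omega> \<Longrightarrow> u x = 0"
  by (elim C1cE) auto

lemma C1c_mult:
  assumes "C1_map g" "u \<in> C1c \<Omega>"
  shows "(\<lambda>x. g x * u x) \<in> C1c \<Omega>"
proof -
  obtain K where K: "C1_map u" "{x. u x \<noteq> 0} \<subseteq> K" "compact K" "K \<subseteq> \<Omega>"
    using assms(2) by (rule C1cE)
  show ?thesis
    by (rule C1cI[where K = K]) (use K in \<open>auto intro!: C1_map_mult assms(1)\<close>)
qed

lemma C1c_cmult: "u \<in> C1c \<Omega> \<Longrightarrow> (\<lambda>x. c * u x) \<in> C1c \<Omega>"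
  by (rule C1c_mult[OF C1_map_const])

lemma C1c_add:
  assumes "u \<in> C1c \<Omega>" "v \<in> C1c \<Omega>"
  shows "(\<lambda>x. u x + v x) \<in> C1c \<Omega>"
proof -
  obtain K where K: "C1_map u" "{x. u x \<noteq> 0} \<subseteq> K" "compact K" "K \<subseteq> \<Omega>"
    using assms(1) by (rule C1cE)
  obtain L where L: "C1_map v" "{x. v x \<noteq> 0} \<subseteq> L" "compact L" "L \<subseteq> \<Omega>"
    using assms(2) by (rule C1cE)
  have "{x. u x + v x \<noteq> 0} \<subseteq> K \<union> L" using K(2) L(2) by force
  then show ?thesis
    by (rule C1cI[where K = "K \<union> L", rotated]) (use K L in \<open>auto intro!: C1_map_add\<close>)
qed

lemma C1c_diff:
  assumes "u \<in> C1c \<Omega>" "v \<in> C1c \<Omega>"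
  shows "(\<lambda>x. u x - v x) \<in> C1c \<Omega>"
  using C1c_add[OF assms(1) C1c_cmult[OF assms(2), of "-1"]] by simp

lemma C1c_continuous_on: "u \<in> C1c \<Omega> \<Longrightarrow> continuous_on S u"
  by (elim C1cE) (rule C1_map_continuous_on)

lemma C1c_borel_measurable: "u \<in> C1c \<Omega> \<Longrightarrow> u \<in> borel_measurable borel"
  by (intro borel_measurable_continuous_onI C1c_continuous_on)

lemma C1c_bounded:
  assumes "u \<in> C1c \<Omega>"
  obtains B where "\<And>x. \<bar>u x\<bar> \<le> B"
proof -
  obtain K where K: "C1_map u" "{x. u x \<noteq> 0} \<subseteq> K" "compact K" "K \<subseteq> \<Omega>"
    using assms by (rule C1cE)
  have "compact (u ` K)" using K by (intro compact_continuous_image C1_map_continuous_on)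
  then obtain B where "\<And>y. y \<in> u ` K \<Longrightarrow> norm y \<le> B" using compact_imp_bounded bounded_iff by metis
  then have "\<bar>u x\<bar> \<le> max B 0" for x
    using K(2) by (cases "u x = 0") (force simp: le_max_iff_disj)+
  then show thesis by (rule that)
qed

text \<open>Off the compact set the function is locally zero, so its derivative vanishes there; on
  the compact set the derivative is bounded by continuity. The mean value inequality then applies on
  the convex set \<open>UNIV\<close>.\<close>

lemma C1c_Lipschitz:
  assumes "u \<in> C1c \<Omega>"
  obtains L where "L \<ge> 0" "\<And>x y. \<bar>u x - u y\<bar> \<le> L * norm (x - y)"
proof -
  obtain K where K: "C1_map u" "{x. u x \<noteq> 0} \<subseteq> K" "compact K" "K \<subseteq> \<Omega>"
    using assms by (rule C1cE)
  obtain D where D: "\<And>x. (u has_derivative blinfun_apply (D x)) (at x)" "continuous_on UNIV D"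
    using K(1) unfolding C1_map_def by blast
  have "compact (D ` K)" using K D(2) by (intro compact_continuous_image) (auto intro: continuous_on_subset)
  then obtain B where B: "\<And>y. y \<in> D ` K \<Longrightarrow> norm y \<le> B" using compact_imp_bounded bounded_iff by metis
  have DB: "norm (D x) \<le> max B 0" for x
  proof (cases "x \<in> K")
    case False
    have "open (- K)" using K(3) by (simp add: compact_imp_closed open_Compl)
    have "(u has_derivative (\<lambda>h. 0)) (at x)"
      by (rule has_derivative_transform_within_open[of "\<lambda>x. 0" _ x UNIV "-K"])
        (use False K(2) \<open>open (-K)\<close> in \<open>auto simp: subset_iff\<close>)
    then have "blinfun_apply (D x) = (\<lambda>h. 0)"
      using D(1)[of x] has_derivative_unique by blast
    then have "D x = 0" by (intro blinfun_eqI) simp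
    then show ?thesis by simp
  qed (use B in \<open>force simp: le_max_iff_disj\<close>)
  have "norm (u x - u y) \<le> max B 0 * norm (x - y)" for x y
    by (rule differentiable_bound[where S = UNIV and f' = "\<lambda>x. blinfun_apply (D x)"])
      (use D(1) DB in \<open>auto simp: norm_blinfun.rep_eq[symmetric]\<close>)
  then show thesis by (intro that[of "max B 0"]) auto
qed

text \<open>The image under \<open>\<Phi>\<close> of the old support serves as the new compact set,
  so \<open>\<Phi>\<close> only has to be continuous. The set \<open>B\<close> is the region in
  which a chart is known to send \<Omega> into the half-space.\<close>

lemma C1c_compose:
  assumes u: "u \<in> C1c \<Omega>" and \<Psi>: "C1_map \<Psi>" and \<Phi>: "continuous_on UNIV \<Phi>"
    and inv: "\<And>z. \<Phi> (\<Psi> z) = z"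
    and sub: "closure {x. u x \<noteq> 0} \<subseteq> B" "\<Phi> ` (\<Omega> \<inter> B) \<subseteq> H"
  shows "(\<lambda>z. u (\<Psi> z)) \<in> C1c H"
proof -
  let ?K = "closure {x. u x \<noteq> 0}"
  have K: "C1_map u" "compact ?K" "?K \<subseteq> \<Omega>"
    using u unfolding C1c_def C1_fun_iff_C1_map by auto
  show ?thesis
  proof (rule C1cI[where K = "\<Phi> ` ?K"])
    show "C1_map (\<lambda>z. u (\<Psi> z))" using \<Psi> K(1) by (rule C1_map_compose)
    show "compact (\<Phi> ` ?K)" using K(2) \<Phi> by (intro compact_continuous_image) (auto intro: continuous_on_subset)
    show "\<Phi> ` ?K \<subseteq> H" using K(3) sub by blast
    show "{z. u (\<Psi> z) \<noteq> 0} \<subseteq> \<Phi> ` ?K"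
    proof safe
      fix z assume "u (\<Psi> z) \<noteq> 0"
      then have "\<Psi> z \<in> ?K" using closure_subset[of "{x. u x \<noteq> 0}"] by blast
      then show "z \<in> \<Phi> ` ?K" using inv[of z] by (metis image_eqI)
    qed
  qed
qed

section \<open>Singular kernels\<close>

lemma member_le_suminf_ennreal: "f k \<le> suminf f" for f :: "nat \<Rightarrow> ennreal"
  using sum_le_suminf[OF summableI, of "{k}" f] by simp

text \<open>A dyadic decomposition in place of polar coordinates: on a shell the kernel is at most
  \<open>1 / (r k / 2) powr s\<close>, and the shell has volume at most that of
  \<open>ball 0 (r k)\<close>. Radii shrinking to 0 give integrability at the origin, growing radii
  give integrability at infinity.\<close>

lemma nn_integral_shells_finite:
  fixes f :: "'a::euclidean_space \<Rightarrow> real" and s :: real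
  assumes s: "s \<ge> 0" and r: "\<And>k. r k > 0"
    and sm: "summable (\<lambda>k. (r k) powr (real DIM('a) - s))"
    and A: "\<And>z. z \<in> A \<Longrightarrow> \<exists>k. r k / 2 \<le> norm z \<and> norm z < r k"
  shows "(\<integral>\<^sup>+ z. indicator A z * ennreal (1 / norm z powr s) \<partial>(lborel :: 'a measure)) < \<infinity>"
proof -
  define c where "c = unit_ball_vol (real DIM('a)) * 2 powr s"
  have c0: "c \<ge> 0" unfolding c_def by simp
  have "(\<integral>\<^sup>+ z. indicator A z * ennreal (1 / norm z powr s) \<partial>(lborel :: 'a measure))
     \<le> (\<integral>\<^sup>+ z. (\<Sum>k. ennreal (1 / (r k / 2) powr s) * indicator (ball 0 (r k)) z) \<partial>(lborel :: 'a measure))"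
  proof (rule nn_integral_mono)
    fix z :: 'a
    show "indicator A z * ennreal (1 / norm z powr s)
      \<le> (\<Sum>k. ennreal (1 / (r k / 2) powr s) * indicator (ball 0 (r k)) z)"
    proof (cases "z \<in> A")
      case True
      then obtain k where k: "r k / 2 \<le> norm z" "norm z < r k" using A by blast
      have "(r k / 2) powr s \<le> norm z powr s" using k r[of k] s by (intro powr_mono2) auto
      then have "1 / norm z powr s \<le> 1 / (r k / 2) powr s"
        using r[of k] by (intro divide_left_mono) (auto intro!: mult_pos_pos simp: k)
      then have "indicator A z * ennreal (1 / norm z powr s)
        \<le> ennreal (1 / (r k / 2) powr s) * indicator (ball 0 (r k)) z"
        using True k by (simp add: ennreal_leI)
      also have "\<dots> \<le> (\<Sum>k. ennreal (1 / (r k / 2) powr s) * indicator (ball 0 (r k)) z)"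
        by (rule member_le_suminf_ennreal[where f = "\<lambda>k. ennreal (1 / (r k / 2) powr s) * indicator (ball 0 (r k)) z"])
      finally show ?thesis .
    qed simp
  qed
  also have "\<dots> = (\<Sum>k. \<integral>\<^sup>+ z. ennreal (1 / (r k / 2) powr s) * indicator (ball 0 (r k)) z \<partial>(lborel :: 'a measure))"
  proof (rule nn_integral_suminf)
    fix k
    have "ball 0 (r k) \<in> sets (lborel :: 'a measure)" by simp
    then show "(\<lambda>z. ennreal (1 / (r k / 2) powr s) * indicator (ball 0 (r k)) z) \<in> borel_measurable (lborel :: 'a measure)"
      by (rule borel_measurable_times_ennreal[OF borel_measurable_const borel_measurable_indicator])
  qed
  also have "\<dots> = (\<Sum>k. ennreal (c * (r k) powr (real DIM('a) - s)))"
  proof (rule suminf_cong)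
    fix k
    have "(\<integral>\<^sup>+ z. ennreal (1 / (r k / 2) powr s) * indicator (ball 0 (r k)) z \<partial>(lborel :: 'a measure))
      = ennreal (1 / (r k / 2) powr s) * ennreal (unit_ball_vol (real DIM('a)) * r k ^ DIM('a))"
      using emeasure_ball[of "r k" "0::'a"] r[of k] by (subst nn_integral_cmult_indicator) auto
    also have "\<dots> = ennreal (1 / (r k / 2) powr s * (unit_ball_vol (real DIM('a)) * r k ^ DIM('a)))"
      using r[of k] by (subst ennreal_mult) auto
    also have "1 / (r k / 2) powr s * (unit_ball_vol (real DIM('a)) * r k ^ DIM('a))
       = c * (r k) powr (real DIM('a) - s)"
      using r[of k] by (simp add: c_def powr_diff powr_divide powr_realpow[symmetric] field_simps)
    finally show "(\<integral>\<^sup>+ z. ennreal (1 / (r k / 2) powr s) * indicator (ball 0 (r k)) z \<partial>(lborel :: 'a measure))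
       = ennreal (c * (r k) powr (real DIM('a) - s))" .
  qed
  also have "\<dots> = ennreal (\<Sum>k. c * (r k) powr (real DIM('a) - s))"
    using c0 sm by (intro suminf_ennreal_eq sums_mult) (auto intro!: summable_sums summable_mult)
  also have "\<dots> < \<infinity>" by simp
  finally show ?thesis .
qed

lemma summable_powr_geometric:
  fixes q a b :: real
  assumes "q > 0" "a > 0" "q powr b < 1"
  shows "summable (\<lambda>k::nat. (a * q ^ k) powr b)"
proof -
  have "(a * q ^ k) powr b = a powr b * (q powr b) ^ k" for k :: nat
    using assms by (simp add: powr_mult powr_realpow[symmetric] powr_powr mult.commute)
  moreover have "summable (\<lambda>k. a powr b * (q powr b) ^ k)"
    using assms by (intro summable_mult summable_geometric) auto
  ultimately show ?thesis by simp
qed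

lemma nn_integral_kernel_near_finite:
  assumes "0 \<le> s" "s < real DIM('a::euclidean_space)"
  shows "(\<integral>\<^sup>+ z. indicator (ball 0 R) z * ennreal (1 / norm z powr s) \<partial>(lborel :: 'a measure)) < \<infinity>"
proof (cases "R > 0")
  case True
  \<comment> \<open>The origin lies in no shell. Removing it changes nothing, not even pointwise,
    because the kernel there is \<open>1 / 0 = 0\<close>.\<close>
  let ?A = "ball 0 R - {0} :: 'a set"
  have "(\<integral>\<^sup>+ z. indicator ?A z * ennreal (1 / norm z powr s) \<partial>(lborel :: 'a measure)) < \<infinity>"
  proof (rule nn_integral_shells_finite[where r = "\<lambda>k. R * (1/2) ^ k"])
    show "summable (\<lambda>k. (R * (1/2) ^ k) powr (real DIM('a) - s))"
    proof (rule summable_powr_geometric)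
      show "(1/2 :: real) powr (real DIM('a) - s) < 1"
        using powr_less_mono2[of "real DIM('a) - s" "1/2" 1] assms(2) by simp
    qed (use True in auto)
    fix z :: 'a assume z: "z \<in> ?A"
    then have nz: "0 < norm z" "norm z < R" by auto
    have "\<exists>n. R * (1/2) ^ n \<le> norm z"
    proof -
      obtain n where "(1/2 :: real) ^ n < norm z / R"
        using real_arch_pow_inv[of "norm z / R" "1/2"] nz True by auto
      then show ?thesis using True by (intro exI[of _ n]) (simp add: field_simps)
    qed
    define n where "n = (LEAST n. R * (1/2) ^ n \<le> norm z)"
    have n: "R * (1/2) ^ n \<le> norm z" unfolding n_def by (rule LeastI_ex) fact
    have "n \<noteq> 0" using n nz by (intro notI) auto
    then obtain k where k: "n = Suc k" by (cases n) auto
    have "\<not> R * (1/2) ^ k \<le> norm z"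
      using not_less_Least[of k "\<lambda>n. R * (1/2) ^ n \<le> norm z"] k unfolding n_def by auto
    then show "\<exists>k. R * (1/2) ^ k / 2 \<le> norm z \<and> norm z < R * (1/2) ^ k"
      using n k by (intro exI[of _ k]) auto
  qed (use assms True in auto)
  moreover have "(\<integral>\<^sup>+ z. indicator ?A z * ennreal (1 / norm z powr s) \<partial>(lborel :: 'a measure))
    = (\<integral>\<^sup>+ z. indicator (ball 0 R) z * ennreal (1 / norm z powr s) \<partial>(lborel :: 'a measure))"
    by (rule nn_integral_cong) (auto simp: indicator_def)
  ultimately show ?thesis by simp
next
  case False
  then have "indicator (ball 0 R) z * ennreal (1 / norm z powr s) = 0" for z :: 'a
    using norm_ge_zero[of z] by (simp add: indicator_def del: norm_ge_zero)
  then show ?thesis by (simp only: nn_integral_0_iff_AE nn_integral_const) simp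
qed

lemma nn_integral_kernel_far_finite:
  assumes "s > real DIM('a::euclidean_space)" "d > 0"
  shows "(\<integral>\<^sup>+ z. indicator {z. d \<le> norm z} z * ennreal (1 / norm z powr s) \<partial>(lborel :: 'a measure)) < \<infinity>"
\<comment> \<open>The factor 2 in front of \<open>d\<close> makes the innermost shell begin exactly
  at radius \<open>d\<close>.\<close>
proof (rule nn_integral_shells_finite[where r = "\<lambda>k. (2 * d) * 2 ^ k"])
  show "summable (\<lambda>k. (2 * d * 2 ^ k) powr (real DIM('a) - s))"
  proof (rule summable_powr_geometric)
    show "(2 :: real) powr (real DIM('a) - s) < 1"
      using powr_less_mono[of "real DIM('a) - s" 0 2] assms(1) by simp
  qed (use assms in auto)
  fix z :: 'a assume z: "z \<in> {z. d \<le> norm z}"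
  have "\<exists>n. norm z < 2 * d * 2 ^ n"
  proof -
    obtain n where "norm z / d < 2 ^ n" using real_arch_pow[of 2 "norm z / d"] by auto
    then have "norm z < d * 2 ^ n" using assms by (simp add: field_simps)
    moreover have "0 < d * 2 ^ n" using assms by simp
    ultimately show ?thesis by (intro exI[of _ n]) linarith
  qed
  define n where "n = (LEAST n. norm z < 2 * d * 2 ^ n)"
  have n: "norm z < 2 * d * 2 ^ n" unfolding n_def by (rule LeastI_ex) fact
  have "2 * d * 2 ^ n / 2 \<le> norm z"
  proof (cases n)
    case 0
    then show ?thesis using z by simp
  next
    case (Suc k)
    then have "\<not> norm z < 2 * d * 2 ^ k"
      using not_less_Least[of k "\<lambda>n. norm z < 2 * d * 2 ^ n"] unfolding n_def by auto
    then show ?thesis using Suc by simp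
  qed
  then show "\<exists>k. 2 * d * 2 ^ k / 2 \<le> norm z \<and> norm z < 2 * d * 2 ^ k"
    using n by blast
qed (use assms in auto)

lemma nn_integral_translate:
  fixes x :: "'a::euclidean_space"
  assumes "g \<in> borel_measurable borel"
  shows "(\<integral>\<^sup>+ y. g (x - y) \<partial>lborel) = (\<integral>\<^sup>+ y. g y \<partial>lborel)"
proof -
  have "(\<integral>\<^sup>+ y. g (x - y) \<partial>lborel) = (\<integral>\<^sup>+ y. g (x - y) \<partial>(density (distr lborel borel (\<lambda>y. x + (-1) *\<^sub>R y)) (\<lambda>_. 1)))"
    using lborel_affine[of "-1" x] by simp
  also have "\<dots> = (\<integral>\<^sup>+ y. g y \<partial>lborel)"
    using assms by (simp add: nn_integral_density nn_integral_distr)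
  finally show ?thesis .
qed

section \<open>Change of variables for Lipschitz maps\<close>

text \<open>Vitali's theorem delivers a countable index set without an enumeration, hence the sum is
  written as an integral over \<open>count_space\<close>.\<close>

lemma emeasure_UN_countable_subadditive:
  assumes [measurable]: "\<And>i. i \<in> I \<Longrightarrow> X i \<in> sets M" and I: "countable I"
  shows "emeasure M (\<Union>i\<in>I. X i) \<le> (\<integral>\<^sup>+ i. emeasure M (X i) \<partial>count_space I)"
proof -
  have "emeasure M (\<Union>i\<in>I. X i) = (\<integral>\<^sup>+ x. indicator (\<Union>i\<in>I. X i) x \<partial>M)"
    by (rule nn_integral_indicator[symmetric], rule sets.countable_UN'[OF I]) auto
  also have "\<dots> \<le> (\<integral>\<^sup>+ x. \<integral>\<^sup>+ i. indicator (X i) x \<partial>count_space I \<partial>M)"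
  proof (rule nn_integral_mono)
    fix x
    show "indicator (\<Union>i\<in>I. X i) x \<le> (\<integral>\<^sup>+ i. indicator (X i) x \<partial>count_space I)"
    proof (cases "x \<in> (\<Union>i\<in>I. X i)")
      case True
      then obtain i where i: "i \<in> I" "x \<in> X i" by blast
      have "indicator (X i) x \<le> (\<integral>\<^sup>+ i. indicator (X i) x \<partial>count_space I)"
        by (rule nn_integral_ge_point[OF i(1), of "\<lambda>i. indicator (X i) x"])
      then show ?thesis using True i by simp
    qed simp
  qed
  also have "\<dots> = (\<integral>\<^sup>+ i. \<integral>\<^sup>+ x. indicator (X i) x \<partial>M \<partial>count_space I)"
    using I by (rule nn_integral_count_space_nn_integral) auto
  also have "\<dots> = (\<integral>\<^sup>+ i. emeasure M (X i) \<partial>count_space I)"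
    by (rule nn_integral_cong) auto
  finally show ?thesis .
qed

text \<open>That the factor is \<open>L ^ DIM('a)\<close> without a dimensional constant is the
  point: it must tend to 1 with \<open>L\<close>. Vitali's theorem exhausts \<open>W\<close> by
  disjoint balls up to a null set, each ball is mapped into a ball with radius larger by the factor
  \<open>L\<close>, and Lipschitz maps preserve null sets.\<close>

lemma emeasure_Lipschitz_image_open_le:
  fixes \<Phi> :: "'a::euclidean_space \<Rightarrow> 'a"
  assumes L: "L > 0" and W: "open W"
    and lip: "\<And>x y. x \<in> W \<Longrightarrow> y \<in> W \<Longrightarrow> norm (\<Phi> x - \<Phi> y) \<le> L * norm (x - y)"
    and m: "\<Phi> ` W \<in> sets borel"
  shows "emeasure lborel (\<Phi> ` W) \<le> ennreal (L ^ DIM('a)) * emeasure lborel W"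
proof -
  let ?K = "{(c, r). 0 < r \<and> ball c r \<subseteq> W} :: ('a \<times> real) set"
  obtain C where C: "countable C" "C \<subseteq> ?K"
     "pairwise (\<lambda>i j. disjnt (ball (fst i) (snd i)) (ball (fst j) (snd j))) C"
     "negligible (W - (\<Union>i\<in>C. ball (fst i) (snd i)))"
  proof (rule Vitali_covering_theorem_balls[of W ?K fst snd])
    fix x and d :: real assume "x \<in> W" "0 < d"
    then obtain e where "e > 0" "ball x e \<subseteq> W" using W open_contains_ball by blast
    then show "\<exists>i. i \<in> ?K \<and> x \<in> ball (fst i) (snd i) \<and> snd i < d"
      using \<open>0 < d\<close> by (intro exI[of _ "(x, min e (d/2))"]) auto
  qed blast
  let ?B = "\<lambda>i. ball (fst i) (snd i)" and ?B' = "\<lambda>i. cball (\<Phi> (fst i)) (L * snd i)"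
  define N where "N = W - (\<Union>i\<in>C. ?B i)"
  have "negligible (\<Phi> ` N)"
  proof (rule negligible_locally_Lipschitz_image)
    fix x assume "x \<in> N"
    then show "\<exists>T B. open T \<and> x \<in> T \<and> (\<forall>y\<in>N \<inter> T. norm (\<Phi> y - \<Phi> x) \<le> B * norm (y - x))"
      using lip W by (intro exI[of _ W] exI[of _ L]) (auto simp: N_def)
  qed (use C(4) in \<open>auto simp: N_def\<close>)
  then have "\<Phi> ` N \<in> null_sets lebesgue" by (simp add: negligible_iff_null_sets)
  \<comment> \<open>The image of the null set need not be Borel, so a Borel null set containing it
    takes its place in the cover.\<close>
  then obtain N' where N': "N' \<in> null_sets lborel" "\<Phi> ` N \<subseteq> N'"
    unfolding null_sets_completion_iff2 by blast
  have "emeasure lborel (\<Phi> ` W) \<le> emeasure lborel (N' \<union> (\<Union>i\<in>C. ?B' i))"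
  proof (rule emeasure_mono)
    show "\<Phi> ` W \<subseteq> N' \<union> (\<Union>i\<in>C. ?B' i)"
    proof
      fix y assume "y \<in> \<Phi> ` W"
      then obtain x where x: "x \<in> W" "y = \<Phi> x" by blast
      show "y \<in> N' \<union> (\<Union>i\<in>C. ?B' i)"
      proof (cases "x \<in> N")
        case False
        then obtain i where i: "i \<in> C" "x \<in> ?B i" using x unfolding N_def by blast
        then have b: "?B i \<subseteq> W" "0 < snd i" using subsetD[OF C(2) i(1)] by (auto simp: case_prod_beta)
        then have "norm (\<Phi> (fst i) - \<Phi> x) \<le> L * norm (fst i - x)"
          using i by (intro lip) auto
        also have "\<dots> \<le> L * snd i" using i L by (auto simp: dist_norm)
        finally show ?thesis using i x by (auto simp: dist_norm)
      qed (use N' x in blast)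
    qed
    show "N' \<union> (\<Union>i\<in>C. ?B' i) \<in> sets lborel"
      using N' C(1) by (intro sets.Un sets.countable_UN') auto
  qed
  also have "\<dots> \<le> emeasure lborel N' + emeasure lborel (\<Union>i\<in>C. ?B' i)"
    using N' C(1) by (intro emeasure_subadditive sets.countable_UN') auto
  also have "emeasure lborel N' = 0" using N' by auto
  also have "emeasure lborel (\<Union>i\<in>C. ?B' i) \<le> (\<integral>\<^sup>+ i. emeasure lborel (?B' i) \<partial>count_space C)"
    using C(1) by (intro emeasure_UN_countable_subadditive) auto
  also have "\<dots> = (\<integral>\<^sup>+ i. ennreal (L ^ DIM('a)) * emeasure lborel (?B i) \<partial>count_space C)"
  proof (rule nn_integral_cong)
    fix i assume "i \<in> space (count_space C)"
    then have i: "0 < snd i" using C(2) by auto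
    have "emeasure lborel (?B' i) = ennreal (unit_ball_vol (real DIM('a)) * (L * snd i) ^ DIM('a))"
      using emeasure_cball[of "L * snd i" "\<Phi> (fst i)"] i L by simp
    also have "\<dots> = ennreal (L ^ DIM('a)) * ennreal (unit_ball_vol (real DIM('a)) * snd i ^ DIM('a))"
      using i L by (subst ennreal_mult[symmetric]) (auto simp: power_mult_distrib mult_ac)
    also have "\<dots> = ennreal (L ^ DIM('a)) * emeasure lborel (?B i)"
      using emeasure_ball[of "snd i" "fst i"] i by simp
    finally show "emeasure lborel (?B' i) = ennreal (L ^ DIM('a)) * emeasure lborel (?B i)" .
  qed
  also have "\<dots> = ennreal (L ^ DIM('a)) * (\<integral>\<^sup>+ i. emeasure lborel (?B i) \<partial>count_space C)"
    by (rule nn_integral_cmult) auto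
  also have "(\<integral>\<^sup>+ i. emeasure lborel (?B i) \<partial>count_space C) = emeasure lborel (\<Union>i\<in>C. ?B i)"
    using C(1,3) by (intro emeasure_UN_countable[symmetric])
      (auto simp: disjoint_family_on_def pairwise_def disjnt_def)
  also have "\<dots> \<le> emeasure lborel W"
    using C(2) W by (intro emeasure_mono) (force simp: subset_iff)+
  finally show ?thesis by (simp add: mult_left_mono)
qed

text \<open>By outer regularity a Borel set is enclosed in an open set of almost the same measure,
  where the Vitali estimate is available. Images under \<open>\<Phi>\<close> are written as
  preimages under the continuous inverse \<open>\<Psi>\<close>, which keeps them Borel.\<close>

lemma emeasure_Lipschitz_image_le:
  fixes \<Phi> \<Psi> :: "'a::euclidean_space \<Rightarrow> 'a"
  assumes L: "L > 0" and U: "open U"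
    and lip: "\<And>x y. x \<in> U \<Longrightarrow> y \<in> U \<Longrightarrow> norm (\<Phi> x - \<Phi> y) \<le> L * norm (x - y)"
    and \<Psi>: "continuous_on UNIV \<Psi>" and inv: "\<And>x. \<Psi> (\<Phi> x) = x" "\<And>z. \<Phi> (\<Psi> z) = z"
    and A: "A \<in> sets borel" "A \<subseteq> U"
  shows "emeasure lborel (\<Psi> -` A) \<le> ennreal (L ^ DIM('a)) * emeasure lborel A"
proof (rule ennreal_le_epsilon)
  have vim: "\<Psi> -` X = \<Phi> ` X" for X
  proof safe
    fix z assume "\<Psi> z \<in> X"
    then show "z \<in> \<Phi> ` X" using inv(2)[of z] by (metis imageI)
  qed (simp add: inv(1))
  have \<Psi>m: "\<Psi> \<in> borel_measurable borel" using \<Psi> by (rule borel_measurable_continuous_onI)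
  fix e :: real assume "0 < e"
  then have e': "e / L ^ DIM('a) > 0" using L by simp
  obtain V where V: "open V" "A \<subseteq> V" "emeasure lborel (V - A) < e / L ^ DIM('a)"
    by (rule outer_regular_lborel[OF A(1) e'])
  let ?W = "V \<inter> U"
  have oW: "open (\<Psi> -` ?W)"
    using V U \<Psi> by (auto simp: continuous_on_open_vimage)
  have "emeasure lborel (\<Psi> -` A) \<le> emeasure lborel (\<Phi> ` ?W)"
    unfolding vim[symmetric] using V A oW
    by (intro emeasure_mono) auto
  also have "\<dots> \<le> ennreal (L ^ DIM('a)) * emeasure lborel ?W"
  proof (rule emeasure_Lipschitz_image_open_le)
    show "\<Phi> ` ?W \<in> sets borel" unfolding vim[symmetric]
      using oW by (rule borel_open)
  qed (use L V U lip in auto)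
  also have "\<dots> \<le> ennreal (L ^ DIM('a)) * (emeasure lborel A + emeasure lborel (V - A))"
  proof (rule mult_left_mono)
    have "emeasure lborel ?W \<le> emeasure lborel (A \<union> (V - A))"
      using V(1) A by (intro emeasure_mono) auto
    also have "\<dots> \<le> emeasure lborel A + emeasure lborel (V - A)"
      using V(1) A by (intro emeasure_subadditive) auto
    finally show "emeasure lborel ?W \<le> emeasure lborel A + emeasure lborel (V - A)" .
  qed simp
  also have "\<dots> \<le> ennreal (L ^ DIM('a)) * (emeasure lborel A + ennreal (e / L ^ DIM('a)))"
    using V(3) by (intro mult_left_mono add_left_mono) auto
  also have "\<dots> = ennreal (L ^ DIM('a)) * emeasure lborel A + ennreal e"
    using L \<open>0 < e\<close> by (simp add: distrib_left ennreal_mult[symmetric])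
  finally show "emeasure lborel (\<Psi> -` A) \<le> ennreal (L ^ DIM('a)) * emeasure lborel A + ennreal e" .
qed

text \<open>A change of variables without Jacobians. The estimate for sets says that on
  \<open>U\<close> the push-forward of Lebesgue measure under \<open>\<Psi>\<close> is dominated by
  \<open>L ^ DIM('a)\<close> times Lebesgue measure, and domination passes to integrals.
  Inequalities in the two directions are all that the charts require.\<close>

lemma nn_integral_Lipschitz_le:
  fixes \<Phi> \<Psi> :: "'a::euclidean_space \<Rightarrow> 'a"
  assumes L: "L > 0" and U: "open U"
    and lip: "\<And>x y. x \<in> U \<Longrightarrow> y \<in> U \<Longrightarrow> norm (\<Phi> x - \<Phi> y) \<le> L * norm (x - y)"
    and \<Psi>: "continuous_on UNIV \<Psi>" and inv: "\<And>x. \<Psi> (\<Phi> x) = x" "\<And>z. \<Phi> (\<Psi> z) = z"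
    and G[measurable]: "G \<in> borel_measurable borel"
  shows "(\<integral>\<^sup>+ y. indicator U (\<Psi> y) * G (\<Psi> y) \<partial>lborel) \<le> ennreal (L ^ DIM('a)) * (\<integral>\<^sup>+ x. indicator U x * G x \<partial>lborel)"
proof -
  have \<Psi>m[measurable]: "\<Psi> \<in> borel_measurable borel" using \<Psi> by (rule borel_measurable_continuous_onI)
  have Um[measurable]: "U \<in> sets borel" using U by simp
  let ?N = "density (distr lborel borel \<Psi>) (indicator U)"
  let ?M = "density lborel (\<lambda>x. ennreal (L ^ DIM('a)) * indicator U x)"
  have "?N \<le> ?M"
  proof (subst le_measure)
    show "\<forall>A\<in>sets ?N. emeasure ?N A \<le> emeasure ?M A"
    proof
      fix A assume "A \<in> sets ?N"
      then have A[measurable]: "A \<in> sets borel" by simp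
      have "emeasure ?N A = emeasure lborel (\<Psi> -` (U \<inter> A))"
      proof -
        have "emeasure ?N A = (\<integral>\<^sup>+ x. indicator U x * indicator A x \<partial>distr lborel borel \<Psi>)"
          by (rule emeasure_density) auto
        also have "\<dots> = (\<integral>\<^sup>+ x. indicator (U \<inter> A) x \<partial>distr lborel borel \<Psi>)"
          by (rule nn_integral_cong) (simp add: indicator_def)
        also have "\<dots> = emeasure (distr lborel borel \<Psi>) (U \<inter> A)"
          by (rule nn_integral_indicator) auto
        also have "\<dots> = emeasure lborel (\<Psi> -` (U \<inter> A))"
          by (subst emeasure_distr) auto
        finally show ?thesis .
      qed
      also have "\<dots> \<le> ennreal (L ^ DIM('a)) * emeasure lborel (U \<inter> A)"
        by (rule emeasure_Lipschitz_image_le[OF L U lip \<Psi> inv]) auto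
      also have "\<dots> = emeasure ?M A"
      proof -
        have "emeasure ?M A = (\<integral>\<^sup>+ x. ennreal (L ^ DIM('a)) * indicator U x * indicator A x \<partial>lborel)"
          by (rule emeasure_density) auto
        also have "\<dots> = (\<integral>\<^sup>+ x. ennreal (L ^ DIM('a)) * indicator (U \<inter> A) x \<partial>lborel)"
          by (rule nn_integral_cong) (simp add: indicator_def)
        also have "\<dots> = ennreal (L ^ DIM('a)) * emeasure lborel (U \<inter> A)"
          by (rule nn_integral_cmult_indicator) auto
        finally show ?thesis by simp
      qed
      finally show "emeasure ?N A \<le> emeasure ?M A" .
    qed
  qed simp
  then have "nn_integral ?N G \<le> nn_integral ?M G"
    by (rule nn_integral_mono_measure[rotated]) simp
  moreover have "nn_integral ?N G = (\<integral>\<^sup>+ y. indicator U (\<Psi> y) * G (\<Psi> y) \<partial>lborel)"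
    by (subst nn_integral_density) (auto intro!: nn_integral_distr)
  moreover have "nn_integral ?M G = (\<integral>\<^sup>+ x. ennreal (L ^ DIM('a)) * (indicator U x * G x) \<partial>lborel)"
    by (subst nn_integral_density) (auto simp: mult.assoc)
  moreover have "\<dots> = ennreal (L ^ DIM('a)) * (\<integral>\<^sup>+ x. indicator U x * G x \<partial>lborel)"
    by (rule nn_integral_cmult) auto
  ultimately show ?thesis by simp
qed

section \<open>Integrals of powers\<close>

text \<open>Convexity of the power at the weighted mean of \<open>a / (1 - l)\<close> and
  \<open>b / l\<close>. Small \<open>l\<close> brings the first coefficient near 1, as the
  Brezis--Lieb lemma needs; weights proportional to given bounds produce Minkowski's
  inequality.\<close>

lemma powr_abs_add_le_convex:
  fixes a b p :: real
  assumes p: "p \<ge> 1" and l: "0 < l" "l < 1"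
  shows "\<bar>a + b\<bar> powr p \<le> (1 - l) powr (1 - p) * \<bar>a\<bar> powr p + l powr (1 - p) * \<bar>b\<bar> powr p"
proof -
  have g1: "1 \<le> m powr (1 - p)" if "0 < m" "m < 1" for m
    using that p powr_mono'[of "1 - p" 0 m] by simp
  consider "a = 0" | "b = 0" | "a \<noteq> 0" "b \<noteq> 0" by blast
  then show ?thesis
  proof cases
    case 1
    then show ?thesis using mult_right_mono[OF g1[OF l], of "\<bar>b\<bar> powr p"] by simp
  next
    case 2
    then show ?thesis using mult_right_mono[OF g1[of "1 - l"], of "\<bar>a\<bar> powr p"] l by simp
  next
    case 3
    let ?x = "\<bar>a\<bar> / (1 - l)" and ?y = "\<bar>b\<bar> / l"
    have "\<bar>a + b\<bar> powr p \<le> (\<bar>a\<bar> + \<bar>b\<bar>) powr p" using p by (intro powr_mono2) auto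
    also have "\<bar>a\<bar> + \<bar>b\<bar> = (1 - l) *\<^sub>R ?x + l *\<^sub>R ?y" using l by simp
    also have "\<dots> powr p \<le> (1 - l) * ?x powr p + l * ?y powr p"
      using 3 l by (intro convex_onD[OF powr_convex[OF p]]) auto
    also have "(1 - l) * ?x powr p = (1 - l) powr (1 - p) * \<bar>a\<bar> powr p"
      using l by (simp add: powr_divide powr_diff)
    also have "l * ?y powr p = l powr (1 - p) * \<bar>b\<bar> powr p"
      using l by (simp add: powr_divide powr_diff)
    finally show ?thesis .
  qed
qed

lemma powr_abs_add_le_eps:
  fixes p e :: real
  assumes p: "p > 1" and e: "e > 0"
  obtains C where "C \<ge> 0" "\<And>a b. \<bar>a + b\<bar> powr p \<le> (1 + e) * \<bar>a\<bar> powr p + C * \<bar>b\<bar> powr p"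
proof
  define m where "m = (1 + e) powr (- 1 / (p - 1))"
  have "(1 + e) powr (- 1 / (p - 1)) < (1 + e) powr 0"
    using p e by (intro powr_less_mono) auto
  then have m: "0 < m" "m < 1" using e by (auto simp: m_def)
  have "m powr (1 - p) = 1 + e"
  proof -
    have "- 1 / (p - 1) * (1 - p) = 1" using p by (simp add: field_simps)
    then show ?thesis unfolding m_def using e by (simp add: powr_powr)
  qed
  then show "\<bar>a + b\<bar> powr p \<le> (1 + e) * \<bar>a\<bar> powr p + (1 - m) powr (1 - p) * \<bar>b\<bar> powr p" for a b
    using powr_abs_add_le_convex[of p "1 - m" a b] p m by simp
qed simp

text \<open>One functional for both quantities of interest: over \<open>dom_measure \<Omega>\<close>
  it is \<open>lp_pow\<close>, and over the singular measure
  \<open>pair_measure_kernel \<sigma> \<Omega>\<close> with exponent 2, applied to differences, it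
  is the energy. Fatou, perturbation and Brezis--Lieb arguments are thus carried out once.\<close>

definition pint :: "'a measure \<Rightarrow> real \<Rightarrow> ('a \<Rightarrow> real) \<Rightarrow> ennreal" where
  "pint M p f = (\<integral>\<^sup>+ x. ennreal (\<bar>f x\<bar> powr p) \<partial>M)"

lemma nn_integral_linear_bound:
  assumes "f \<in> borel_measurable M" "g \<in> borel_measurable M" "a \<ge> 0" "b \<ge> 0"
    and "\<And>x. f x \<ge> 0" "\<And>x. g x \<ge> 0" "\<And>x. h x \<le> a * f x + b * g x"
  shows "(\<integral>\<^sup>+ x. ennreal (h x) \<partial>M) \<le> ennreal a * (\<integral>\<^sup>+ x. ennreal (f x) \<partial>M) + ennreal b * (\<integral>\<^sup>+ x. ennreal (g x) \<partial>M)"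
proof -
  have "(\<integral>\<^sup>+ x. ennreal (h x) \<partial>M) \<le> (\<integral>\<^sup>+ x. ennreal a * ennreal (f x) + ennreal b * ennreal (g x) \<partial>M)"
    using assms by (intro nn_integral_mono) (auto simp: ennreal_mult[symmetric] ennreal_plus[symmetric] simp del: ennreal_plus intro!: ennreal_leI)
  also have "\<dots> = ennreal a * (\<integral>\<^sup>+ x. ennreal (f x) \<partial>M) + ennreal b * (\<integral>\<^sup>+ x. ennreal (g x) \<partial>M)"
    using assms(1,2) by (simp add: nn_integral_add nn_integral_cmult)
  finally show ?thesis .
qed

lemma pint_add_le:
  assumes "p > 1" "e > 0"
  obtains C where "C \<ge> 0"
    "\<And>M f g. f \<in> borel_measurable M \<Longrightarrow> g \<in> borel_measurable M \<Longrightarrow>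
      pint M p (\<lambda>x. f x + g x) \<le> ennreal (1 + e) * pint M p f + ennreal C * pint M p g"
proof -
  obtain C where C: "C \<ge> 0" "\<And>a b. \<bar>a + b\<bar> powr p \<le> (1 + e) * \<bar>a\<bar> powr p + C * \<bar>b\<bar> powr p"
    using powr_abs_add_le_eps[OF assms] by blast
  show thesis
  proof (rule that[OF C(1)])
    fix M :: "'b measure" and f g :: "'b \<Rightarrow> real"
    assume [measurable]: "f \<in> borel_measurable M" "g \<in> borel_measurable M"
    show "pint M p (\<lambda>x. f x + g x) \<le> ennreal (1 + e) * pint M p f + ennreal C * pint M p g"
      unfolding pint_def by (rule nn_integral_linear_bound) (use C assms in auto)
  qed
qed

lemma pint_cmult: 
  assumes "f \<in> borel_measurable M"
  shows "pint M p (\<lambda>x. c * f x) = ennreal (\<bar>c\<bar> powr p) * pint M p f"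
proof -
  have "pint M p (\<lambda>x. c * f x) = (\<integral>\<^sup>+ x. ennreal (\<bar>c\<bar> powr p) * ennreal (\<bar>f x\<bar> powr p) \<partial>M)"
    unfolding pint_def by (intro nn_integral_cong) (simp add: abs_mult powr_mult ennreal_mult)
  also have "\<dots> = ennreal (\<bar>c\<bar> powr p) * pint M p f"
    unfolding pint_def using assms by (intro nn_integral_cmult) measurable
  finally show ?thesis .
qed

lemma pint_minus: "pint M p (\<lambda>x. - f x) = pint M p f"
  by (simp add: pint_def)

lemma pint_diff_commute: "pint M p (\<lambda>x. f x - g x) = pint M p (\<lambda>x. g x - f x)"
  by (simp add: pint_def abs_minus_commute)

lemma pint_add_finite:
  assumes "p > 1" "f \<in> borel_measurable M" "g \<in> borel_measurable M" "pint M p f < \<infinity>" "pint M p g < \<infinity>"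
  shows "pint M p (\<lambda>x. f x + g x) < \<infinity>"
proof -
  obtain C where C: "C \<ge> 0" "pint M p (\<lambda>x. f x + g x) \<le> ennreal (1 + 1) * pint M p f + ennreal C * pint M p g"
    using pint_add_le[of p 1] assms by (metis zero_less_one)
  note C(2)
  also have "\<dots> < \<infinity>" using assms by (simp add: ennreal_mult_less_top)
  finally show ?thesis .
qed

lemma pint_diff_finite:
  assumes "p > 1" "f \<in> borel_measurable M" "g \<in> borel_measurable M" "pint M p f < \<infinity>" "pint M p g < \<infinity>"
  shows "pint M p (\<lambda>x. f x - g x) < \<infinity>"
  using pint_add_finite[of p f M "\<lambda>x. - g x"] assms by (simp add: pint_minus)

section \<open>Limits of integrals of powers\<close>

lemma pint_Fatou:
  assumes [measurable]: "\<And>k. f k \<in> borel_measurable M" "g \<in> borel_measurable M"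
    and "AE x in M. (\<lambda>k. f k x) \<longlonglongrightarrow> g x" "p > 0"
  shows "pint M p g \<le> liminf (\<lambda>k. pint M p (f k))"
proof -
  have "pint M p g = (\<integral>\<^sup>+ x. liminf (\<lambda>k. ennreal (\<bar>f k x\<bar> powr p)) \<partial>M)"
    unfolding pint_def
  proof (rule nn_integral_cong_AE)
    show "AE x in M. ennreal (\<bar>g x\<bar> powr p) = liminf (\<lambda>k. ennreal (\<bar>f k x\<bar> powr p))"
      using assms(3)
    proof eventually_elim
      case (elim x)
      have "(\<lambda>k. ennreal (\<bar>f k x\<bar> powr p)) \<longlonglongrightarrow> ennreal (\<bar>g x\<bar> powr p)"
        using assms(4) by (intro tendsto_ennrealI tendsto_powr' tendsto_rabs elim tendsto_const) auto
      then show ?case by (rule lim_imp_Liminf[OF sequentially_bot, symmetric])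
    qed
  qed
  also have "\<dots> \<le> liminf (\<lambda>k. pint M p (f k))"
    unfolding pint_def by (rule nn_integral_liminf) measurable
  finally show ?thesis .
qed

lemma pint_Fatou_bound:
  assumes "\<And>k. f k \<in> borel_measurable M" "g \<in> borel_measurable M"
    and "AE x in M. (\<lambda>k. f k x) \<longlonglongrightarrow> g x" "p > 0"
    and "eventually (\<lambda>k. pint M p (f k) \<le> B) sequentially"
  shows "pint M p g \<le> B"
  using pint_Fatou[OF assms(1-4)] Liminf_le[OF sequentially_bot assms(5)] by (rule order_trans)

text \<open>The hypothesis \<open>le\<close> replaces the triangle inequality when only p-th powers
  of norms are at hand: the constant \<open>C\<close> may depend on \<open>e\<close>, but it
  multiplies a null sequence, so \<open>k\<close> goes to infinity before \<open>e\<close> goes to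
  0.\<close>

lemma tendsto_perturb_real:
  fixes a b d :: "nat \<Rightarrow> real"
  assumes d: "d \<longlonglongrightarrow> 0" and b: "b \<longlonglongrightarrow> P" and P: "P \<ge> 0" and a: "\<And>k. a k \<ge> 0"
    and le: "\<And>e. e > 0 \<Longrightarrow> \<exists>C. \<forall>k. a k \<le> (1 + e) * b k + C * d k \<and> b k \<le> (1 + e) * a k + C * d k"
  shows "a \<longlonglongrightarrow> P"
proof (rule order_tendstoI)
  fix y assume y: "P < y"
  \<comment> \<open>Small enough for \<open>(1 + e) * P < y\<close>; the \<open>+ 1\<close> covers
    \<open>P = 0\<close>.\<close>
  define e where "e = (y - P) / (2 * (P + 1))"
  have e: "e > 0" unfolding e_def using y P by (intro divide_pos_pos) auto
  have "e * P < y - P"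
  proof -
    have "e * P \<le> e * (P + 1)" using e by simp
    also have "\<dots> = (y - P) / 2" unfolding e_def using P by (simp add: field_simps)
    also have "\<dots> < y - P" using y by simp
    finally show ?thesis .
  qed
  then have ey: "(1 + e) * P + 0 < y" by (simp add: algebra_simps)
  obtain C where C: "\<And>k. a k \<le> (1 + e) * b k + C * d k" using le[OF e] by blast
  have "(\<lambda>k. (1 + e) * b k + C * d k) \<longlonglongrightarrow> (1 + e) * P + 0"
    by (intro tendsto_add tendsto_mult_right_zero tendsto_mult_left b d)
  then have "eventually (\<lambda>k. (1 + e) * b k + C * d k < y) sequentially"
    using order_tendstoD(2) ey by blast
  then show "eventually (\<lambda>k. a k < y) sequentially"
    by eventually_elim (use C le_less_trans in blast)
next
  fix y assume y: "y < P"
  show "eventually (\<lambda>k. y < a k) sequentially"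
  proof (cases "y < 0")
    case True
    then show ?thesis using a by (auto intro!: always_eventually intro: less_le_trans)
  next
    case False
    define e where "e = (P - y) / (2 * (y + 1))"
    have e: "e > 0" unfolding e_def using y False by (intro divide_pos_pos) auto
    have "e * y < P - y"
    proof -
      have "e * y \<le> e * (y + 1)" using e by simp
      also have "\<dots> = (P - y) / 2" unfolding e_def using False by (simp add: field_simps)
      also have "\<dots> < P - y" using y by simp
      finally show ?thesis .
    qed
    then have ey: "(1 + e) * y < P - 0" by (simp add: algebra_simps)
    obtain C where C: "\<And>k. b k \<le> (1 + e) * a k + C * d k" using le[OF e] by blast
    have "(\<lambda>k. b k - C * d k) \<longlonglongrightarrow> P - 0"
      by (intro tendsto_diff tendsto_mult_right_zero b d)
    then have "eventually (\<lambda>k. (1 + e) * y < b k - C * d k) sequentially"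
      using order_tendstoD(1) ey by blast
    then show ?thesis
    proof eventually_elim
      case (elim k)
      then have "(1 + e) * y < (1 + e) * a k" using C[of k] by linarith
      then show ?case using e by simp
    qed
  qed
qed

lemma ennreal_bound_enn2real:
  assumes "x \<le> ennreal a * y + ennreal c * z" "y < \<infinity>" "z < \<infinity>" "a \<ge> 0" "c \<ge> 0"
  shows "enn2real x \<le> a * enn2real y + c * enn2real z"
proof -
  have "ennreal a * y + ennreal c * z = ennreal (a * enn2real y + c * enn2real z)"
    using assms by (simp add: ennreal_mult)
  then have "x \<le> ennreal (a * enn2real y + c * enn2real z)" using assms(1) by simp
  then show ?thesis using assms by (intro enn2real_leI) auto
qed

lemma pint_tendsto_perturb:
  assumes p: "p > 1" and [measurable]: "\<And>k. f k \<in> borel_measurable M" "\<And>k. g k \<in> borel_measurable M"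
    and fin: "\<And>k. pint M p (f k) < \<infinity>" "\<And>k. pint M p (g k) < \<infinity>"
    and d: "(\<lambda>k. pint M p (\<lambda>x. f k x - g k x)) \<longlonglongrightarrow> 0"
    and P: "(\<lambda>k. enn2real (pint M p (g k))) \<longlonglongrightarrow> P"
  shows "(\<lambda>k. enn2real (pint M p (f k))) \<longlonglongrightarrow> P"
proof (rule tendsto_perturb_real[OF _ P])
  show "(\<lambda>k. enn2real (pint M p (\<lambda>x. f k x - g k x))) \<longlonglongrightarrow> 0"
    using d by (intro tendsto_enn2real) auto
  show "0 \<le> P" using P by (rule LIMSEQ_le_const) auto
  have fd: "pint M p (\<lambda>x. f k x - g k x) < \<infinity>" for k
    using p fin by (intro pint_diff_finite) auto
  fix e :: real assume e: "e > 0"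
  obtain C where C: "C \<ge> 0" "\<And>f g. f \<in> borel_measurable M \<Longrightarrow> g \<in> borel_measurable M \<Longrightarrow>
      pint M p (\<lambda>x. f x + g x) \<le> ennreal (1 + e) * pint M p f + ennreal C * pint M p g"
    using pint_add_le[OF p e] by metis
  have "enn2real (pint M p (f k)) \<le> (1 + e) * enn2real (pint M p (g k)) + C * enn2real (pint M p (\<lambda>x. f k x - g k x))
     \<and> enn2real (pint M p (g k)) \<le> (1 + e) * enn2real (pint M p (f k)) + C * enn2real (pint M p (\<lambda>x. f k x - g k x))" for k
    using C(2)[of "g k" "\<lambda>x. f k x - g k x"] C(2)[of "f k" "\<lambda>x. g k x - f k x"] fin[of k] fd[of k] e C(1)
    by (auto simp: pint_diff_commute[of M p "g k" "f k"] intro!: ennreal_bound_enn2real)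
  then show "\<exists>C. \<forall>k. enn2real (pint M p (f k)) \<le> (1 + e) * enn2real (pint M p (g k)) + C * enn2real (pint M p (\<lambda>x. f k x - g k x))
     \<and> enn2real (pint M p (g k)) \<le> (1 + e) * enn2real (pint M p (f k)) + C * enn2real (pint M p (\<lambda>x. f k x - g k x))"
    by blast
qed simp

text \<open>Lets the Brezis--Lieb argument work with genuine limits along subsequences instead of
  upper and lower limits. A sequence that stays away from \<open>L\<close> infinitely often has,
  being bounded, a subsequence with a different limit.\<close>

lemma tendsto_if_subseq_limits:
  fixes x :: "nat \<Rightarrow> real"
  assumes "bounded (range x)" "\<And>r l. strict_mono r \<Longrightarrow> (\<lambda>k. x (r k)) \<longlonglongrightarrow> l \<Longrightarrow> l = L"
  shows "x \<longlonglongrightarrow> L"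
proof (rule ccontr)
  assume "\<not> x \<longlonglongrightarrow> L"
  then obtain e where e: "e > 0" "\<And>N. \<exists>n\<ge>N. e \<le> dist (x n) L"
    unfolding lim_sequentially by (auto simp: not_less)
  obtain s :: "nat \<Rightarrow> nat" where s: "strict_mono s" "\<And>k. e \<le> dist (x (s k)) L"
  proof -
    have "infinite {n. e \<le> dist (x n) L}"
      unfolding infinite_nat_iff_unbounded_le using e(2) by auto
    then show thesis using that infinite_enumerate[of "{n. e \<le> dist (x n) L}"] by blast
  qed
  have "bounded (range (x \<circ> s))" using assms(1) by (rule bounded_subset) auto
  then obtain l t where t: "strict_mono t" "((x \<circ> s) \<circ> t) \<longlonglongrightarrow> l"
    using bounded_imp_convergent_subsequence by blast
  have "l = L" using assms(2)[of "s \<circ> t" l] s t by (auto simp: o_def intro: strict_mono_compose)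
  then have "eventually (\<lambda>k. dist (x (s (t k))) L < e) sequentially"
    using tendstoD[OF t(2) e(1)] by (simp add: o_def)
  then show False using s(2) by (auto simp: eventually_sequentially not_less[symmetric])
qed

lemma integral_Fatou:
  fixes A :: "nat \<Rightarrow> 'a \<Rightarrow> real"
  assumes i: "\<And>k. integrable M (A k)" "integrable M B" and pos: "\<And>k x. A k x \<ge> 0"
    and lim: "AE x in M. (\<lambda>k. A k x) \<longlonglongrightarrow> B x" and c: "(\<lambda>k. \<integral>x. A k x \<partial>M) \<longlonglongrightarrow> c"
  shows "(\<integral>x. B x \<partial>M) \<le> c"
proof -
  have B: "AE x in M. B x \<ge> 0"
    using lim by eventually_elim (use pos in \<open>auto intro: LIMSEQ_le_const\<close>)
  have [measurable]: "\<And>k. A k \<in> borel_measurable M" "B \<in> borel_measurable M" using i by auto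
  have "ennreal (\<integral>x. B x \<partial>M) = (\<integral>\<^sup>+ x. ennreal (B x) \<partial>M)"
    using i(2) B by (rule nn_integral_eq_integral[symmetric])
  also have "\<dots> = (\<integral>\<^sup>+ x. liminf (\<lambda>k. ennreal (A k x)) \<partial>M)"
  proof (rule nn_integral_cong_AE)
    show "AE x in M. ennreal (B x) = liminf (\<lambda>k. ennreal (A k x))"
      using lim by eventually_elim (rule lim_imp_Liminf[OF sequentially_bot tendsto_ennrealI, symmetric])
  qed
  also have "\<dots> \<le> liminf (\<lambda>k. \<integral>\<^sup>+ x. ennreal (A k x) \<partial>M)"
    by (rule nn_integral_liminf) measurable
  also have "\<dots> = liminf (\<lambda>k. ennreal (\<integral>x. A k x \<partial>M))"
    using i pos by (simp add: nn_integral_eq_integral)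
  also have "\<dots> = ennreal c" using c by (intro lim_imp_Liminf tendsto_ennrealI) auto
  finally have "ennreal (\<integral>x. B x \<partial>M) \<le> ennreal c" .
  moreover have "c \<ge> 0" using c by (rule LIMSEQ_le_const) (auto simp: pos)
  ultimately show ?thesis by simp
qed

text \<open>Fatou's lemma is applied to two functions that are nonnegative by the inequality with
  constant \<open>1 + e\<close>: the difference of \<open>(1 + e) * \<bar>f k x - g x\<bar> powr p +
  C * \<bar>g x\<bar> powr p\<close> and \<open>\<bar>f k x\<bar> powr p\<close>, and the same with
  the roles of \<open>f k\<close> and \<open>f k - g\<close> exchanged. Each gives one of the two
  bounds on the limit of the remainder as \<open>e\<close> tends to 0.\<close>

lemma Brezis_Lieb:
  assumes p: "p > 1" and [measurable]: "\<And>k. f k \<in> borel_measurable M" "g \<in> borel_measurable M"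
    and fin: "\<And>k. pint M p (f k) < \<infinity>"
    and lim: "AE x in M. (\<lambda>k. f k x) \<longlonglongrightarrow> g x"
    and P: "(\<lambda>k. enn2real (pint M p (f k))) \<longlonglongrightarrow> P"
  shows "pint M p g < \<infinity>"
    and "(\<lambda>k. enn2real (pint M p (\<lambda>x. f k x - g x))) \<longlonglongrightarrow> P - enn2real (pint M p g)"
proof -
  have Pe: "(\<lambda>k. pint M p (f k)) \<longlonglongrightarrow> ennreal P"
    using tendsto_ennrealI[OF P] fin by simp
  have "pint M p g \<le> liminf (\<lambda>k. pint M p (f k))"
    using p lim by (intro pint_Fatou) auto
  also have "\<dots> = ennreal P" using Pe by (intro lim_imp_Liminf) auto
  finally have gP: "pint M p g \<le> ennreal P" .
  then show gfin: "pint M p g < \<infinity>" using le_less_trans by fastforce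
  have fd: "pint M p (\<lambda>x. f k x - g x) < \<infinity>" for k
    using p fin gfin by (intro pint_diff_finite) auto
  have int: "integrable M (\<lambda>x. \<bar>h x\<bar> powr p)" and eq: "enn2real (pint M p h) = (\<integral>x. \<bar>h x\<bar> powr p \<partial>M)"
    if [measurable]: "h \<in> borel_measurable M" and "pint M p h < \<infinity>" for h
  proof -
    show "integrable M (\<lambda>x. \<bar>h x\<bar> powr p)"
      using that unfolding pint_def by (intro integrableI_nonneg) auto
    show "enn2real (pint M p h) = (\<integral>x. \<bar>h x\<bar> powr p \<partial>M)"
      unfolding pint_def by (rule integral_eq_nn_integral[symmetric]) auto
  qed
  define G where "G = enn2real (pint M p g)"
  define F where "F k = enn2real (pint M p (f k))" for k
  define x where "x k = enn2real (pint M p (\<lambda>x. f k x - g x))" for k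
  note i = int[OF _ fin] int[OF _ gfin] int[OF _ fd]
  have limp: "AE x in M. (\<lambda>k. \<bar>f k x\<bar> powr p) \<longlonglongrightarrow> \<bar>g x\<bar> powr p"
      "AE x in M. (\<lambda>k. \<bar>f k x - g x\<bar> powr p) \<longlonglongrightarrow> 0"
  proof -
    show "AE x in M. (\<lambda>k. \<bar>f k x\<bar> powr p) \<longlonglongrightarrow> \<bar>g x\<bar> powr p"
      using lim by eventually_elim (use p in \<open>auto intro!: tendsto_powr' tendsto_rabs tendsto_const\<close>)
    show "AE x in M. (\<lambda>k. \<bar>f k x - g x\<bar> powr p) \<longlonglongrightarrow> 0"
      using lim
    proof eventually_elim
      case (elim x)
      have "(\<lambda>k. \<bar>f k x - g x\<bar> powr p) \<longlonglongrightarrow> \<bar>g x - g x\<bar> powr p"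
        by (intro tendsto_powr' tendsto_rabs tendsto_diff elim tendsto_const) (use p in auto)
      then show ?case by simp
    qed
  qed
  have bd: "\<exists>C. (\<forall>k. x k \<le> (1 + e) * F k + C * G) \<and> (\<forall>r l. strict_mono r \<longrightarrow> (\<lambda>k. x (r k)) \<longlonglongrightarrow> l \<longrightarrow>
      P - G \<le> (1 + e) * l \<and> l \<le> (1 + e) * (P - G))" if e: "e > 0" for e
  proof -
    obtain C where C: "C \<ge> 0" "\<And>a b. \<bar>a + b\<bar> powr p \<le> (1 + e) * \<bar>a\<bar> powr p + C * \<bar>b\<bar> powr p"
      using powr_abs_add_le_eps[OF p e] by blast
    have c1: "\<bar>f k x\<bar> powr p \<le> (1 + e) * \<bar>f k x - g x\<bar> powr p + C * \<bar>g x\<bar> powr p" for k x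
      using C(2)[of "f k x - g x" "g x"] by simp
    have c2: "\<bar>f k x - g x\<bar> powr p \<le> (1 + e) * \<bar>f k x\<bar> powr p + C * \<bar>g x\<bar> powr p" for k x
      using C(2)[of "f k x" "- g x"] by simp
    have "x k \<le> (1 + e) * F k + C * G" for k
    proof -
      have "x k = (\<integral>x. \<bar>f k x - g x\<bar> powr p \<partial>M)" unfolding x_def by (rule eq[OF _ fd]) measurable
      also have "\<dots> \<le> (\<integral>x. (1 + e) * \<bar>f k x\<bar> powr p + C * \<bar>g x\<bar> powr p \<partial>M)"
        using i c2 by (intro integral_mono) auto
      also have "\<dots> = (1 + e) * F k + C * G"
        unfolding F_def G_def using i by (simp add: eq[OF _ fin] eq[OF _ gfin])
      finally show ?thesis .
    qed
    moreover have "P - G \<le> (1 + e) * l \<and> l \<le> (1 + e) * (P - G)" if r: "strict_mono r" "(\<lambda>k. x (r k)) \<longlonglongrightarrow> l" for r l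
    proof -
      have Pr: "(\<lambda>k. F (r k)) \<longlonglongrightarrow> P" unfolding F_def using LIMSEQ_subseq_LIMSEQ[OF P r(1)] by (simp add: o_def)
      have r': "filterlim r at_top sequentially" using r(1) by (rule filterlim_subseq)
      let ?A = "\<lambda>k x. (1 + e) * \<bar>f (r k) x - g x\<bar> powr p + C * \<bar>g x\<bar> powr p - \<bar>f (r k) x\<bar> powr p"
      let ?A' = "\<lambda>k x. (1 + e) * \<bar>f (r k) x\<bar> powr p + C * \<bar>g x\<bar> powr p - \<bar>f (r k) x - g x\<bar> powr p"
      have "(\<integral>x. (C - 1) * \<bar>g x\<bar> powr p \<partial>M) \<le> (1 + e) * l + C * G - P"
      proof (rule integral_Fatou[where A = ?A])
        show "AE x in M. (\<lambda>k. ?A k x) \<longlonglongrightarrow> (C - 1) * \<bar>g x\<bar> powr p"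
          using limp
        proof eventually_elim
          case (elim x)
          have "(\<lambda>k. ?A k x) \<longlonglongrightarrow> (1 + e) * 0 + C * \<bar>g x\<bar> powr p - \<bar>g x\<bar> powr p"
            by (intro tendsto_intros filterlim_compose[OF elim(1) r'] filterlim_compose[OF elim(2) r'])
          then show ?case by (simp add: algebra_simps)
        qed
        have "(\<integral>x. ?A k x \<partial>M) = (1 + e) * x (r k) + C * G - F (r k)" for k
          unfolding F_def G_def x_def using i by (simp add: eq[OF _ fin] eq[OF _ gfin] eq[OF _ fd])
        moreover have "(\<lambda>k. (1 + e) * x (r k) + C * G - F (r k)) \<longlonglongrightarrow> (1 + e) * l + C * G - P"
          by (intro tendsto_intros r(2) Pr)
        ultimately show "(\<lambda>k. \<integral>x. ?A k x \<partial>M) \<longlonglongrightarrow> (1 + e) * l + C * G - P" by simp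
      qed (use i c1 in auto)
      moreover have "(\<integral>x. (1 + e + C) * \<bar>g x\<bar> powr p \<partial>M) \<le> (1 + e) * P + C * G - l"
      proof (rule integral_Fatou[where A = ?A'])
        show "AE x in M. (\<lambda>k. ?A' k x) \<longlonglongrightarrow> (1 + e + C) * \<bar>g x\<bar> powr p"
          using limp
        proof eventually_elim
          case (elim x)
          have "(\<lambda>k. ?A' k x) \<longlonglongrightarrow> (1 + e) * \<bar>g x\<bar> powr p + C * \<bar>g x\<bar> powr p - 0"
            by (intro tendsto_intros filterlim_compose[OF elim(1) r'] filterlim_compose[OF elim(2) r'])
          then show ?case by (simp add: algebra_simps)
        qed
        have "(\<integral>x. ?A' k x \<partial>M) = (1 + e) * F (r k) + C * G - x (r k)" for k
          unfolding F_def G_def x_def using i by (simp add: eq[OF _ fin] eq[OF _ gfin] eq[OF _ fd])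
        moreover have "(\<lambda>k. (1 + e) * F (r k) + C * G - x (r k)) \<longlonglongrightarrow> (1 + e) * P + C * G - l"
          by (intro tendsto_intros r(2) Pr)
        ultimately show "(\<lambda>k. \<integral>x. ?A' k x \<partial>M) \<longlonglongrightarrow> (1 + e) * P + C * G - l" by simp
      qed (use i c2 in auto)
      moreover have "(\<integral>x. \<bar>g x\<bar> powr p \<partial>M) = G"
        unfolding G_def by (simp add: eq[OF _ gfin])
      \<comment> \<open>Nothing is known about \<open>C\<close> as \<open>e\<close> shrinks, but it
        multiplies \<open>G\<close> on both sides of each inequality and cancels.\<close>
      ultimately have "(C - 1) * G \<le> (1 + e) * l + C * G - P" "(1 + e + C) * G \<le> (1 + e) * P + C * G - l"
        by simp_all
      then show ?thesis by (simp add: algebra_simps)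
    qed
    ultimately show ?thesis by blast
  qed
  show "(\<lambda>k. enn2real (pint M p (\<lambda>x. f k x - g x))) \<longlonglongrightarrow> P - enn2real (pint M p g)"
    unfolding x_def[symmetric] G_def[symmetric]
  proof (rule tendsto_if_subseq_limits)
    obtain C where C: "\<And>k. x k \<le> 2 * F k + C * G" using bd[of 1] by auto
    have "bounded (range F)" using P unfolding F_def by (rule convergent_imp_bounded)
    then obtain B where B: "\<And>k. \<bar>F k\<bar> \<le> B" by (auto simp: bounded_iff)
    have "\<bar>x k\<bar> \<le> 2 * B + C * G" for k
    proof -
      have "x k \<ge> 0" by (simp add: x_def)
      then show ?thesis using C[of k] B[of k] by linarith
    qed
    then show "bounded (range x)" by (auto simp: bounded_iff)
    fix r l assume r: "strict_mono r" "(\<lambda>k. x (r k)) \<longlonglongrightarrow> l"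
    have e: "P - G \<le> (1 + e) * l \<and> l \<le> (1 + e) * (P - G)" if "e > 0" for e using bd[OF that] r by blast
    have "((\<lambda>e. (1 + e) * l) \<longlongrightarrow> (1 + 0) * l) (at_right 0)" "((\<lambda>e. (1 + e) * (P - G)) \<longlongrightarrow> (1 + 0) * (P - G)) (at_right 0)"
      by (intro tendsto_intros)+
    moreover have "eventually (\<lambda>e. P - G \<le> (1 + e) * l) (at_right 0)" "eventually (\<lambda>e. l \<le> (1 + e) * (P - G)) (at_right 0)"
      using e by (auto simp: eventually_at_right_field intro: exI[of _ 1])
    ultimately have "P - G \<le> (1 + 0) * l" "l \<le> (1 + 0) * (P - G)"
      by (auto intro: tendsto_lowerbound simp: trivial_limit_at_right_real)
    then show "l = P - G" by simp
  qed
qed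

text \<open>Strictly positive bounds \<open>A i\<close> instead of the norms themselves keep the
  weight \<open>l\<close> inside the open unit interval even if a summand vanishes. With weights
  proportional to the bounds, the convexity inequality adds up to exactly the power of the
  sum.\<close>

lemma Minkowski_sum:
  fixes g :: "'i \<Rightarrow> 'a \<Rightarrow> real"
  assumes q: "q \<ge> 1" and I: "finite I" "I \<noteq> {}"
    and m: "\<And>i. i \<in> I \<Longrightarrow> g i \<in> borel_measurable M"
    and A: "\<And>i. i \<in> I \<Longrightarrow> A i > 0" "\<And>i. i \<in> I \<Longrightarrow> pint M q (g i) \<le> ennreal (A i powr q)"
  shows "pint M q (\<lambda>x. \<Sum>i\<in>I. g i x) \<le> ennreal ((\<Sum>i\<in>I. A i) powr q)"
  using I m A
proof (induction I rule: finite_ne_induct)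
  case (insert i I)
  define B where "B = (\<Sum>i\<in>I. A i)"
  have pos: "A i > 0" "B > 0" using insert by (auto simp: B_def intro!: sum_pos)
  have IH: "pint M q (\<lambda>x. \<Sum>i\<in>I. g i x) \<le> ennreal (B powr q)" unfolding B_def using insert by auto
  define l where "l = B / (A i + B)"
  have l: "0 < l" "l < 1" "1 - l = A i / (A i + B)" using pos by (auto simp: l_def field_simps)
  have "pint M q (\<lambda>x. \<Sum>i\<in>insert i I. g i x) = (\<integral>\<^sup>+ x. ennreal (\<bar>g i x + (\<Sum>i\<in>I. g i x)\<bar> powr q) \<partial>M)"
    using insert by (simp add: pint_def)
  also have "\<dots> \<le> ennreal ((1 - l) powr (1 - q)) * (\<integral>\<^sup>+ x. ennreal (\<bar>g i x\<bar> powr q) \<partial>M)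
       + ennreal (l powr (1 - q)) * (\<integral>\<^sup>+ x. ennreal (\<bar>\<Sum>i\<in>I. g i x\<bar> powr q) \<partial>M)"
  proof (rule nn_integral_linear_bound)
    show "(\<lambda>x. \<bar>g i x\<bar> powr q) \<in> borel_measurable M" using insert.prems(1)[of i] by auto
    have [measurable]: "(\<lambda>x. \<Sum>i\<in>I. g i x) \<in> borel_measurable M"
      using insert.prems(1) by (intro borel_measurable_sum) auto
    show "(\<lambda>x. \<bar>\<Sum>i\<in>I. g i x\<bar> powr q) \<in> borel_measurable M"
      by measurable
  qed (use powr_abs_add_le_convex[OF q l(1,2)] in auto)
  also have "\<dots> \<le> ennreal ((1 - l) powr (1 - q)) * ennreal (A i powr q) + ennreal (l powr (1 - q)) * ennreal (B powr q)"
    using IH insert.prems(3)[of i] by (intro add_mono mult_left_mono) (auto simp: pint_def)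
  also have "\<dots> = ennreal ((1 - l) powr (1 - q) * A i powr q + l powr (1 - q) * B powr q)"
    by (simp add: ennreal_mult)
  also have "(1 - l) powr (1 - q) * A i powr q + l powr (1 - q) * B powr q = (A i + B) powr q"
  proof -
    have *: "(a / (A i + B)) powr (1 - q) * a powr q = (A i + B) powr (q - 1) * a" if "a > 0" for a
    proof -
      have "(a / (A i + B)) powr (1 - q) * a powr q = (a powr (1 - q) * a powr q) / (A i + B) powr (1 - q)"
        using that pos by (simp add: powr_divide)
      also have "a powr (1 - q) * a powr q = a" using that by (simp add: powr_add[symmetric])
      also have "a / (A i + B) powr (1 - q) = (A i + B) powr (q - 1) * a"
        using powr_minus_divide[of "A i + B" "1 - q"] by simp
      finally show ?thesis .
    qed
    have "(1 - l) powr (1 - q) * A i powr q + l powr (1 - q) * B powr q = (A i + B) powr (q - 1) * (A i + B)"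
      unfolding l(3) using *[OF pos(1)] *[OF pos(2)] by (simp add: l_def distrib_left)
    also have "\<dots> = (A i + B) powr q" using pos by (simp add: powr_diff)
    finally show ?thesis .
  qed
  finally show ?case using insert by (simp add: B_def)
qed (simp add: pint_def)

section \<open>Energy and norm as integrals\<close>

text \<open>A density, unlike a restricted space, keeps the Borel sets of the whole space, so the
  same measurable functions serve for every \<Omega>.\<close>

definition dom_measure :: "'a::euclidean_space set \<Rightarrow> 'a measure" where
  "dom_measure \<Omega> = density lborel (indicator \<Omega>)"

text \<open>The singular kernel sits in the measure and not in the integrand, so the energy becomes
  a plain square integral of \<open>diffq u\<close>, which is linear in \<open>u\<close>. On the
  diagonal the density is \<open>1 / 0 = 0\<close>.\<close>

definition pair_measure_kernel :: "real \<Rightarrow> 'a::euclidean_space set \<Rightarrow> ('a \<times> 'a) measure" where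
  "pair_measure_kernel \<sigma> \<Omega> = density (lborel \<Otimes>\<^sub>M lborel) (\<lambda>z. indicator \<Omega> (fst z) * indicator \<Omega> (snd z) *
      ennreal (1 / norm (fst z - snd z) powr (real DIM('a) + 2 * \<sigma>)))"

definition diffq :: "('a \<Rightarrow> real) \<Rightarrow> 'a \<times> 'a \<Rightarrow> real" where
  "diffq u z = u (fst z) - u (snd z)"

lemma sets_dom_measure [measurable_cong]: "sets (dom_measure \<Omega>) = sets borel"
  by (simp add: dom_measure_def)

lemma sets_pair_measure_kernel [measurable_cong]:
  "sets (pair_measure_kernel \<sigma> (\<Omega> :: 'a::euclidean_space set)) = sets ((borel :: 'a measure) \<Otimes>\<^sub>M borel)"
  unfolding pair_measure_kernel_def by (simp cong: sets_pair_measure_cong)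

lemma diffq_measurable [measurable]:
  assumes [measurable]: "u \<in> borel_measurable borel"
  shows "diffq u \<in> borel_measurable (pair_measure_kernel \<sigma> \<Omega>)"
  unfolding diffq_def by measurable

lemma diffq_diff: "diffq (\<lambda>x. f x - g x) = (\<lambda>z. diffq f z - diffq g z)"
  by (auto simp: diffq_def fun_eq_iff)

lemma diffq_add: "diffq (\<lambda>x. f x + g x) = (\<lambda>z. diffq f z + diffq g z)"
  by (auto simp: diffq_def fun_eq_iff)

lemma diffq_cmult: "diffq (\<lambda>x. c * f x) = (\<lambda>z. c * diffq f z)"
  by (auto simp: diffq_def fun_eq_iff algebra_simps)

lemma lp_pow_eq_pint:
  assumes [measurable]: "\<Omega> \<in> sets borel" "u \<in> borel_measurable borel"
  shows "lp_pow p \<Omega> u = pint (dom_measure \<Omega>) p u"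
  unfolding lp_pow_def pint_def dom_measure_def by (subst nn_integral_density) auto

lemma gagliardo_eq_pint:
  fixes \<Omega> :: "'a::euclidean_space set"
  assumes [measurable]: "\<Omega> \<in> sets borel" "u \<in> borel_measurable borel"
  shows "gagliardo \<sigma> \<Omega> u = pint (pair_measure_kernel \<sigma> \<Omega>) 2 (diffq u)"
proof -
  let ?s = "real DIM('a) + 2 * \<sigma>"
  have "pint (pair_measure_kernel \<sigma> \<Omega>) 2 (diffq u)
      = (\<integral>\<^sup>+ z. indicator \<Omega> (fst z) * indicator \<Omega> (snd z) * ennreal (1 / norm (fst z - snd z) powr ?s) *
          ennreal (\<bar>diffq u z\<bar> powr 2) \<partial>(lborel \<Otimes>\<^sub>M lborel))"
    unfolding pint_def pair_measure_kernel_def by (subst nn_integral_density) (auto simp: diffq_def)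
  also have "\<dots> = (\<integral>\<^sup>+ x. \<integral>\<^sup>+ y. indicator \<Omega> x * indicator \<Omega> y * ennreal (1 / norm (x - y) powr ?s) *
          ennreal (\<bar>diffq u (x, y)\<bar> powr 2) \<partial>lborel \<partial>lborel)"
    by (subst lborel.nn_integral_fst[symmetric]) (auto simp: diffq_def)
  also have "\<dots> = gagliardo \<sigma> \<Omega> u"
    unfolding gagliardo_def
    by (intro nn_integral_cong) (auto simp: diffq_def mult.assoc ennreal_mult[symmetric])
  finally show ?thesis by simp
qed

lemma gagliardo_cong:
  assumes "\<And>x. x \<in> \<Omega> \<Longrightarrow> u x = v x"
  shows "gagliardo \<sigma> \<Omega> u = gagliardo \<sigma> \<Omega> v"
  unfolding gagliardo_def using assms by (intro nn_integral_cong) (auto simp: indicator_def)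

lemma lp_pow_cong:
  assumes "\<And>x. x \<in> \<Omega> \<Longrightarrow> u x = v x"
  shows "lp_pow p \<Omega> u = lp_pow p \<Omega> v"
  unfolding lp_pow_def using assms by (intro nn_integral_cong) (auto simp: indicator_def)

lemma AE_pair_measure_kernel_diffq:
  fixes \<Omega> :: "'a::euclidean_space set"
  assumes [measurable]: "\<Omega> \<in> sets borel" "\<And>k. f k \<in> borel_measurable borel" "g \<in> borel_measurable borel"
    and lim: "AE x in dom_measure \<Omega>. (\<lambda>k. f k x) \<longlonglongrightarrow> g x"
  shows "AE z in pair_measure_kernel \<sigma> \<Omega>. (\<lambda>k. diffq (f k) z) \<longlonglongrightarrow> diffq g z"
proof -
  have AE: "AE x in lborel. x \<in> \<Omega> \<longrightarrow> (\<lambda>k. f k x) \<longlonglongrightarrow> g x"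
    using lim unfolding dom_measure_def by (subst (asm) AE_density) (auto simp: indicator_def)
  have "AE z in lborel \<Otimes>\<^sub>M lborel. fst z \<in> \<Omega> \<longrightarrow> snd z \<in> \<Omega> \<longrightarrow> (\<lambda>k. diffq (f k) z) \<longlonglongrightarrow> diffq g z"
  proof (rule lborel_pair.AE_pair_measure)
    show "{z \<in> space (lborel \<Otimes>\<^sub>M lborel). fst z \<in> \<Omega> \<longrightarrow> snd z \<in> \<Omega> \<longrightarrow> (\<lambda>k. diffq (f k) z) \<longlonglongrightarrow> diffq g z}
      \<in> sets (lborel \<Otimes>\<^sub>M (lborel :: 'a measure))"
      unfolding diffq_def by measurable
    show "AE x in lborel. AE y in lborel. fst (x, y) \<in> \<Omega> \<longrightarrow> snd (x, y) \<in> \<Omega> \<longrightarrow> (\<lambda>k. diffq (f k) (x, y)) \<longlonglongrightarrow> diffq g (x, y)"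
      using AE
    proof eventually_elim
      case (elim x)
      show ?case using AE
        by eventually_elim (use elim in \<open>auto simp: diffq_def intro!: tendsto_diff\<close>)
    qed
  qed
  then show ?thesis
    unfolding pair_measure_kernel_def by (subst AE_density) (auto simp: indicator_def split: if_splits elim: eventually_mono)
qed

lemma pint_two: "pint M 2 f = (\<integral>\<^sup>+ x. ennreal ((f x)\<^sup>2) \<partial>M)"
  by (simp add: pint_def)

text \<open>Used in two ways: as an identity in the averaging argument that approximates the limit,
  and, with one term on the left dropped, as a quadratic triangle inequality.\<close>

lemma pint_parallelogram:
  assumes [measurable]: "f \<in> borel_measurable M" "g \<in> borel_measurable M"
  shows "pint M 2 (\<lambda>x. f x + g x) + pint M 2 (\<lambda>x. f x - g x) = 2 * (pint M 2 f + pint M 2 g)"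
proof -
  have "pint M 2 (\<lambda>x. f x + g x) + pint M 2 (\<lambda>x. f x - g x) = (\<integral>\<^sup>+ x. ennreal ((f x + g x)\<^sup>2) + ennreal ((f x - g x)\<^sup>2) \<partial>M)"
    unfolding pint_two by (rule nn_integral_add[symmetric]) auto
  also have "\<dots> = (\<integral>\<^sup>+ x. 2 * (ennreal ((f x)\<^sup>2) + ennreal ((g x)\<^sup>2)) \<partial>M)"
  proof (rule nn_integral_cong)
    fix x
    have "ennreal ((f x + g x)\<^sup>2) + ennreal ((f x - g x)\<^sup>2) = ennreal ((f x + g x)\<^sup>2 + (f x - g x)\<^sup>2)" by simp
    also have "(f x + g x)\<^sup>2 + (f x - g x)\<^sup>2 = 2 * ((f x)\<^sup>2 + (g x)\<^sup>2)" by (simp add: power2_eq_square algebra_simps)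
    also have "ennreal \<dots> = 2 * (ennreal ((f x)\<^sup>2) + ennreal ((g x)\<^sup>2))" by (subst ennreal_mult) auto
    finally show "ennreal ((f x + g x)\<^sup>2) + ennreal ((f x - g x)\<^sup>2) = 2 * (ennreal ((f x)\<^sup>2) + ennreal ((g x)\<^sup>2))" .
  qed
  also have "\<dots> = 2 * (pint M 2 f + pint M 2 g)"
    unfolding pint_two by (simp add: nn_integral_cmult nn_integral_add)
  finally show ?thesis .
qed

text \<open>Where the square is at most \<open>d\<close>, it contributes at most \<open>d\<close>
  per unit volume; elsewhere the negative power \<open>2 - p\<close> is bounded by its value at the
  threshold. Small \<open>d\<close> shrinks the first term, large \<open>d\<close> the coefficient
  of the second, and both regimes occur below.\<close>

lemma lp_pow_two_le:
  fixes u :: "'a::euclidean_space \<Rightarrow> real"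
  assumes p: "p > 2" and d: "d > 0" and [measurable]: "\<Omega> \<in> sets borel" "u \<in> borel_measurable borel"
  shows "lp_pow 2 \<Omega> u \<le> ennreal d * emeasure lborel \<Omega> + ennreal (d powr ((2 - p) / 2)) * lp_pow p \<Omega> u"
proof -
  have t: "t powr 2 \<le> d + d powr ((2 - p) / 2) * t powr p" if t: "t \<ge> 0" for t :: real
  proof (cases "t\<^sup>2 \<le> d")
    case True
    moreover have "0 \<le> d powr ((2 - p) / 2) * t powr p" by simp
    ultimately have "t\<^sup>2 \<le> d + d powr ((2 - p) / 2) * t powr p" by linarith
    then show ?thesis using t by simp
  next
    case False
    then have "t > 0" using d t by (cases "t = 0") auto
    have "(t powr 2) powr ((2 - p) / 2) \<le> d powr ((2 - p) / 2)"
      using False p d \<open>t > 0\<close> by (intro powr_mono2') auto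
    moreover have "(t powr 2) powr ((2 - p) / 2) = t powr (2 - p)"
    proof -
      have "2 * ((2 - p) / 2) = 2 - p" by simp
      then show ?thesis by (simp only: powr_powr)
    qed
    ultimately have "t powr (2 - p) * t powr p \<le> d powr ((2 - p) / 2) * t powr p"
      by (intro mult_right_mono) auto
    moreover have "t powr (2 - p) * t powr p = t powr 2" by (simp add: powr_add[symmetric])
    ultimately show ?thesis using d by linarith
  qed
  have "lp_pow 2 \<Omega> u \<le> (\<integral>\<^sup>+ x. ennreal d * indicator \<Omega> x + ennreal (d powr ((2 - p) / 2)) * (indicator \<Omega> x * ennreal (\<bar>u x\<bar> powr p)) \<partial>lborel)"
    unfolding lp_pow_def
  proof (rule nn_integral_mono)
    fix x
    have "ennreal (\<bar>u x\<bar> powr 2) \<le> ennreal (d + d powr ((2 - p) / 2) * \<bar>u x\<bar> powr p)"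
      using t[of "\<bar>u x\<bar>"] by (intro ennreal_leI) auto
    also have "\<dots> = ennreal d + ennreal (d powr ((2 - p) / 2)) * ennreal (\<bar>u x\<bar> powr p)"
      using d by (simp add: ennreal_mult)
    finally show "indicator \<Omega> x * ennreal (\<bar>u x\<bar> powr 2) \<le> ennreal d * indicator \<Omega> x + ennreal (d powr ((2 - p) / 2)) * (indicator \<Omega> x * ennreal (\<bar>u x\<bar> powr p))"
      by (auto simp: indicator_def)
  qed
  also have "\<dots> = ennreal d * emeasure lborel \<Omega> + ennreal (d powr ((2 - p) / 2)) * lp_pow p \<Omega> u"
    unfolding lp_pow_def by (simp add: nn_integral_add nn_integral_cmult nn_integral_cmult_indicator)
  finally show ?thesis .
qed

lemma kernel_bound_bounded:
  fixes \<Omega> :: "'a::euclidean_space set"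
  assumes "bounded \<Omega>" "0 \<le> s" "s < real DIM('a)"
  obtains C where "C \<ge> 0" "\<And>x. x \<in> \<Omega> \<Longrightarrow> (\<integral>\<^sup>+ y. indicator \<Omega> y * ennreal (1 / norm (x - y) powr s) \<partial>lborel) \<le> ennreal C"
proof -
  define R where "R = diameter \<Omega> + 1"
  define I where "I = (\<integral>\<^sup>+ z. indicator (ball 0 R) z * ennreal (1 / norm z powr s) \<partial>(lborel :: 'a measure))"
  have I: "I < \<infinity>" unfolding I_def using assms by (intro nn_integral_kernel_near_finite)
  show thesis
  proof (rule that[of "enn2real I"])
    fix x assume x: "x \<in> \<Omega>"
    have "(\<integral>\<^sup>+ y. indicator \<Omega> y * ennreal (1 / norm (x - y) powr s) \<partial>lborel)
      \<le> (\<integral>\<^sup>+ y. indicator (ball 0 R) (x - y) * ennreal (1 / norm (x - y) powr s) \<partial>lborel)"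
    proof (rule nn_integral_mono)
      fix y
      have "x - y \<in> ball 0 R" if "y \<in> \<Omega>"
        using diameter_bounded_bound[OF assms(1) x that] by (simp add: R_def dist_norm norm_minus_commute)
      then show "indicator \<Omega> y * ennreal (1 / norm (x - y) powr s) \<le> indicator (ball 0 R) (x - y) * ennreal (1 / norm (x - y) powr s)"
        by (auto simp: indicator_def)
    qed
    also have "\<dots> = I"
      unfolding I_def
    proof (rule nn_integral_translate[OF borel_measurable_times_ennreal[OF borel_measurable_indicator]])
      show "(\<lambda>x. ennreal (1 / norm x powr s)) \<in> borel_measurable (borel :: 'a measure)" by measurable
    qed simp
    finally show "(\<integral>\<^sup>+ y. indicator \<Omega> y * ennreal (1 / norm (x - y) powr s) \<partial>lborel) \<le> ennreal (enn2real I)"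
      using I by simp
  qed simp
qed

text \<open>At \<open>t = 0\<close> both sides are 0 by the conventions for division and
  \<open>powr\<close>, so the diagonal never has to be excluded when two powers of the singularity
  are cancelled.\<close>

lemma power2_divide_powr: "t \<ge> 0 \<Longrightarrow> t\<^sup>2 / t powr s = 1 / t powr (s - 2)" for t :: real
  by (cases "t = 0") (auto simp: powr_diff)

text \<open>Lipschitz continuity cancels two powers of the singularity. The remaining exponent lies
  below the dimension because \<open>\<sigma> < 1\<close>, so the kernel is integrable over a
  bounded set, uniformly in the first point.\<close>

lemma gagliardo_C1c_finite:
  fixes \<Omega> :: "'a::euclidean_space set"
  assumes \<Omega>: "open \<Omega>" "bounded \<Omega>" and \<sigma>: "\<sigma> < 1" "2 \<le> real DIM('a) + 2 * \<sigma>" and u: "u \<in> C1c A"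
  shows "gagliardo \<sigma> \<Omega> u < \<infinity>"
proof -
  let ?s = "real DIM('a) + 2 * \<sigma>"
  have [measurable]: "\<Omega> \<in> sets borel" using \<Omega> by simp
  obtain L where L: "L \<ge> 0" "\<And>x y. \<bar>u x - u y\<bar> \<le> L * norm (x - y)" using u by (rule C1c_Lipschitz) blast
  obtain C where C: "C \<ge> 0" "\<And>x. x \<in> \<Omega> \<Longrightarrow> (\<integral>\<^sup>+ y. indicator \<Omega> y * ennreal (1 / norm (x - y) powr (?s - 2)) \<partial>lborel) \<le> ennreal C"
    by (rule kernel_bound_bounded[of \<Omega> "?s - 2"]) (use \<Omega> \<sigma> in auto)
  have "gagliardo \<sigma> \<Omega> u \<le> (\<integral>\<^sup>+ x. ennreal (L\<^sup>2) * ennreal C * indicator \<Omega> x \<partial>lborel)"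
    unfolding gagliardo_def
  proof (rule nn_integral_mono)
    fix x
    have "(\<integral>\<^sup>+ y. indicator \<Omega> x * indicator \<Omega> y * ennreal ((u x - u y)\<^sup>2 / norm (x - y) powr ?s) \<partial>lborel)
      \<le> (\<integral>\<^sup>+ y. indicator \<Omega> x * ennreal (L\<^sup>2) * (indicator \<Omega> y * ennreal (1 / norm (x - y) powr (?s - 2))) \<partial>lborel)"
    proof (rule nn_integral_mono)
      fix y
      have "(u x - u y)\<^sup>2 \<le> L\<^sup>2 * (norm (x - y))\<^sup>2"
        using power_mono[OF L(2)[of x y], of 2] by (simp add: power_mult_distrib)
      then have "(u x - u y)\<^sup>2 / norm (x - y) powr ?s \<le> L\<^sup>2 * (norm (x - y))\<^sup>2 / norm (x - y) powr ?s"
        by (rule divide_right_mono) simp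
      also have "\<dots> = L\<^sup>2 * (1 / norm (x - y) powr (?s - 2))"
        unfolding times_divide_eq_right[symmetric] using power2_divide_powr[of "norm (x - y)" ?s] by simp
      finally have "ennreal ((u x - u y)\<^sup>2 / norm (x - y) powr ?s) \<le> ennreal (L\<^sup>2) * ennreal (1 / norm (x - y) powr (?s - 2))"
        by (simp add: ennreal_mult[symmetric] ennreal_leI)
      then show "indicator \<Omega> x * indicator \<Omega> y * ennreal ((u x - u y)\<^sup>2 / norm (x - y) powr ?s)
        \<le> indicator \<Omega> x * ennreal (L\<^sup>2) * (indicator \<Omega> y * ennreal (1 / norm (x - y) powr (?s - 2)))"
        by (auto simp: indicator_def)
    qed
    also have "\<dots> = indicator \<Omega> x * ennreal (L\<^sup>2) * (\<integral>\<^sup>+ y. indicator \<Omega> y * ennreal (1 / norm (x - y) powr (?s - 2)) \<partial>lborel)"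
      by (rule nn_integral_cmult) measurable
    also have "\<dots> \<le> ennreal (L\<^sup>2) * ennreal C * indicator \<Omega> x"
      using C(2)[of x] by (cases "x \<in> \<Omega>") (auto intro!: mult_left_mono)
    finally show "(\<integral>\<^sup>+ y. indicator \<Omega> x * indicator \<Omega> y * ennreal ((u x - u y)\<^sup>2 / norm (x - y) powr ?s) \<partial>lborel)
      \<le> ennreal (L\<^sup>2) * ennreal C * indicator \<Omega> x" .
  qed
  also have "\<dots> = ennreal (L\<^sup>2) * ennreal C * emeasure lborel \<Omega>"
    by (rule nn_integral_cmult_indicator) auto
  also have "\<dots> < \<infinity>" using emeasure_bounded_finite[OF \<Omega>(2)] by (simp add: ennreal_mult_less_top)
  finally show ?thesis .
qed

lemma lp_pow_C1c_finite:
  fixes \<Omega> :: "'a::euclidean_space set"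
  assumes \<Omega>: "open \<Omega>" "bounded \<Omega>" and u: "u \<in> C1c A" and p: "p \<ge> 0"
  shows "lp_pow p \<Omega> u < \<infinity>"
proof -
  have [measurable]: "\<Omega> \<in> sets borel" using \<Omega> by simp
  obtain B where B: "\<And>x. \<bar>u x\<bar> \<le> B" using u by (rule C1c_bounded) blast
  have "lp_pow p \<Omega> u \<le> (\<integral>\<^sup>+ x. ennreal (B powr p) * indicator \<Omega> x \<partial>lborel)"
    unfolding lp_pow_def using B p
    by (intro nn_integral_mono) (auto simp: indicator_def intro!: ennreal_leI powr_mono2)
  also have "\<dots> = ennreal (B powr p) * emeasure lborel \<Omega>"
    by (rule nn_integral_cmult_indicator) auto
  also have "\<dots> < \<infinity>" using emeasure_bounded_finite[OF \<Omega>(2)] by (simp add: ennreal_mult_less_top)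
  finally show ?thesis .
qed

section \<open>Nearly isometric charts and partitions of unity\<close>

text \<open>The half-space is tied to a fixed basis vector, so the normal of a boundary plane has to
  be turned into it. A reflection does this and is its own inverse, which keeps the inverse chart
  explicit. If \<open>a = b\<close>, then \<open>m = 0\<close> and the formula gives the
  identity.\<close>

lemma Householder_reflection:
  fixes a b :: "'a::euclidean_space"
  assumes "norm a = 1" "norm b = 1"
  obtains R where "bounded_linear R" "\<And>x. R (R x) = x" "\<And>x. norm (R x) = norm x" "\<And>x. R x \<bullet> b = x \<bullet> a"
proof
  define m where "m = a - b"
  define R where "R = (\<lambda>x. x - (2 * (x \<bullet> m) / (m \<bullet> m)) *\<^sub>R m)"
  have aa: "a \<bullet> a = 1" "b \<bullet> b = 1" using assms by (auto simp: dot_square_norm)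
  show "bounded_linear R"
    unfolding R_def linear_conv_bounded_linear[symmetric]
    by (rule linearI) (auto simp: algebra_simps inner_add_left add_divide_distrib scaleR_add_left)
  have Rm: "R x \<bullet> m = - (x \<bullet> m)" for x
    by (cases "m = 0") (auto simp: R_def inner_diff_left)
  show "R (R x) = x" for x
    using Rm[of x] by (subst (1) R_def) (simp add: R_def)
  have "R x \<bullet> R x = x \<bullet> x" for x
    by (cases "m = 0") (auto simp: R_def inner_diff_left inner_diff_right inner_commute power2_eq_square)
  then show "norm (R x) = norm x" for x by (simp add: norm_eq_sqrt_inner)
  show "R x \<bullet> b = x \<bullet> a" for x
  proof (cases "m = 0")
    case False
    then have mm: "m \<bullet> m \<noteq> 0" by simp
    have "m \<bullet> b = - (m \<bullet> m) / 2"
      unfolding m_def using aa by (simp add: inner_diff_left inner_diff_right inner_commute)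
    then have "R x \<bullet> b = x \<bullet> b + x \<bullet> m"
      using mm by (simp add: R_def inner_diff_left)
    then show ?thesis by (simp add: m_def inner_diff_right)
  qed (auto simp: R_def m_def)
qed

text \<open>The two maps are mutually inverse on the whole space, so a function composed with
  \<open>\<Psi>\<close> is defined everywhere without cutting off. Only the Lipschitz bounds and the
  matching of \<Omega> with the half-space are local.\<close>

definition near_isometric_chart ::
    "real \<Rightarrow> 'a::euclidean_space set \<Rightarrow> 'a \<Rightarrow> real \<Rightarrow> ('a \<Rightarrow> 'a) \<Rightarrow> ('a \<Rightarrow> 'a) \<Rightarrow> bool" where
  "near_isometric_chart L \<Omega> p r \<Phi> \<Psi> \<longleftrightarrow> 0 < r \<and> C1_map \<Phi> \<and> C1_map \<Psi> \<and>
     (\<forall>x. \<Psi> (\<Phi> x) = x) \<and> (\<forall>z. \<Phi> (\<Psi> z) = z) \<and>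
     (\<forall>x\<in>ball p r. \<forall>y\<in>ball p r. norm (\<Phi> x - \<Phi> y) \<le> L * norm (x - y) \<and> norm (x - y) \<le> L * norm (\<Phi> x - \<Phi> y)) \<and>
     (\<forall>x\<in>ball p r. x \<in> \<Omega> \<longleftrightarrow> \<Phi> x \<in> half_space)"

lemma half_space_altdef:
  obtains b where "b \<in> (Basis :: 'a::euclidean_space set)" "half_space = {x::'a. 0 < x \<bullet> b}"
proof -
  have "(SOME b. b \<in> (Basis :: 'a set)) \<in> Basis" using nonempty_Basis by (simp add: some_in_eq)
  then show thesis using that half_space_def by metis
qed

lemma open_half_space: "open (half_space :: 'a::euclidean_space set)"
  unfolding half_space_def by (rule open_halfspace_component_gt)

lemma near_isometric_chart_interior:
  fixes \<Omega> :: "'a::euclidean_space set"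
  assumes "open \<Omega>" "p \<in> \<Omega>" "L \<ge> 1"
  obtains r \<Phi> \<Psi> where "near_isometric_chart L \<Omega> p r \<Phi> \<Psi>"
proof -
  obtain r where r: "r > 0" "ball p r \<subseteq> \<Omega>" using assms open_contains_ball by blast
  obtain b where b: "b \<in> Basis" "half_space = {x::'a. 0 < x \<bullet> b}" using half_space_altdef by metis
  \<comment> \<open>The translation lifts the centre to height \<open>r\<close>, so the ball of
    radius \<open>r\<close> stays above the boundary plane.\<close>
  define c where "c = (r - p \<bullet> b) *\<^sub>R b"
  have "0 < (x + c) \<bullet> b" if "x \<in> ball p r" for x
  proof -
    have "\<bar>(p - x) \<bullet> b\<bar> \<le> norm (p - x)" using b(1) by (rule Basis_le_norm)
    then show ?thesis using that b(1) by (simp add: c_def dist_norm inner_add_left inner_diff_left)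
  qed
  moreover have "norm (x - y) \<le> L * norm (x - y)" for x y :: 'a
    using mult_right_mono[OF assms(3) norm_ge_zero, of "x - y"] by simp
  moreover have "C1_map (\<lambda>x. x + c)" "C1_map (\<lambda>x. x - c)"
    by (rule C1_map_add[OF C1_map_bounded_linear[OF bounded_linear_ident] C1_map_const]
        C1_map_diff[OF C1_map_bounded_linear[OF bounded_linear_ident] C1_map_const])+
  ultimately have "near_isometric_chart L \<Omega> p r (\<lambda>x. x + c) (\<lambda>x. x - c)"
    unfolding near_isometric_chart_def using r b(2) by auto
  then show thesis by (rule that)
qed

text \<open>The tangent plane of the graph is subtracted from \<open>\<gamma>\<close>; the resulting shear has derivative
  the identity at \<open>p\<close>, is explicitly invertible, and maps the supergraph to a half-space.\<close>

lemma near_isometric_chart_boundary: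
  fixes \<Omega> :: "'a::euclidean_space set"
  assumes "C1_boundary \<Omega>" "p \<in> frontier \<Omega>" "L > 1"
  obtains r \<Phi> \<Psi> where "near_isometric_chart L \<Omega> p r \<Phi> \<Psi>"
proof -
  obtain r0 \<nu> \<gamma> where r0: "r0 > 0" and \<nu>: "norm \<nu> = 1" and \<gamma>: "C1_fun \<gamma>" and inv: "\<And>x t. \<gamma> (x + t *\<^sub>R \<nu>) = \<gamma> x"
    and \<Omega>: "\<Omega> \<inter> ball p r0 = {x \<in> ball p r0. x \<bullet> \<nu> > \<gamma> x}"
    using assms(1,2) unfolding C1_boundary_def by blast
  obtain D where D: "\<And>x. (\<gamma> has_derivative blinfun_apply (D x)) (at x)" "continuous_on UNIV D"
    using \<gamma> unfolding C1_fun_def by blast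
  have D\<nu>: "D p \<nu> = 0"
  proof -
    have "((\<lambda>t. \<gamma> (p + t *\<^sub>R \<nu>)) has_derivative (\<lambda>h. D p (h *\<^sub>R \<nu>))) (at 0)"
      using D(1)[of "p + 0 *\<^sub>R \<nu>"]
      by (intro has_derivative_compose[where g = \<gamma> and f = "\<lambda>t. p + t *\<^sub>R \<nu>"]) (auto intro!: derivative_eq_intros)
    moreover have "((\<lambda>t. \<gamma> (p + t *\<^sub>R \<nu>)) has_derivative (\<lambda>h. 0)) (at 0)"
      unfolding inv by simp
    ultimately have "(\<lambda>h. D p (h *\<^sub>R \<nu>)) = (\<lambda>h. 0)" by (rule has_derivative_unique)
    from fun_cong[OF this, of 1] show ?thesis by simp
  qed
  define g where "g = (\<Sum>b\<in>Basis. D p b *\<^sub>R b)"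
  have g: "D p x = g \<bullet> x" for x
  proof -
    have "D p x = D p (\<Sum>b\<in>Basis. (x \<bullet> b) *\<^sub>R b)" by (simp add: euclidean_representation)
    also have "\<dots> = (\<Sum>b\<in>Basis. (x \<bullet> b) * D p b)" by (simp add: blinfun.sum_right blinfun.scaleR_right)
    also have "\<dots> = g \<bullet> x"
      unfolding g_def inner_sum_left inner_scaleR_left
      by (intro sum.cong refl) (simp add: inner_commute[of x] mult.commute)
    finally show ?thesis .
  qed
  \<comment> \<open>This function is still invariant along \<open>\<nu>\<close>, because
    \<open>D p \<nu> = 0\<close>; hence the shear by \<open>\<gamma>' x *\<^sub>R \<nu>\<close> is
    undone by adding the same multiple. Its derivative vanishes at \<open>p\<close>, which makes it
    Lipschitz with a small constant near \<open>p\<close>.\<close>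
  define \<gamma>' where "\<gamma>' = (\<lambda>x. \<gamma> x - D p x)"
  have inv': "\<gamma>' (x + t *\<^sub>R \<nu>) = \<gamma>' x" "\<gamma>' (x - t *\<^sub>R \<nu>) = \<gamma>' x" for x t
    using inv[of x t] inv[of x "-t"] D\<nu> by (auto simp: \<gamma>'_def blinfun.add_right blinfun.diff_right blinfun.scaleR_right)
  have C1\<gamma>': "C1_map \<gamma>'"
    unfolding \<gamma>'_def using \<gamma> by (intro C1_map_diff) (auto simp: C1_fun_iff_C1_map intro!: C1_map_bounded_linear blinfun.bounded_linear_right)
  \<comment> \<open>Serves both Lipschitz bounds: \<open>1 + e \<le> L\<close>, and
    \<open>1 - e\<close> is the reciprocal of \<open>L\<close>.\<close>
  define e where "e = (L - 1) / L"
  have e: "e > 0" "e \<le> L - 1" "L * (1 - e) = 1"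
    using assms(3) divide_left_mono[of 1 L "L - 1"] by (auto simp: e_def field_simps)
  obtain r1 where r1: "r1 > 0" "\<And>x. dist x p < r1 \<Longrightarrow> dist (D x) (D p) < e"
    using D(2) e(1) unfolding continuous_on_iff by (metis UNIV_I)
  define r where "r = min r0 r1"
  have r: "r > 0" using r0 r1 by (simp add: r_def)
  have lip: "\<bar>\<gamma>' x - \<gamma>' y\<bar> \<le> e * norm (x - y)" if "x \<in> ball p r" "y \<in> ball p r" for x y
  proof -
    have "norm (\<gamma>' x - \<gamma>' y) \<le> e * norm (x - y)"
    proof (rule differentiable_bound[where S = "ball p r" and f' = "\<lambda>x. blinfun_apply (D x - D p)"])
      fix x assume x: "x \<in> ball p r"
      show "(\<gamma>' has_derivative blinfun_apply (D x - D p)) (at x within ball p r)"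
        unfolding \<gamma>'_def minus_blinfun.rep_eq
        by (intro has_derivative_diff has_derivative_at_withinI[OF D(1)] bounded_linear_imp_has_derivative blinfun.bounded_linear_right)
      have "dist (D x) (D p) < e" using r1(2)[of x] x by (simp add: r_def dist_commute)
      then show "onorm (blinfun_apply (D x - D p)) \<le> e"
        by (simp add: norm_blinfun.rep_eq[symmetric] dist_norm)
    qed (use that in auto)
    then show ?thesis by simp
  qed
  \<comment> \<open>The normal of the flattened boundary: since
    \<open>w \<bullet> \<nu> = 1\<close>, the inner product of the sheared point with
    \<open>w\<close> is \<open>x \<bullet> w - \<gamma>' x\<close>, which equals
    \<open>x \<bullet> \<nu> - \<gamma> x\<close>.\<close>
  define w where "w = \<nu> - g"
  have "w \<bullet> \<nu> = 1" using \<nu> D\<nu> g[of \<nu>] by (simp add: w_def inner_diff_left dot_square_norm)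
  then have w0: "w \<noteq> 0" by auto
  define a where "a = w /\<^sub>R norm w"
  have a: "norm a = 1" using w0 by (simp add: a_def)
  obtain b where b: "b \<in> Basis" "half_space = {x::'a. 0 < x \<bullet> b}" using half_space_altdef by metis
  obtain R where R: "bounded_linear R" "\<And>x. R (R x) = x" "\<And>x. norm (R x) = norm x" "\<And>x. R x \<bullet> b = x \<bullet> a"
    using Householder_reflection[OF a, of b] b(1) by auto
  interpret R: bounded_linear R by fact
  define \<Phi> where "\<Phi> = (\<lambda>x. R (x - \<gamma>' x *\<^sub>R \<nu>))"
  define \<Psi> where "\<Psi> = (\<lambda>z. R z + \<gamma>' (R z) *\<^sub>R \<nu>)"
  have "near_isometric_chart L \<Omega> p r \<Phi> \<Psi>"
    unfolding near_isometric_chart_def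
  proof (intro conjI ballI allI)
    show "C1_map \<Phi>" unfolding \<Phi>_def
      by (intro C1_map_compose[OF _ C1_map_bounded_linear[OF R(1)]] C1_map_diff C1_map_scaleR C1\<gamma>' C1_map_const
          C1_map_bounded_linear bounded_linear_ident)
    show "C1_map \<Psi>" unfolding \<Psi>_def
      by (intro C1_map_add C1_map_scaleR C1_map_compose[OF _ C1\<gamma>'] C1_map_const C1_map_bounded_linear R(1))
    show "\<Psi> (\<Phi> x) = x" for x unfolding \<Phi>_def \<Psi>_def R(2) by (simp add: inv')
    show "\<Phi> (\<Psi> z) = z" for z unfolding \<Phi>_def \<Psi>_def by (simp add: inv' R(2))
  next
    fix x y assume xy: "x \<in> ball p r" "y \<in> ball p r"
    let ?d = "(\<gamma>' x - \<gamma>' y) *\<^sub>R \<nu>"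
    have eq: "norm (\<Phi> x - \<Phi> y) = norm ((x - y) - ?d)"
      unfolding \<Phi>_def R.diff[symmetric] R(3) by (simp add: algebra_simps)
    have d: "norm ?d \<le> e * norm (x - y)" using lip[OF xy] \<nu> by simp
    have "norm (\<Phi> x - \<Phi> y) \<le> (1 + e) * norm (x - y)"
      unfolding eq using norm_triangle_ineq4[of "x - y" ?d] d by (simp add: algebra_simps)
    also have "\<dots> \<le> L * norm (x - y)" using e by (intro mult_right_mono) auto
    finally show "norm (\<Phi> x - \<Phi> y) \<le> L * norm (x - y)" .
    have "(1 - e) * norm (x - y) \<le> norm (\<Phi> x - \<Phi> y)"
      unfolding eq using norm_triangle_ineq2[of "x - y" ?d] d by (simp add: algebra_simps)
    then have "L * ((1 - e) * norm (x - y)) \<le> L * norm (\<Phi> x - \<Phi> y)" using assms(3) by simp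
    then show "norm (x - y) \<le> L * norm (\<Phi> x - \<Phi> y)" using e(3) by (simp add: mult.assoc[symmetric])
  next
    fix x assume x: "x \<in> ball p r"
    then have "x \<in> ball p r0" by (simp add: r_def)
    then have "x \<in> \<Omega> \<longleftrightarrow> x \<bullet> \<nu> > \<gamma> x" using \<Omega> by blast
    also have "\<dots> \<longleftrightarrow> 0 < (x - \<gamma>' x *\<^sub>R \<nu>) \<bullet> w"
    proof -
      have "(x - \<gamma>' x *\<^sub>R \<nu>) \<bullet> w = x \<bullet> w - \<gamma>' x"
        using \<open>w \<bullet> \<nu> = 1\<close> by (simp add: inner_diff_left inner_diff_right inner_commute)
      also have "\<dots> = x \<bullet> \<nu> - \<gamma> x" by (simp add: w_def \<gamma>'_def g inner_diff_right inner_commute)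
      finally show ?thesis by simp
    qed
    also have "\<dots> \<longleftrightarrow> 0 < (x - \<gamma>' x *\<^sub>R \<nu>) \<bullet> a"
      using w0 by (simp add: a_def zero_less_mult_iff)
    also have "\<dots> \<longleftrightarrow> \<Phi> x \<in> half_space"
      unfolding b(2) \<Phi>_def using R(4) by simp
    finally show "x \<in> \<Omega> \<longleftrightarrow> \<Phi> x \<in> half_space" .
  qed (rule r)
  then show thesis by (rule that)
qed

lemma near_isometric_chart_exists:
  fixes \<Omega> :: "'a::euclidean_space set"
  assumes "open \<Omega>" "C1_boundary \<Omega>" "p \<in> closure \<Omega>" "L > 1"
  shows "\<exists>r \<Phi> \<Psi>. near_isometric_chart L \<Omega> p r \<Phi> \<Psi>"
proof (cases "p \<in> \<Omega>")
  case True
  then show ?thesis using near_isometric_chart_interior[OF assms(1)] assms(4) by (metis less_imp_le)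
next
  case False
  then have "p \<in> frontier \<Omega>" using assms by (simp add: frontier_def interior_open)
  then show ?thesis using near_isometric_chart_boundary[OF assms(2) _ assms(4)] by metis
qed

text \<open>Squares are asked to sum to 1 because the energy is quadratic: in the localized energy
  the cutoffs then survive only through their differences. The Lipschitz bound controls these
  differences, and C^1 regularity keeps the localized pieces in \<open>C1c\<close>.\<close>

lemma quadratic_partition_of_unity:
  fixes K :: "'a::euclidean_space set"
  assumes K: "compact K" and r: "\<And>p. p \<in> K \<Longrightarrow> r p > 0"
  obtains P \<zeta> L where "finite P" "P \<subseteq> K" "\<And>p. p \<in> P \<Longrightarrow> C1_map (\<zeta> p)"
    "\<And>p x. p \<in> P \<Longrightarrow> \<zeta> p x \<noteq> 0 \<Longrightarrow> x \<in> ball p (r p)"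
    "\<And>x. x \<in> K \<Longrightarrow> (\<Sum>p\<in>P. (\<zeta> p x)\<^sup>2) = 1"
    "\<And>p x y. p \<in> P \<Longrightarrow> \<bar>\<zeta> p x - \<zeta> p y\<bar> \<le> L * norm (x - y :: 'a)"
proof -
  obtain P where P: "P \<subseteq> K" "finite P" "K \<subseteq> (\<Union>p\<in>P. ball p (r p))"
    by (rule compactE_image[OF K, of K "\<lambda>p. ball p (r p)"]) (use r in auto)
  define \<eta> where "\<eta> = (\<lambda>p x. (max 0 (1 - ((x - p) \<bullet> (x - p)) / (r p)\<^sup>2))\<^sup>2)"
  define s where "s = (\<lambda>x. \<Sum>p\<in>P. (\<eta> p x)\<^sup>2)"
  have "C1_map (\<lambda>x::'a. x \<bullet> x)"
    by (rule C1_mapI[of _ "\<lambda>x. 2 *\<^sub>R blinfun_inner_right x"])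
      (auto intro!: derivative_eq_intros continuous_intros bounded_linear.continuous_on[OF bounded_linear_blinfun_inner_right]
        simp: scaleR_blinfun.rep_eq inner_commute)
  then have "C1_map (\<lambda>x. (x - p) \<bullet> (x - p))" for p :: 'a
    by (rule C1_map_compose[rotated]) (intro C1_map_diff C1_map_const C1_map_bounded_linear bounded_linear_ident)
  then have "C1_map (\<lambda>x. 1 / (r p)\<^sup>2 * ((x - p) \<bullet> (x - p)))" for p :: 'a
    by (intro C1_map_mult C1_map_const)
  then have C\<eta>: "C1_map (\<eta> p)" for p
    unfolding \<eta>_def by (intro C1_map_max_0_power2 C1_map_diff C1_map_const) simp
  have Cs: "C1_map s"
    unfolding s_def power2_eq_square using P(2) by (intro C1_map_sum C1_map_mult C\<eta>)
  have \<eta>ball: "\<eta> p x \<noteq> 0 \<longleftrightarrow> x \<in> ball p (r p)" if "p \<in> P" for p x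
  proof -
    have rp: "r p > 0" using that P(1) r by blast
    have "(max 0 (1 - t))\<^sup>2 \<noteq> 0 \<longleftrightarrow> t < 1" for t :: real by (auto simp: max_def)
    then have "\<eta> p x \<noteq> 0 \<longleftrightarrow> ((x - p) \<bullet> (x - p)) / (r p)\<^sup>2 < 1" unfolding \<eta>_def .
    also have "\<dots> \<longleftrightarrow> (norm (x - p))\<^sup>2 < (r p)\<^sup>2" using rp by (simp add: power2_norm_eq_inner)
    also have "\<dots> \<longleftrightarrow> norm (x - p) < r p" using rp
      by (intro iffI power_strict_mono) (auto intro: power2_less_imp_less)
    finally show ?thesis by (simp add: dist_norm norm_minus_commute)
  qed
  have s0: "s x \<ge> 0" for x unfolding s_def by (intro sum_nonneg) auto
  have spos: "s x > 0" if x: "x \<in> K" for x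
  proof -
    obtain p where p: "p \<in> P" "x \<in> ball p (r p)" using P(3) x by blast
    have "0 < (\<eta> p x)\<^sup>2" using \<eta>ball[OF p(1)] p(2) by simp
    also have "\<dots> \<le> s x" unfolding s_def by (rule member_le_sum) (use p P in auto)
    finally show ?thesis .
  qed
  obtain c where c: "c > 0" "\<And>x. x \<in> K \<Longrightarrow> c \<le> s x"
  proof (cases "K = {}")
    case False
    obtain x where "x \<in> K" "\<And>y. y \<in> K \<Longrightarrow> s x \<le> s y"
      using continuous_attains_inf[OF K False C1_map_continuous_on[OF Cs]] by blast
    then show thesis using that[of "s x"] spos by blast
  qed (use that[of 1] in auto)
  \<comment> \<open>Away from \<open>K\<close> the sum \<open>s\<close> may vanish. The added term
    keeps the denominator positive everywhere and is zero on \<open>K\<close>, where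
    \<open>s\<close> is at least \<open>c\<close>.\<close>
  define \<zeta> where "\<zeta> = (\<lambda>p x. \<eta> p x / sqrt (s x + (max 0 (c - s x))\<^sup>2))"
  have den: "0 < s x + (max 0 (c - s x))\<^sup>2" for x
    using s0[of x] c(1) by (cases "s x = 0") (auto intro!: add_pos_nonneg)
  have C\<zeta>: "C1_map (\<zeta> p)" for p
    unfolding \<zeta>_def using den by (intro C1_map_divide_sqrt C\<eta> C1_map_add Cs C1_map_max_0_power2 C1_map_diff C1_map_const)
  have ball: "x \<in> ball p (r p)" if "p \<in> P" "\<zeta> p x \<noteq> 0" for p x
    using that \<eta>ball[OF that(1), of x] by (auto simp: \<zeta>_def)
  have sum1: "(\<Sum>p\<in>P. (\<zeta> p x)\<^sup>2) = 1" if "x \<in> K" for x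
  proof -
    have "(\<Sum>p\<in>P. (\<zeta> p x)\<^sup>2) = (\<Sum>p\<in>P. (\<eta> p x)\<^sup>2 / s x)"
      using c(2)[OF that] s0[of x] by (simp add: \<zeta>_def power_divide max_def)
    also have "\<dots> = 1" using spos[OF that] by (simp add: sum_divide_distrib[symmetric] s_def)
    finally show ?thesis .
  qed
  have "\<exists>L. L \<ge> 0 \<and> (\<forall>x y. \<bar>\<zeta> p x - \<zeta> p y\<bar> \<le> L * norm (x - y))" if "p \<in> P" for p
  proof -
    have "\<zeta> p \<in> C1c UNIV"
      by (rule C1cI[where K = "cball p (r p)"]) (use C\<zeta> ball[OF that] in \<open>force+\<close>)
    then show ?thesis using C1c_Lipschitz by metis
  qed
  then obtain l where l: "\<And>p. p \<in> P \<Longrightarrow> l p \<ge> 0" "\<And>p x y. p \<in> P \<Longrightarrow> \<bar>\<zeta> p x - \<zeta> p y\<bar> \<le> l p * norm (x - y)"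
    by metis
  have "\<bar>\<zeta> p x - \<zeta> p y\<bar> \<le> sum l P * norm (x - y)" if "p \<in> P" for p x y
  proof -
    have "l p \<le> sum l P" using that l(1) P(2) by (intro member_le_sum) auto
    then have "l p * norm (x - y) \<le> sum l P * norm (x - y)" by (rule mult_right_mono) simp
    then show ?thesis using l(2)[OF that, of x y] by linarith
  qed
  then show thesis using that[OF P(2,1) C\<zeta> ball sum1] by blast
qed

section \<open>Sobolev inequality modulo lower-order terms\<close>

text \<open>A Schur-type bound: by Fubini and symmetry of the kernel the two halves are equal, and
  each is estimated by integrating the kernel in one variable. It is the device that puts both kinds
  of error, interactions across the edge of a chart and commutators with cutoffs, into the square
  norm.\<close>

lemma nn_integral_symmetric_kernel_le:
  fixes f :: "'a::euclidean_space \<Rightarrow> ennreal" and k :: "'a \<Rightarrow> 'a \<Rightarrow> ennreal"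
  assumes [measurable]: "f \<in> borel_measurable borel" "case_prod k \<in> borel_measurable (borel \<Otimes>\<^sub>M borel)"
    and sym: "\<And>x y. k x y = k y x" and bd: "\<And>x. f x \<noteq> 0 \<Longrightarrow> (\<integral>\<^sup>+ y. k x y \<partial>lborel) \<le> C"
  shows "(\<integral>\<^sup>+ x. \<integral>\<^sup>+ y. (f x + f y) * k x y \<partial>lborel \<partial>lborel) \<le> 2 * C * (\<integral>\<^sup>+ x. f x \<partial>lborel)"
proof -
  have one: "(\<integral>\<^sup>+ x. \<integral>\<^sup>+ y. f x * k x y \<partial>lborel \<partial>lborel) \<le> C * (\<integral>\<^sup>+ x. f x \<partial>lborel)"
  proof -
    have "(\<integral>\<^sup>+ x. \<integral>\<^sup>+ y. f x * k x y \<partial>lborel \<partial>lborel) \<le> (\<integral>\<^sup>+ x. C * f x \<partial>lborel)"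
    proof (rule nn_integral_mono)
      fix x
      have "(\<integral>\<^sup>+ y. f x * k x y \<partial>lborel) = f x * (\<integral>\<^sup>+ y. k x y \<partial>lborel)"
        by (rule nn_integral_cmult) measurable
      also have "\<dots> \<le> f x * C" using bd[of x] by (cases "f x = 0") (auto intro: mult_left_mono)
      finally show "(\<integral>\<^sup>+ y. f x * k x y \<partial>lborel) \<le> C * f x" by (simp add: mult.commute)
    qed
    also have "\<dots> = C * (\<integral>\<^sup>+ x. f x \<partial>lborel)" by (rule nn_integral_cmult) measurable
    finally show ?thesis .
  qed
  have "(\<integral>\<^sup>+ x. \<integral>\<^sup>+ y. (f x + f y) * k x y \<partial>lborel \<partial>lborel)
     = (\<integral>\<^sup>+ x. (\<integral>\<^sup>+ y. f x * k x y \<partial>lborel) + (\<integral>\<^sup>+ y. f y * k x y \<partial>lborel) \<partial>lborel)"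
    unfolding distrib_right by (intro nn_integral_cong nn_integral_add) measurable
  also have "\<dots> = (\<integral>\<^sup>+ x. \<integral>\<^sup>+ y. f x * k x y \<partial>lborel \<partial>lborel) + (\<integral>\<^sup>+ x. \<integral>\<^sup>+ y. f y * k x y \<partial>lborel \<partial>lborel)"
    by (rule nn_integral_add) measurable
  also have "(\<integral>\<^sup>+ x. \<integral>\<^sup>+ y. f y * k x y \<partial>lborel \<partial>lborel) = (\<integral>\<^sup>+ y. \<integral>\<^sup>+ x. f y * k x y \<partial>lborel \<partial>lborel)"
    by (rule lborel_pair.Fubini'[symmetric]) measurable
  also have "\<dots> = (\<integral>\<^sup>+ x. \<integral>\<^sup>+ y. f x * k x y \<partial>lborel \<partial>lborel)"
    by (subst sym) (rule refl)
  finally show ?thesis using add_mono[OF one one] by (simp add: mult_2 distrib_right)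
qed

lemma nn_integral_double_cmult_add:
  fixes N k :: "'a::euclidean_space \<Rightarrow> 'a \<Rightarrow> ennreal"
  assumes [measurable]: "case_prod N \<in> borel_measurable (borel \<Otimes>\<^sub>M borel)" "case_prod k \<in> borel_measurable (borel \<Otimes>\<^sub>M borel)"
  shows "(\<integral>\<^sup>+ x. \<integral>\<^sup>+ y. c * N x y + k x y \<partial>lborel \<partial>lborel)
     = c * (\<integral>\<^sup>+ x. \<integral>\<^sup>+ y. N x y \<partial>lborel \<partial>lborel) + (\<integral>\<^sup>+ x. \<integral>\<^sup>+ y. k x y \<partial>lborel \<partial>lborel)"
proof -
  have "(\<integral>\<^sup>+ y. c * N x y + k x y \<partial>lborel) = c * (\<integral>\<^sup>+ y. N x y \<partial>lborel) + (\<integral>\<^sup>+ y. k x y \<partial>lborel)" for x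
  proof -
    have "(\<integral>\<^sup>+ y. c * N x y + k x y \<partial>lborel) = (\<integral>\<^sup>+ y. c * N x y \<partial>lborel) + (\<integral>\<^sup>+ y. k x y \<partial>lborel)"
      by (rule nn_integral_add) measurable
    also have "(\<integral>\<^sup>+ y. c * N x y \<partial>lborel) = c * (\<integral>\<^sup>+ y. N x y \<partial>lborel)"
      by (rule nn_integral_cmult) measurable
    finally show ?thesis .
  qed
  then have "(\<integral>\<^sup>+ x. \<integral>\<^sup>+ y. c * N x y + k x y \<partial>lborel \<partial>lborel)
     = (\<integral>\<^sup>+ x. c * (\<integral>\<^sup>+ y. N x y \<partial>lborel) + (\<integral>\<^sup>+ y. k x y \<partial>lborel) \<partial>lborel)"
    by simp
  also have "\<dots> = (\<integral>\<^sup>+ x. c * (\<integral>\<^sup>+ y. N x y \<partial>lborel) \<partial>lborel) + (\<integral>\<^sup>+ x. \<integral>\<^sup>+ y. k x y \<partial>lborel \<partial>lborel)"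
    by (rule nn_integral_add) measurable
  also have "(\<integral>\<^sup>+ x. c * (\<integral>\<^sup>+ y. N x y \<partial>lborel) \<partial>lborel) = c * (\<integral>\<^sup>+ x. \<integral>\<^sup>+ y. N x y \<partial>lborel \<partial>lborel)"
    by (rule nn_integral_cmult) measurable
  finally show ?thesis .
qed

section \<open>Transfer through charts and localization\<close>

lemma kernel_far_bound:
  fixes d s :: real
  assumes "s > real DIM('a::euclidean_space)" "d > 0"
  obtains C where "C \<ge> 0"
    "\<And>x :: 'a. (\<integral>\<^sup>+ y. indicator {z. d \<le> norm z} (x - y) * ennreal (1 / norm (x - y) powr s) \<partial>lborel) \<le> ennreal C"
proof -
  define I where "I = (\<integral>\<^sup>+ z. indicator {z. d \<le> norm z} z * ennreal (1 / norm z powr s) \<partial>(lborel :: 'a measure))"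
  have I: "I < \<infinity>" unfolding I_def using assms by (intro nn_integral_kernel_far_finite)
  have "(\<integral>\<^sup>+ y. indicator {z. d \<le> norm z} (x - y) * ennreal (1 / norm (x - y) powr s) \<partial>lborel) = I" for x :: 'a
    unfolding I_def
  proof (rule nn_integral_translate[OF borel_measurable_times_ennreal[OF borel_measurable_indicator]])
    show "(\<lambda>x. ennreal (1 / norm x powr s)) \<in> borel_measurable (borel :: 'a measure)" by measurable
    have "closed {z :: 'a. d \<le> norm z}" by (intro closed_Collect_le continuous_intros)
    then show "{z :: 'a. d \<le> norm z} \<in> sets borel" by (rule borel_closed)
  qed
  then show thesis using I by (intro that[of "enn2real I"]) auto
qed

text \<open>Pairs with both points in \<open>ball p r\<close> go through the change of variables,
  with one factor \<open>L ^ DIM('a)\<close> per variable and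
  \<open>L powr (n + 2 * \<sigma>)\<close>, n being the dimension, from the kernel; hence the
  exponent 3n + 2\<sigma>. In every other contributing pair one value is 0 and the other is attained
  in the smaller ball, so the images have distance at least \<open>d\<close>. There the kernel is
  integrable and a square-norm term suffices.\<close>

lemma chart_transfer:
  fixes \<Omega> :: "'a::euclidean_space set"
  assumes \<Omega>: "open \<Omega>" and ch: "near_isometric_chart L \<Omega> p r \<Phi> \<Psi>" and L: "L \<ge> 1" and \<sigma>: "0 < \<sigma>"
  obtains C where "C \<ge> 0"
    "\<And>v. v \<in> C1c \<Omega> \<Longrightarrow> closure {x. v x \<noteq> 0} \<subseteq> cball p (r / 2) \<Longrightarrow>
       gagliardo \<sigma> half_space (\<lambda>z. v (\<Psi> z))
         \<le> ennreal (L powr (3 * real DIM('a) + 2 * \<sigma>)) * gagliardo \<sigma> \<Omega> v + ennreal C * lp_pow 2 \<Omega> v"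
    "\<And>v q. v \<in> C1c \<Omega> \<Longrightarrow> closure {x. v x \<noteq> 0} \<subseteq> cball p (r / 2) \<Longrightarrow> q > 0 \<Longrightarrow>
       lp_pow q half_space (\<lambda>z. v (\<Psi> z)) \<le> ennreal (L ^ DIM('a)) * lp_pow q \<Omega> v"
    "\<And>v q. v \<in> C1c \<Omega> \<Longrightarrow> closure {x. v x \<noteq> 0} \<subseteq> cball p (r / 2) \<Longrightarrow> q > 0 \<Longrightarrow>
       lp_pow q \<Omega> v \<le> ennreal (L ^ DIM('a)) * lp_pow q half_space (\<lambda>z. v (\<Psi> z))"
    "\<And>v. v \<in> C1c \<Omega> \<Longrightarrow> closure {x. v x \<noteq> 0} \<subseteq> cball p (r / 2) \<Longrightarrow> (\<lambda>z. v (\<Psi> z)) \<in> C1c half_space"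
proof -
  let ?n = "DIM('a)" and ?H = "half_space :: 'a set" and ?B = "ball p r" and ?Q = "cball p (r / 2)"
  define s where "s = real DIM('a) + 2 * \<sigma>"
  have s: "s > real DIM('a)" "s > 0" using \<sigma> by (auto simp: s_def)
  have r: "r > 0" and C1: "C1_map \<Phi>" "C1_map \<Psi>" and inv: "\<And>x. \<Psi> (\<Phi> x) = x" "\<And>z. \<Phi> (\<Psi> z) = z"
    and lip: "\<And>x y. x \<in> ?B \<Longrightarrow> y \<in> ?B \<Longrightarrow> norm (\<Phi> x - \<Phi> y) \<le> L * norm (x - y)"
      "\<And>x y. x \<in> ?B \<Longrightarrow> y \<in> ?B \<Longrightarrow> norm (x - y) \<le> L * norm (\<Phi> x - \<Phi> y)"
    and mem: "\<And>x. x \<in> ?B \<Longrightarrow> x \<in> \<Omega> \<longleftrightarrow> \<Phi> x \<in> ?H"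
    using ch unfolding near_isometric_chart_def by auto
  have cont: "continuous_on S \<Phi>" "continuous_on S \<Psi>" for S using C1 by (auto intro: C1_map_continuous_on)
  have [measurable]: "\<Phi> \<in> borel_measurable borel" "\<Psi> \<in> borel_measurable borel"
    using cont by (auto intro: borel_measurable_continuous_onI)
  have [measurable]: "\<Omega> \<in> sets borel" "?H \<in> sets borel" "?B \<in> sets borel" using \<Omega> by (auto intro: borel_open open_half_space)
  have L0: "L > 0" using L by simp
  have mem': "\<Psi> z \<in> \<Omega> \<longleftrightarrow> z \<in> ?H" if "\<Psi> z \<in> ?B" for z using mem[OF that] inv(2) by simp
  have QB: "?Q \<subseteq> ?B" using r by (auto simp: subset_iff)
  define V where "V = \<Psi> -` ?B"
  have V: "open V" unfolding V_def using cont(2)[of UNIV] by (simp add: continuous_on_open_vimage)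
  have lipV: "norm (\<Psi> z - \<Psi> y) \<le> L * norm (z - y)" if "z \<in> V" "y \<in> V" for z y
    using lip(2)[of "\<Psi> z" "\<Psi> y"] that inv(2) by (simp add: V_def)
  note cv1 = nn_integral_Lipschitz_le[OF L0 open_ball lip(1) cont(2)[of UNIV] inv]
  note cv2 = nn_integral_Lipschitz_le[OF L0 V lipV cont(1)[of UNIV] inv(2,1)]
  have zero: "v x = 0" if "closure {x. v x \<noteq> 0} \<subseteq> ?Q" "x \<notin> ?Q" for v :: "'a \<Rightarrow> real" and x
    using that closure_subset[of "{x. v x \<noteq> 0}"] by blast
  have zeroB: "v x = 0" if "closure {x. v x \<noteq> 0} \<subseteq> ?Q" "x \<notin> ?B" for v :: "'a \<Rightarrow> real" and x
    using zero[OF that(1)] that(2) QB by blast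
  have lp1: "lp_pow q ?H (\<lambda>z. v (\<Psi> z)) \<le> ennreal (L ^ ?n) * lp_pow q \<Omega> v"
    if v: "v \<in> C1c \<Omega>" "closure {x. v x \<noteq> 0} \<subseteq> ?Q" "q > 0" for v and q :: real
  proof -
    have [measurable]: "v \<in> borel_measurable borel" using v(1) by (rule C1c_borel_measurable)
    let ?G = "\<lambda>x. indicator \<Omega> x * ennreal (\<bar>v x\<bar> powr q)"
    have "lp_pow q ?H (\<lambda>z. v (\<Psi> z)) = (\<integral>\<^sup>+ z. indicator ?B (\<Psi> z) * ?G (\<Psi> z) \<partial>lborel)"
      unfolding lp_pow_def
    proof (rule nn_integral_cong)
      fix z
      show "indicator ?H z * ennreal (\<bar>v (\<Psi> z)\<bar> powr q) = indicator ?B (\<Psi> z) * ?G (\<Psi> z)"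
        using mem'[of z] zeroB[OF v(2), of "\<Psi> z"] v(3) by (cases "\<Psi> z \<in> ?B") (auto simp: indicator_def)
    qed
    also have "\<dots> \<le> ennreal (L ^ ?n) * (\<integral>\<^sup>+ x. indicator ?B x * ?G x \<partial>lborel)"
      by (rule cv1) measurable
    also have "\<dots> \<le> ennreal (L ^ ?n) * lp_pow q \<Omega> v"
      unfolding lp_pow_def by (intro mult_left_mono nn_integral_mono) (auto simp: indicator_def)
    finally show ?thesis .
  qed
  have lp2: "lp_pow q \<Omega> v \<le> ennreal (L ^ ?n) * lp_pow q ?H (\<lambda>z. v (\<Psi> z))"
    if v: "v \<in> C1c \<Omega>" "closure {x. v x \<noteq> 0} \<subseteq> ?Q" "q > 0" for v and q :: real
  proof -
    have [measurable]: "v \<in> borel_measurable borel" using v(1) by (rule C1c_borel_measurable)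
    let ?G = "\<lambda>z. indicator ?H z * ennreal (\<bar>v (\<Psi> z)\<bar> powr q)"
    have "lp_pow q \<Omega> v = (\<integral>\<^sup>+ x. indicator V (\<Phi> x) * ?G (\<Phi> x) \<partial>lborel)"
      unfolding lp_pow_def
    proof (rule nn_integral_cong)
      fix x
      show "indicator \<Omega> x * ennreal (\<bar>v x\<bar> powr q) = indicator V (\<Phi> x) * ?G (\<Phi> x)"
        using mem[of x] zeroB[OF v(2), of x] v(3) by (cases "x \<in> ?B") (auto simp: indicator_def V_def inv)
    qed
    also have "\<dots> \<le> ennreal (L ^ ?n) * (\<integral>\<^sup>+ z. indicator V z * ?G z \<partial>lborel)"
      by (rule cv2) measurable
    also have "\<dots> \<le> ennreal (L ^ ?n) * lp_pow q ?H (\<lambda>z. v (\<Psi> z))"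
      unfolding lp_pow_def by (intro mult_left_mono nn_integral_mono) (auto simp: indicator_def)
    finally show ?thesis .
  qed
  have C1c: "(\<lambda>z. v (\<Psi> z)) \<in> C1c ?H" if "v \<in> C1c \<Omega>" "closure {x. v x \<noteq> 0} \<subseteq> ?Q" for v
    by (rule C1c_compose[OF that(1) C1(2) cont(1) inv(2) that(2)]) (use mem QB in auto)
  \<comment> \<open>The image of the smaller closed ball is compact and disjoint from the closed
    complement of the image of \<open>ball p r\<close>. Keeping supports in the ball of half the
    radius buys this gap.\<close>
  obtain d where d: "d > 0" "\<And>z y. \<Psi> z \<in> ?Q \<Longrightarrow> \<Psi> y \<notin> ?B \<Longrightarrow> d \<le> norm (z - y)"
  proof -
    have "compact (\<Phi> ` ?Q)" by (intro compact_continuous_image cont compact_cball)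
    moreover have "closed (- V)" using V by (simp add: closed_Compl)
    moreover have "\<Phi> ` ?Q \<inter> - V = {}" using QB by (auto simp: V_def inv)
    ultimately obtain d where "d > 0" "\<forall>x\<in>\<Phi> ` ?Q. \<forall>y\<in>- V. d \<le> dist x y"
      using separate_compact_closed by metis
    then show thesis using that[of d] inv(2) unfolding V_def dist_norm
      by (metis ComplI imageI vimageE)
  qed
  obtain C where C: "C \<ge> 0" "\<And>x :: 'a. (\<integral>\<^sup>+ y. indicator {z. d \<le> norm z} (x - y) * ennreal (1 / norm (x - y) powr s) \<partial>lborel) \<le> ennreal C"
    by (rule kernel_far_bound[OF s(1) d(1)]) blast
  have gag: "gagliardo \<sigma> ?H (\<lambda>z. v (\<Psi> z))
         \<le> ennreal (L powr (3 * real DIM('a) + 2 * \<sigma>)) * gagliardo \<sigma> \<Omega> v + ennreal (2 * C * L ^ ?n) * lp_pow 2 \<Omega> v"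
    if v: "v \<in> C1c \<Omega>" "closure {x. v x \<noteq> 0} \<subseteq> ?Q" for v
  proof -
    have [measurable]: "v \<in> borel_measurable borel" using v(1) by (rule C1c_borel_measurable)
    define G where "G = (\<lambda>x y. indicator \<Omega> x * indicator \<Omega> y * ennreal ((v x - v y)\<^sup>2 / norm (x - y) powr s))"
    define f where "f = (\<lambda>z. indicator ?H z * ennreal (\<bar>v (\<Psi> z)\<bar> powr 2))"
    define k where "k = (\<lambda>z y :: 'a. indicator {z. d \<le> norm z} (z - y) * ennreal (1 / norm (z - y) powr s))"
    have Gm: "case_prod G \<in> borel_measurable (borel \<Otimes>\<^sub>M borel)" unfolding G_def by measurable
    have [measurable]: "f \<in> borel_measurable borel" unfolding f_def by measurable
    have "closed {z :: 'a. d \<le> norm z}" by (intro closed_Collect_le continuous_intros)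
    then have [measurable]: "{z :: 'a. d \<le> norm z} \<in> sets borel" by (rule borel_closed)
    have km: "case_prod k \<in> borel_measurable (borel \<Otimes>\<^sub>M borel)"
    proof -
      have "(\<lambda>z. indicator {z. d \<le> norm z} (fst z - snd z) :: ennreal) \<in> borel_measurable (borel \<Otimes>\<^sub>M (borel :: 'a measure))"
        by (rule measurable_compose[OF _ borel_measurable_indicator]) measurable
      then have "(\<lambda>z. indicator {z. d \<le> norm z} (fst z - snd z) * ennreal (1 / norm (fst z - snd z) powr s)) \<in> borel_measurable (borel \<Otimes>\<^sub>M (borel :: 'a measure))"
        by (rule borel_measurable_times_ennreal) measurable
      then show ?thesis by (simp add: k_def case_prod_beta')
    qed
    note [measurable] = Gm km
    let ?c = "ennreal (L powr s)"
    have pw: "indicator ?H z * indicator ?H y * ennreal ((v (\<Psi> z) - v (\<Psi> y))\<^sup>2 / norm (z - y) powr s)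
       \<le> ?c * (indicator ?B (\<Psi> z) * (indicator ?B (\<Psi> y) * G (\<Psi> z) (\<Psi> y))) + (f z + f y) * k z y" for z y
    proof (cases "z \<in> ?H \<and> y \<in> ?H \<and> v (\<Psi> z) \<noteq> v (\<Psi> y)")
      case True
      then have H: "z \<in> ?H" "y \<in> ?H" and ne: "v (\<Psi> z) \<noteq> v (\<Psi> y)" by auto
      then have zy: "\<Psi> z \<noteq> \<Psi> y" "z \<noteq> y" by auto
      show ?thesis
      proof (cases "\<Psi> z \<in> ?B \<and> \<Psi> y \<in> ?B")
        case True
        then have O: "\<Psi> z \<in> \<Omega>" "\<Psi> y \<in> \<Omega>" using H mem' by auto
        have "norm (\<Psi> z - \<Psi> y) \<le> L * norm (z - y)" using True by (intro lipV) (auto simp: V_def)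
        then have "norm (\<Psi> z - \<Psi> y) powr s \<le> (L * norm (z - y)) powr s" using s by (intro powr_mono2) auto
        also have "\<dots> = L powr s * norm (z - y) powr s" using L0 by (simp add: powr_mult)
        finally have n: "norm (\<Psi> z - \<Psi> y) powr s \<le> L powr s * norm (z - y) powr s" .
        have pos: "norm (\<Psi> z - \<Psi> y) powr s > 0" "norm (z - y) powr s > 0" using zy by auto
        have "1 / norm (z - y) powr s \<le> L powr s / norm (\<Psi> z - \<Psi> y) powr s"
          using n pos by (simp add: field_simps)
        then have "(v (\<Psi> z) - v (\<Psi> y))\<^sup>2 * (1 / norm (z - y) powr s) \<le> (v (\<Psi> z) - v (\<Psi> y))\<^sup>2 * (L powr s / norm (\<Psi> z - \<Psi> y) powr s)"
          by (rule mult_left_mono) simp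
        then have "ennreal ((v (\<Psi> z) - v (\<Psi> y))\<^sup>2 / norm (z - y) powr s) \<le> ?c * ennreal ((v (\<Psi> z) - v (\<Psi> y))\<^sup>2 / norm (\<Psi> z - \<Psi> y) powr s)"
          by (simp add: ennreal_mult[symmetric] ennreal_leI mult.commute)
        also have "\<dots> = ?c * (indicator ?B (\<Psi> z) * (indicator ?B (\<Psi> y) * G (\<Psi> z) (\<Psi> y)))"
          using True O by (simp add: G_def)
        also have "\<dots> \<le> \<dots> + (f z + f y) * k z y" by simp
        finally show ?thesis using H by simp
      next
        case False
        have kk: "k z y = ennreal (1 / norm (z - y) powr s)" and
          ff: "ennreal ((v (\<Psi> z) - v (\<Psi> y))\<^sup>2) \<le> f z + f y"
        proof -
          have "d \<le> norm (z - y) \<and> (v (\<Psi> z) = 0 \<or> v (\<Psi> y) = 0)"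
          proof (cases "\<Psi> z \<in> ?B")
            case True
            then have y: "\<Psi> y \<notin> ?B" using False by simp
            then have vy: "v (\<Psi> y) = 0" using zero[OF v(2)] QB by blast
            then have "\<Psi> z \<in> ?Q" using ne zero[OF v(2), of "\<Psi> z"] by auto
            then show ?thesis using d(2)[OF _ y] vy by blast
          next
            case nz: False
            then have vz: "v (\<Psi> z) = 0" using zero[OF v(2)] QB by blast
            then have "\<Psi> y \<in> ?Q" using ne zero[OF v(2), of "\<Psi> y"] by auto
            then show ?thesis using d(2)[OF _ nz] vz by (metis norm_minus_commute)
          qed
          then show "k z y = ennreal (1 / norm (z - y) powr s)" "ennreal ((v (\<Psi> z) - v (\<Psi> y))\<^sup>2) \<le> f z + f y"
            using H by (auto simp: k_def f_def)
        qed
        have "ennreal ((v (\<Psi> z) - v (\<Psi> y))\<^sup>2 / norm (z - y) powr s) = ennreal ((v (\<Psi> z) - v (\<Psi> y))\<^sup>2) * k z y"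
          unfolding kk by (simp add: ennreal_mult[symmetric])
        also have "\<dots> \<le> (f z + f y) * k z y" using ff by (rule mult_right_mono) simp
        also have "\<dots> \<le> ?c * (indicator ?B (\<Psi> z) * (indicator ?B (\<Psi> y) * G (\<Psi> z) (\<Psi> y))) + \<dots>" by simp
        finally show ?thesis using H by simp
      qed
    next
      case False
      then have "indicator ?H z * indicator ?H y * ennreal ((v (\<Psi> z) - v (\<Psi> y))\<^sup>2 / norm (z - y) powr s) = 0"
        by (auto simp: indicator_def)
      then show ?thesis by (simp only: zero_le)
    qed
    have inner: "(\<integral>\<^sup>+ y. indicator ?B (\<Psi> y) * G x (\<Psi> y) \<partial>lborel) \<le> ennreal (L ^ ?n) * (\<integral>\<^sup>+ y. G x y \<partial>lborel)" for x
    proof -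
      have "(\<integral>\<^sup>+ y. indicator ?B (\<Psi> y) * G x (\<Psi> y) \<partial>lborel) \<le> ennreal (L ^ ?n) * (\<integral>\<^sup>+ y. indicator ?B y * G x y \<partial>lborel)"
        by (rule cv1) measurable
      also have "\<dots> \<le> ennreal (L ^ ?n) * (\<integral>\<^sup>+ y. G x y \<partial>lborel)"
        by (intro mult_left_mono nn_integral_mono) (auto simp: indicator_def)
      finally show ?thesis .
    qed
    have "(\<integral>\<^sup>+ z. \<integral>\<^sup>+ y. indicator ?B (\<Psi> z) * (indicator ?B (\<Psi> y) * G (\<Psi> z) (\<Psi> y)) \<partial>lborel \<partial>lborel)
       = (\<integral>\<^sup>+ z. indicator ?B (\<Psi> z) * (\<integral>\<^sup>+ y. indicator ?B (\<Psi> y) * G (\<Psi> z) (\<Psi> y) \<partial>lborel) \<partial>lborel)"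
      by (intro nn_integral_cong nn_integral_cmult) measurable
    also have "\<dots> \<le> ennreal (L ^ ?n) * (\<integral>\<^sup>+ x. indicator ?B x * (\<integral>\<^sup>+ y. indicator ?B (\<Psi> y) * G x (\<Psi> y) \<partial>lborel) \<partial>lborel)"
      by (rule cv1) measurable
    also have "\<dots> \<le> ennreal (L ^ ?n) * (\<integral>\<^sup>+ x. ennreal (L ^ ?n) * (\<integral>\<^sup>+ y. G x y \<partial>lborel) \<partial>lborel)"
    proof (intro mult_left_mono nn_integral_mono)
      fix x
      show "indicator ?B x * (\<integral>\<^sup>+ y. indicator ?B (\<Psi> y) * G x (\<Psi> y) \<partial>lborel) \<le> ennreal (L ^ ?n) * (\<integral>\<^sup>+ y. G x y \<partial>lborel)"
        using inner[of x] by (auto simp: indicator_def)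
    qed simp
    also have "\<dots> = ennreal (L ^ ?n) * (ennreal (L ^ ?n) * (\<integral>\<^sup>+ x. \<integral>\<^sup>+ y. G x y \<partial>lborel \<partial>lborel))"
      by (subst nn_integral_cmult) measurable
    also have "(\<integral>\<^sup>+ x. \<integral>\<^sup>+ y. G x y \<partial>lborel \<partial>lborel) = gagliardo \<sigma> \<Omega> v"
      unfolding gagliardo_def G_def s_def ..
    finally have near: "(\<integral>\<^sup>+ z. \<integral>\<^sup>+ y. indicator ?B (\<Psi> z) * (indicator ?B (\<Psi> y) * G (\<Psi> z) (\<Psi> y)) \<partial>lborel \<partial>lborel)
       \<le> ennreal (L ^ ?n) * (ennreal (L ^ ?n) * gagliardo \<sigma> \<Omega> v)" .
    have far: "(\<integral>\<^sup>+ z. \<integral>\<^sup>+ y. (f z + f y) * k z y \<partial>lborel \<partial>lborel) \<le> 2 * ennreal C * (\<integral>\<^sup>+ z. f z \<partial>lborel)"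
    proof (rule nn_integral_symmetric_kernel_le)
      show "k x y = k y x" for x y by (simp add: k_def indicator_def norm_minus_commute)
      show "(\<integral>\<^sup>+ y. k x y \<partial>lborel) \<le> ennreal C" for x unfolding k_def by (rule C(2))
    qed measurable
    have "gagliardo \<sigma> ?H (\<lambda>z. v (\<Psi> z)) \<le> (\<integral>\<^sup>+ z. \<integral>\<^sup>+ y. ?c * (indicator ?B (\<Psi> z) * (indicator ?B (\<Psi> y) * G (\<Psi> z) (\<Psi> y)))
        + (f z + f y) * k z y \<partial>lborel \<partial>lborel)"
      unfolding gagliardo_def s_def[symmetric] by (intro nn_integral_mono pw)
    also have "\<dots> = ?c * (\<integral>\<^sup>+ z. \<integral>\<^sup>+ y. indicator ?B (\<Psi> z) * (indicator ?B (\<Psi> y) * G (\<Psi> z) (\<Psi> y)) \<partial>lborel \<partial>lborel)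
        + (\<integral>\<^sup>+ z. \<integral>\<^sup>+ y. (f z + f y) * k z y \<partial>lborel \<partial>lborel)"
      by (rule nn_integral_double_cmult_add) measurable
    also have "\<dots> \<le> ?c * (ennreal (L ^ ?n) * (ennreal (L ^ ?n) * gagliardo \<sigma> \<Omega> v)) + 2 * ennreal C * (\<integral>\<^sup>+ z. f z \<partial>lborel)"
      by (intro add_mono mult_left_mono near far) simp
    also have "?c * (ennreal (L ^ ?n) * (ennreal (L ^ ?n) * gagliardo \<sigma> \<Omega> v)) = ennreal (L powr s * L ^ ?n * L ^ ?n) * gagliardo \<sigma> \<Omega> v"
      using L0 by (simp add: ennreal_mult mult.assoc)
    also have "L powr s * L ^ ?n * L ^ ?n = L powr (3 * real DIM('a) + 2 * \<sigma>)"
      using L0 by (simp add: s_def powr_realpow[symmetric] powr_add[symmetric])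
    also have "(\<integral>\<^sup>+ z. f z \<partial>lborel) = lp_pow 2 ?H (\<lambda>z. v (\<Psi> z))" unfolding f_def lp_pow_def ..
    also have "2 * ennreal C * \<dots> \<le> 2 * ennreal C * (ennreal (L ^ ?n) * lp_pow 2 \<Omega> v)"
      by (intro mult_left_mono lp1 v) auto
    also have "\<dots> = ennreal (2 * C * L ^ ?n) * lp_pow 2 \<Omega> v"
      using C(1) L0 by (simp add: ennreal_mult mult.assoc)
    finally show ?thesis by (simp add: add_left_mono)
  qed
  show thesis
    by (rule that[of "2 * C * L ^ ?n"]) (use C(1) L0 gag lp1 lp2 C1c in auto)
qed

text \<open>As the squares of the cutoffs sum to 1, the localized squared differences sum to
  \<open>(u x - u y)\<^sup>2 + u x * u y * D\<close> with \<open>D\<close> the sum of the squared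
  differences of the cutoffs. The Lipschitz bound on \<open>D\<close> removes two powers of the
  singularity, and \<open>\<sigma> < 1\<close> makes the rest integrable. The leading constant is
  exactly 1.\<close>

lemma localization_gagliardo:
  fixes \<Omega> :: "'a::euclidean_space set" and \<zeta> :: "'i \<Rightarrow> 'a \<Rightarrow> real"
  assumes \<Omega>: "open \<Omega>" "bounded \<Omega>" and \<sigma>: "\<sigma> < 1" "2 \<le> real DIM('a) + 2 * \<sigma>"
    and P: "finite P" and m: "\<And>p. p \<in> P \<Longrightarrow> \<zeta> p \<in> borel_measurable borel"
    and one: "\<And>x. x \<in> \<Omega> \<Longrightarrow> (\<Sum>p\<in>P. (\<zeta> p x)\<^sup>2) = 1"
    and lip: "\<And>p x y. p \<in> P \<Longrightarrow> \<bar>\<zeta> p x - \<zeta> p y\<bar> \<le> L * norm (x - y)"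
  obtains C where "C \<ge> 0" "\<And>u. u \<in> borel_measurable borel \<Longrightarrow>
      (\<Sum>p\<in>P. gagliardo \<sigma> \<Omega> (\<lambda>x. \<zeta> p x * u x)) \<le> gagliardo \<sigma> \<Omega> u + ennreal C * lp_pow 2 \<Omega> u"
proof -
  define s where "s = real DIM('a) + 2 * \<sigma>"
  define A where "A = real (card P) * L\<^sup>2"
  have A0: "A \<ge> 0" by (simp add: A_def)
  have [measurable]: "\<Omega> \<in> sets borel" using \<Omega> by simp
  obtain C where C: "C \<ge> 0" "\<And>x. x \<in> \<Omega> \<Longrightarrow> (\<integral>\<^sup>+ y. indicator \<Omega> y * ennreal (1 / norm (x - y) powr (s - 2)) \<partial>lborel) \<le> ennreal C"
    by (rule kernel_bound_bounded[of \<Omega> "s - 2"]) (use \<Omega> \<sigma> in \<open>auto simp: s_def\<close>)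
  show thesis
  proof (rule that[of "2 * (A * C)"])
    show "0 \<le> 2 * (A * C)" using A0 C(1) by simp
    fix u :: "'a \<Rightarrow> real" assume [measurable]: "u \<in> borel_measurable borel"
    define f where "f = (\<lambda>x. indicator \<Omega> x * ennreal (\<bar>u x\<bar> powr 2))"
    define k where "k = (\<lambda>x y :: 'a. ennreal A * (indicator \<Omega> x * indicator \<Omega> y * ennreal (1 / norm (x - y) powr (s - 2))))"
    define N where "N = (\<lambda>v x y :: 'a. indicator \<Omega> x * indicator \<Omega> y * ennreal ((v x - v y :: real)\<^sup>2 / norm (x - y) powr s))"
    have g: "gagliardo \<sigma> \<Omega> v = (\<integral>\<^sup>+ x. \<integral>\<^sup>+ y. N v x y \<partial>lborel \<partial>lborel)" for v
      unfolding gagliardo_def N_def s_def ..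
    have Nm: "case_prod (N v) \<in> borel_measurable (borel \<Otimes>\<^sub>M borel)" if [measurable]: "v \<in> borel_measurable borel" for v
      unfolding N_def by measurable
    have [measurable]: "f \<in> borel_measurable borel" "case_prod k \<in> borel_measurable (borel \<Otimes>\<^sub>M borel)"
      unfolding f_def k_def by measurable
    have \<zeta>m: "(\<lambda>x. \<zeta> p x * u x) \<in> borel_measurable borel" if "p \<in> P" for p
      using m[OF that] by measurable
    have pw: "(\<Sum>p\<in>P. N (\<lambda>x. \<zeta> p x * u x) x y) \<le> 1 * N u x y + (f x + f y) * k x y" for x y
    proof (cases "x \<in> \<Omega> \<and> y \<in> \<Omega>")
      case True
      then have x: "x \<in> \<Omega>" and y: "y \<in> \<Omega>" by auto
      define T where "T = (\<Sum>p\<in>P. \<zeta> p x * \<zeta> p y)"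
      define D where "D = (\<Sum>p\<in>P. (\<zeta> p x - \<zeta> p y)\<^sup>2)"
      have DT: "D = 2 - 2 * T"
      proof -
        have "D = (\<Sum>p\<in>P. (\<zeta> p x)\<^sup>2 + (\<zeta> p y)\<^sup>2 - 2 * (\<zeta> p x * \<zeta> p y))"
          unfolding D_def by (intro sum.cong) (auto simp: power2_eq_square algebra_simps)
        also have "\<dots> = 2 - 2 * T"
          unfolding T_def by (simp add: sum_subtractf sum.distrib sum_distrib_left[symmetric] one[OF x] one[OF y])
        finally show ?thesis .
      qed
      have D0: "D \<ge> 0" unfolding D_def by (intro sum_nonneg) auto
      have D: "D \<le> A * (norm (x - y))\<^sup>2"
      proof -
        have "D \<le> (\<Sum>p\<in>P. L\<^sup>2 * (norm (x - y))\<^sup>2)"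
          unfolding D_def
        proof (rule sum_mono)
          fix p assume "p \<in> P"
          then show "(\<zeta> p x - \<zeta> p y)\<^sup>2 \<le> L\<^sup>2 * (norm (x - y))\<^sup>2"
            using power_mono[OF lip[of p x y], of 2] by (simp add: power_mult_distrib)
        qed
        then show ?thesis by (simp add: A_def)
      qed
      have eq: "(\<Sum>p\<in>P. (\<zeta> p x * u x - \<zeta> p y * u y)\<^sup>2) = (u x - u y)\<^sup>2 + u x * u y * D"
      proof -
        have "(\<Sum>p\<in>P. (\<zeta> p x * u x - \<zeta> p y * u y)\<^sup>2)
           = (\<Sum>p\<in>P. (\<zeta> p x)\<^sup>2 * (u x)\<^sup>2 + (\<zeta> p y)\<^sup>2 * (u y)\<^sup>2 - (\<zeta> p x * \<zeta> p y) * (2 * u x * u y))"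
          by (intro sum.cong) (auto simp: power2_eq_square algebra_simps)
        also have "\<dots> = (u x)\<^sup>2 + (u y)\<^sup>2 - T * (2 * u x * u y)"
          unfolding T_def by (simp add: sum_subtractf sum.distrib sum_distrib_right[symmetric] one[OF x] one[OF y])
        also have "\<dots> = (u x - u y)\<^sup>2 + u x * u y * D"
          unfolding DT by (simp add: power2_eq_square algebra_simps)
        finally show ?thesis .
      qed
      have uv: "u x * u y \<le> (u x)\<^sup>2 + (u y)\<^sup>2"
        using sum_squares_bound[of "u x" "u y"] zero_le_power2[of "u x"] zero_le_power2[of "u y"] by linarith
      have "(\<Sum>p\<in>P. (\<zeta> p x * u x - \<zeta> p y * u y)\<^sup>2) \<le> (u x - u y)\<^sup>2 + ((u x)\<^sup>2 + (u y)\<^sup>2) * (A * (norm (x - y))\<^sup>2)"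
        unfolding eq using mult_mono[OF uv D] D0 by simp
      then have "(\<Sum>p\<in>P. (\<zeta> p x * u x - \<zeta> p y * u y)\<^sup>2) / norm (x - y) powr s
          \<le> ((u x - u y)\<^sup>2 + ((u x)\<^sup>2 + (u y)\<^sup>2) * (A * (norm (x - y))\<^sup>2)) / norm (x - y) powr s"
        by (rule divide_right_mono) simp
      also have "\<dots> = (u x - u y)\<^sup>2 / norm (x - y) powr s + ((u x)\<^sup>2 + (u y)\<^sup>2) * A * ((norm (x - y))\<^sup>2 / norm (x - y) powr s)"
        by (simp add: add_divide_distrib mult.assoc)
      also have "(norm (x - y))\<^sup>2 / norm (x - y) powr s = 1 / norm (x - y) powr (s - 2)"
        by (rule power2_divide_powr) simp
      finally have le: "(\<Sum>p\<in>P. (\<zeta> p x * u x - \<zeta> p y * u y)\<^sup>2 / norm (x - y) powr s)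
          \<le> (u x - u y)\<^sup>2 / norm (x - y) powr s + ((u x)\<^sup>2 + (u y)\<^sup>2) * A * (1 / norm (x - y) powr (s - 2))"
        by (simp add: sum_divide_distrib)
      have "(\<Sum>p\<in>P. N (\<lambda>x. \<zeta> p x * u x) x y) = ennreal (\<Sum>p\<in>P. (\<zeta> p x * u x - \<zeta> p y * u y)\<^sup>2 / norm (x - y) powr s)"
        unfolding N_def using x y by (simp add: sum_ennreal)
      also have "\<dots> \<le> ennreal ((u x - u y)\<^sup>2 / norm (x - y) powr s + ((u x)\<^sup>2 + (u y)\<^sup>2) * A * (1 / norm (x - y) powr (s - 2)))"
        using le by (rule ennreal_leI)
      also have "\<dots> = ennreal ((u x - u y)\<^sup>2 / norm (x - y) powr s) + ennreal ((u x)\<^sup>2 + (u y)\<^sup>2) * (ennreal A * ennreal (1 / norm (x - y) powr (s - 2)))"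
        using A0 by (simp add: ennreal_plus[symmetric] ennreal_mult[symmetric] mult.assoc del: ennreal_plus)
      also have "\<dots> = 1 * N u x y + (f x + f y) * k x y"
        unfolding N_def f_def k_def using x y by simp
      finally show ?thesis .
    next
      case False
      then have "(\<Sum>p\<in>P. N (\<lambda>x. \<zeta> p x * u x) x y) = 0" unfolding N_def by (auto simp: indicator_def)
      then show ?thesis by (simp only: zero_le)
    qed
    have "(\<Sum>p\<in>P. gagliardo \<sigma> \<Omega> (\<lambda>x. \<zeta> p x * u x)) = (\<integral>\<^sup>+ x. (\<Sum>p\<in>P. (\<integral>\<^sup>+ y. N (\<lambda>x. \<zeta> p x * u x) x y \<partial>lborel)) \<partial>lborel)"
      unfolding g
    proof (rule nn_integral_sum[symmetric])
      fix p assume "p \<in> P"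
      note [measurable] = Nm[OF \<zeta>m[OF this]]
      show "(\<lambda>x. \<integral>\<^sup>+ y. N (\<lambda>x. \<zeta> p x * u x) x y \<partial>lborel) \<in> borel_measurable lborel" by measurable
    qed
    also have "\<dots> = (\<integral>\<^sup>+ x. \<integral>\<^sup>+ y. (\<Sum>p\<in>P. N (\<lambda>x. \<zeta> p x * u x) x y) \<partial>lborel \<partial>lborel)"
    proof (intro nn_integral_cong nn_integral_sum[symmetric])
      fix x p assume "p \<in> P"
      note [measurable] = Nm[OF \<zeta>m[OF this]]
      show "N (\<lambda>x. \<zeta> p x * u x) x \<in> borel_measurable lborel" by measurable
    qed
    also have "\<dots> \<le> (\<integral>\<^sup>+ x. \<integral>\<^sup>+ y. 1 * N u x y + (f x + f y) * k x y \<partial>lborel \<partial>lborel)"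
      by (intro nn_integral_mono pw)
    also have "\<dots> = 1 * (\<integral>\<^sup>+ x. \<integral>\<^sup>+ y. N u x y \<partial>lborel \<partial>lborel) + (\<integral>\<^sup>+ x. \<integral>\<^sup>+ y. (f x + f y) * k x y \<partial>lborel \<partial>lborel)"
      by (rule nn_integral_double_cmult_add[OF Nm]) measurable
    also have "(\<integral>\<^sup>+ x. \<integral>\<^sup>+ y. (f x + f y) * k x y \<partial>lborel \<partial>lborel) \<le> 2 * ennreal (A * C) * (\<integral>\<^sup>+ x. f x \<partial>lborel)"
    proof (rule nn_integral_symmetric_kernel_le)
      show "k x y = k y x" for x y by (simp add: k_def norm_minus_commute mult_ac)
      fix x assume "f x \<noteq> 0"
      then have x: "x \<in> \<Omega>" by (auto simp: f_def indicator_def split: if_splits)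
      have "(\<integral>\<^sup>+ y. k x y \<partial>lborel) = ennreal A * (\<integral>\<^sup>+ y. indicator \<Omega> y * ennreal (1 / norm (x - y) powr (s - 2)) \<partial>lborel)"
        unfolding k_def using x by (subst nn_integral_cmult) auto
      also have "\<dots> \<le> ennreal A * ennreal C" by (intro mult_left_mono C x) simp
      also have "\<dots> = ennreal (A * C)" using A0 C(1) by (simp add: ennreal_mult)
      finally show "(\<integral>\<^sup>+ y. k x y \<partial>lborel) \<le> ennreal (A * C)" .
    qed measurable
    also have "(\<integral>\<^sup>+ x. f x \<partial>lborel) = lp_pow 2 \<Omega> u" unfolding f_def lp_pow_def ..
    also have "2 * ennreal (A * C) = ennreal (2 * (A * C))" using A0 C(1) by (simp add: ennreal_mult)
    finally show "(\<Sum>p\<in>P. gagliardo \<sigma> \<Omega> (\<lambda>x. \<zeta> p x * u x)) \<le> gagliardo \<sigma> \<Omega> u + ennreal (2 * (A * C)) * lp_pow 2 \<Omega> u"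
      by (simp add: g add_left_mono)
  qed
qed

text \<open>Multiplying out the quotient has to respect conventions: where the denominator is 0 the
  quotient says nothing, but the left side is then 0 as well.\<close>

lemma Sobolev_C1c:
  fixes A :: "'a::euclidean_space set"
  assumes u: "u \<in> C1c A" and S: "ereal S \<le> S_const \<sigma> A"
  shows "S * enn2real (lp_pow (crit_exp DIM('a) \<sigma>) A u) powr ((real DIM('a) - 2 * \<sigma>) / real DIM('a)) \<le> enn2real (gagliardo \<sigma> A u)"
proof (cases "\<exists>x. u x \<noteq> 0")
  case True
  let ?d = "enn2real (lp_pow (crit_exp DIM('a) \<sigma>) A u) powr ((real DIM('a) - 2 * \<sigma>) / real DIM('a))"
  have "S_const \<sigma> A \<le> ereal (sob_quot \<sigma> A u)"
    unfolding S_const_def by (rule INF_lower) (use True u in auto)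
  then have "S \<le> sob_quot \<sigma> A u" using S order_trans by fastforce
  then have *: "S \<le> enn2real (gagliardo \<sigma> A u) / ?d" unfolding sob_quot_def .
  show ?thesis
  proof (cases "?d = 0")
    case False
    then have "0 < ?d" by (metis powr_ge_zero less_eq_real_def)
    then show ?thesis using * by (simp add: pos_le_divide_eq)
  qed simp
next
  case False
  then show ?thesis by (simp add: lp_pow_def)
qed

text \<open>The half-space inequality pulled back through a single chart. To the exponent 3n +
  2\<sigma> of the energy, the comparison of norms adds \<open>(L ^ DIM('a)) powr \<theta>\<close>,
  rounded up to \<open>L ^ DIM('a)\<close>, where \<theta> is the exponent on the norm integral. The
  loss disappears as \<open>L\<close> tends to 1.\<close>

lemma local_Sobolev:
  fixes \<Omega> :: "'a::euclidean_space set"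
  assumes n: "DIM('a) \<ge> 2" and \<sigma>: "0 < \<sigma>" "\<sigma> < 1" and \<Omega>: "open \<Omega>" "bounded \<Omega>" "C1_boundary \<Omega>"
    and S1: "S1 \<ge> 0" "ereal S1 \<le> S_const \<sigma> (half_space :: 'a set)" and L: "L > 1" and p: "p \<in> closure \<Omega>"
  shows "\<exists>r C. r > 0 \<and> C \<ge> 0 \<and> (\<forall>v. v \<in> C1c \<Omega> \<longrightarrow> closure {x. v x \<noteq> 0} \<subseteq> cball p r \<longrightarrow>
     S1 * enn2real (lp_pow (crit_exp DIM('a) \<sigma>) \<Omega> v) powr ((real DIM('a) - 2 * \<sigma>) / real DIM('a))
      \<le> L powr (4 * real DIM('a) + 2 * \<sigma>) * enn2real (gagliardo \<sigma> \<Omega> v) + C * enn2real (lp_pow 2 \<Omega> v))"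
proof -
  let ?n = "DIM('a)" and ?H = "half_space :: 'a set" and ?q = "crit_exp DIM('a) \<sigma>"
  let ?\<theta> = "(real DIM('a) - 2 * \<sigma>) / real DIM('a)"
  have \<theta>: "0 < ?\<theta>" "?\<theta> \<le> 1" using n \<sigma> by auto
  have q: "?q > 0" using n \<sigma> by (simp add: crit_exp_def)
  obtain r \<Phi> \<Psi> where ch: "near_isometric_chart L \<Omega> p r \<Phi> \<Psi>"
    using near_isometric_chart_exists[OF \<Omega>(1,3) p L] by blast
  have r: "r > 0" using ch unfolding near_isometric_chart_def by blast
  have L1: "L \<ge> 1" using L by simp
  obtain C where C: "C \<ge> 0"
    "\<And>v. v \<in> C1c \<Omega> \<Longrightarrow> closure {x. v x \<noteq> 0} \<subseteq> cball p (r / 2) \<Longrightarrow>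
       gagliardo \<sigma> ?H (\<lambda>z. v (\<Psi> z))
         \<le> ennreal (L powr (3 * real DIM('a) + 2 * \<sigma>)) * gagliardo \<sigma> \<Omega> v + ennreal C * lp_pow 2 \<Omega> v"
    "\<And>v q. v \<in> C1c \<Omega> \<Longrightarrow> closure {x. v x \<noteq> 0} \<subseteq> cball p (r / 2) \<Longrightarrow> q > 0 \<Longrightarrow>
       lp_pow q ?H (\<lambda>z. v (\<Psi> z)) \<le> ennreal (L ^ DIM('a)) * lp_pow q \<Omega> v"
    "\<And>v q. v \<in> C1c \<Omega> \<Longrightarrow> closure {x. v x \<noteq> 0} \<subseteq> cball p (r / 2) \<Longrightarrow> q > 0 \<Longrightarrow>
       lp_pow q \<Omega> v \<le> ennreal (L ^ DIM('a)) * lp_pow q ?H (\<lambda>z. v (\<Psi> z))"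
    "\<And>v. v \<in> C1c \<Omega> \<Longrightarrow> closure {x. v x \<noteq> 0} \<subseteq> cball p (r / 2) \<Longrightarrow> (\<lambda>z. v (\<Psi> z)) \<in> C1c ?H"
    by (rule chart_transfer[OF \<Omega>(1) ch L1 \<sigma>(1)]) blast
  have "S1 * enn2real (lp_pow ?q \<Omega> v) powr ?\<theta>
      \<le> L powr (4 * real DIM('a) + 2 * \<sigma>) * enn2real (gagliardo \<sigma> \<Omega> v) + (L ^ ?n * C) * enn2real (lp_pow 2 \<Omega> v)"
    if v: "v \<in> C1c \<Omega>" "closure {x. v x \<noteq> 0} \<subseteq> cball p (r / 2)" for v
  proof -
    let ?w = "\<lambda>z. v (\<Psi> z)"
    have fin: "lp_pow ?q \<Omega> v < \<infinity>" "lp_pow 2 \<Omega> v < \<infinity>" "gagliardo \<sigma> \<Omega> v < \<infinity>"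
      using lp_pow_C1c_finite[OF \<Omega>(1,2) v(1)] gagliardo_C1c_finite[OF \<Omega>(1,2) \<sigma>(2) _ v(1)] q n \<sigma> by auto
    have "ennreal (L ^ ?n) * lp_pow ?q \<Omega> v < \<infinity>" using fin by (simp add: ennreal_mult_less_top)
    then have finH: "lp_pow ?q ?H ?w < \<infinity>" using C(3)[OF v q] by (rule le_less_trans[rotated])
    have "enn2real (lp_pow ?q \<Omega> v) \<le> enn2real (ennreal (L ^ ?n) * lp_pow ?q ?H ?w)"
      using C(4)[OF v q] finH by (intro enn2real_mono) (auto simp: ennreal_mult_less_top)
    also have "\<dots> = L ^ ?n * enn2real (lp_pow ?q ?H ?w)" using L by (simp add: enn2real_mult)
    finally have "enn2real (lp_pow ?q \<Omega> v) powr ?\<theta> \<le> (L ^ ?n * enn2real (lp_pow ?q ?H ?w)) powr ?\<theta>"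
      using \<theta> by (intro powr_mono2) auto
    also have "\<dots> = (L ^ ?n) powr ?\<theta> * enn2real (lp_pow ?q ?H ?w) powr ?\<theta>" using L by (simp add: powr_mult)
    also have "\<dots> \<le> L ^ ?n * enn2real (lp_pow ?q ?H ?w) powr ?\<theta>"
    proof (rule mult_right_mono)
      have "(L ^ ?n) powr ?\<theta> \<le> (L ^ ?n) powr 1" using \<theta> L by (intro powr_mono) auto
      then show "(L ^ ?n) powr ?\<theta> \<le> L ^ ?n" using L by simp
    qed simp
    finally have "S1 * enn2real (lp_pow ?q \<Omega> v) powr ?\<theta> \<le> S1 * (L ^ ?n * enn2real (lp_pow ?q ?H ?w) powr ?\<theta>)"
      using S1(1) by (rule mult_left_mono)
    also have "\<dots> = L ^ ?n * (S1 * enn2real (lp_pow ?q ?H ?w) powr ?\<theta>)" by simp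
    also have "\<dots> \<le> L ^ ?n * enn2real (gagliardo \<sigma> ?H ?w)"
      using L Sobolev_C1c[OF C(5)[OF v] S1(2)] by (intro mult_left_mono) auto
    also have "enn2real (gagliardo \<sigma> ?H ?w) \<le> L powr (3 * real DIM('a) + 2 * \<sigma>) * enn2real (gagliardo \<sigma> \<Omega> v) + C * enn2real (lp_pow 2 \<Omega> v)"
      using C(1) L by (intro ennreal_bound_enn2real[OF C(2)[OF v]] fin) auto
    also have "L ^ ?n * \<dots> = (L ^ ?n * L powr (3 * real DIM('a) + 2 * \<sigma>)) * enn2real (gagliardo \<sigma> \<Omega> v) + (L ^ ?n * C) * enn2real (lp_pow 2 \<Omega> v)"
      by (simp add: algebra_simps)
    also have "L ^ ?n * L powr (3 * real DIM('a) + 2 * \<sigma>) = L powr (4 * real DIM('a) + 2 * \<sigma>)"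
      using L by (simp add: powr_realpow[symmetric] powr_add[symmetric])
    finally show ?thesis using L by simp
  qed
  then show ?thesis using r C(1) L by (intro exI[of _ "r / 2"] exI[of _ "L ^ ?n * C"]) auto
qed

text \<open>Local inequalities are summed over a partition of unity without losing in the constant.
  For the energy this is the localization identity; for the norm it is Minkowski's inequality with
  half the critical exponent, applied to the squares of the pieces. The only loss comes from the
  charts and is prescribed in advance.\<close>

lemma refined_Sobolev:
  fixes \<Omega> :: "'a::euclidean_space set"
  assumes n: "DIM('a) \<ge> 2" and \<sigma>: "0 < \<sigma>" "\<sigma> < 1" and \<Omega>: "open \<Omega>" "bounded \<Omega>" "C1_boundary \<Omega>" "\<Omega> \<noteq> {}"
    and S: "0 < S2" "S2 < S1" "ereal S1 \<le> S_const \<sigma> (half_space :: 'a set)"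
  obtains C where "C \<ge> 0" "\<And>u. u \<in> C1c \<Omega> \<Longrightarrow>
     S2 * enn2real (lp_pow (crit_exp DIM('a) \<sigma>) \<Omega> u) powr ((real DIM('a) - 2 * \<sigma>) / real DIM('a))
      \<le> enn2real (gagliardo \<sigma> \<Omega> u) + C * enn2real (lp_pow 2 \<Omega> u)"
proof -
  let ?n = "DIM('a)" and ?q = "crit_exp DIM('a) \<sigma>"
  let ?\<theta> = "(real DIM('a) - 2 * \<sigma>) / real DIM('a)"
  define m where "m = 4 * real DIM('a) + 2 * \<sigma>"
  have m: "m > 0" using \<sigma> n by (simp add: m_def)
  \<comment> \<open>The distortion allowed to the charts is chosen so that their total loss
    \<open>L powr m\<close> is exactly \<open>S1 / S2\<close>.\<close>
  define L where "L = (S1 / S2) powr (1 / m)"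
  have "(S1 / S2) powr 0 < (S1 / S2) powr (1 / m)" using S m by (intro powr_less_mono) auto
  then have L: "L > 1" using S by (simp add: L_def)
  have Lm: "L powr m = S1 / S2" using S m by (simp add: L_def powr_powr)
  have \<theta>: "0 < ?\<theta>" using n \<sigma> by auto
  have q: "?q > 0" using n \<sigma> by (simp add: crit_exp_def)
  have sn: "2 \<le> real DIM('a) + 2 * \<sigma>" using n \<sigma> by simp
  have S1: "S1 \<ge> 0" using S by simp
  have [measurable]: "\<Omega> \<in> sets borel" using \<Omega> by simp
  have "\<forall>p\<in>closure \<Omega>. \<exists>r C. r > 0 \<and> C \<ge> 0 \<and> (\<forall>v. v \<in> C1c \<Omega> \<longrightarrow> closure {x. v x \<noteq> 0} \<subseteq> cball p r \<longrightarrow>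
     S1 * enn2real (lp_pow ?q \<Omega> v) powr ?\<theta> \<le> L powr m * enn2real (gagliardo \<sigma> \<Omega> v) + C * enn2real (lp_pow 2 \<Omega> v))"
    using local_Sobolev[OF n \<sigma> \<Omega>(1-3) S1 S(3) L] unfolding m_def by blast
  then obtain r c where rc: "\<And>p. p \<in> closure \<Omega> \<Longrightarrow> r p > 0" "\<And>p. p \<in> closure \<Omega> \<Longrightarrow> c p \<ge> 0"
    "\<And>p v. p \<in> closure \<Omega> \<Longrightarrow> v \<in> C1c \<Omega> \<Longrightarrow> closure {x. v x \<noteq> 0} \<subseteq> cball p (r p) \<Longrightarrow>
     S1 * enn2real (lp_pow ?q \<Omega> v) powr ?\<theta> \<le> L powr m * enn2real (gagliardo \<sigma> \<Omega> v) + c p * enn2real (lp_pow 2 \<Omega> v)"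
    by metis
  have cpt: "compact (closure \<Omega>)" using \<Omega>(2) by (simp add: compact_closure)
  obtain P \<zeta> K where P: "finite P" "P \<subseteq> closure \<Omega>" "\<And>p. p \<in> P \<Longrightarrow> C1_map (\<zeta> p)"
    "\<And>p x. p \<in> P \<Longrightarrow> \<zeta> p x \<noteq> 0 \<Longrightarrow> x \<in> ball p (r p)"
    "\<And>x. x \<in> closure \<Omega> \<Longrightarrow> (\<Sum>p\<in>P. (\<zeta> p x)\<^sup>2) = 1"
    "\<And>p x y. p \<in> P \<Longrightarrow> \<bar>\<zeta> p x - \<zeta> p y\<bar> \<le> K * norm (x - y :: 'a)"
    by (rule quadratic_partition_of_unity[OF cpt rc(1)]) blast+
  have one: "(\<Sum>p\<in>P. (\<zeta> p x)\<^sup>2) = 1" if "x \<in> \<Omega>" for x using P(5) closure_subset that by blast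
  have Pne: "P \<noteq> {}" using one \<Omega>(4) by fastforce
  have \<zeta>m: "\<zeta> p \<in> borel_measurable borel" if "p \<in> P" for p
    using P(3)[OF that] by (intro borel_measurable_continuous_onI C1_map_continuous_on)
  obtain C1 where C1: "C1 \<ge> 0" "\<And>u. u \<in> borel_measurable borel \<Longrightarrow>
      (\<Sum>p\<in>P. gagliardo \<sigma> \<Omega> (\<lambda>x. \<zeta> p x * u x)) \<le> gagliardo \<sigma> \<Omega> u + ennreal C1 * lp_pow 2 \<Omega> u"
    by (rule localization_gagliardo[OF \<Omega>(1,2) \<sigma>(2) sn P(1) \<zeta>m one P(6)]) auto
  define C2 where "C2 = (\<Sum>p\<in>P. c p)"
  have C2: "C2 \<ge> 0" unfolding C2_def using P(2) rc(2) by (intro sum_nonneg) auto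
  show thesis
  proof (rule that[of "C1 + C2 * (S2 / S1)"])
    show "0 \<le> C1 + C2 * (S2 / S1)" using C1(1) C2 S by simp
    fix u assume u: "u \<in> C1c \<Omega>"
    have um[measurable]: "u \<in> borel_measurable borel" using u by (rule C1c_borel_measurable)
    define v where "v = (\<lambda>p x. \<zeta> p x * u x)"
    have v: "v p \<in> C1c \<Omega>" "closure {x. v p x \<noteq> 0} \<subseteq> cball p (r p)" if "p \<in> P" for p
    proof -
      show "v p \<in> C1c \<Omega>" unfolding v_def using P(3)[OF that] u by (rule C1c_mult)
      have "{x. v p x \<noteq> 0} \<subseteq> cball p (r p)" using P(4)[OF that] by (force simp: v_def)
      then show "closure {x. v p x \<noteq> 0} \<subseteq> cball p (r p)" by (rule closure_minimal) simp
    qed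
    have fin: "lp_pow ?q \<Omega> w < \<infinity>" "lp_pow 2 \<Omega> w < \<infinity>" "gagliardo \<sigma> \<Omega> w < \<infinity>" if "w \<in> C1c \<Omega>" for w
      using lp_pow_C1c_finite[OF \<Omega>(1,2) that] gagliardo_C1c_finite[OF \<Omega>(1,2) \<sigma>(2) sn that] q by auto
    let ?E = "\<lambda>w. enn2real (gagliardo \<sigma> \<Omega> w)" and ?N = "\<lambda>w. enn2real (lp_pow ?q \<Omega> w)" and ?T = "\<lambda>w. enn2real (lp_pow 2 \<Omega> w)"
    have sumE: "(\<Sum>p\<in>P. ?E (v p)) \<le> ?E u + C1 * ?T u"
    proof -
      have "(\<Sum>p\<in>P. ?E (v p)) = enn2real (\<Sum>p\<in>P. gagliardo \<sigma> \<Omega> (v p))"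
        using fin(3)[OF v(1)] by (subst enn2real_sum) auto
      also have "\<dots> \<le> 1 * ?E u + C1 * ?T u"
        using C1(2)[OF um] by (intro ennreal_bound_enn2real) (auto simp: v_def C1(1) fin[OF u, unfolded infinity_ennreal_def])
      finally show ?thesis by simp
    qed
    have T: "?T (v p) \<le> ?T u" if p: "p \<in> P" for p
    proof (rule enn2real_mono)
      show "lp_pow 2 \<Omega> (v p) \<le> lp_pow 2 \<Omega> u"
        unfolding lp_pow_def
      proof (rule nn_integral_mono)
        fix x
        show "indicator \<Omega> x * ennreal (\<bar>v p x\<bar> powr 2) \<le> indicator \<Omega> x * ennreal (\<bar>u x\<bar> powr 2)"
        proof (cases "x \<in> \<Omega>")
          case True
          have "(\<zeta> p x)\<^sup>2 \<le> (\<Sum>p\<in>P. (\<zeta> p x)\<^sup>2)" by (rule member_le_sum) (use p P(1) in auto)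
          then have "(\<zeta> p x)\<^sup>2 * (u x)\<^sup>2 \<le> 1 * (u x)\<^sup>2" using one[OF True] by (intro mult_right_mono) auto
          then show ?thesis using True by (simp add: v_def power_mult_distrib ennreal_leI)
        qed simp
      qed
    qed (use fin[OF u] in auto)
    \<comment> \<open>The squares of the pieces sum to the square of \<open>u\<close>, everywhere
      since \<open>u\<close> vanishes off \<Omega>, and \<open>?q / 2 \<ge> 1\<close>. The slack
      \<open>e\<close> is divided among the pieces to make all bounds \<open>A p\<close>
      positive.\<close>
    have Mink: "?N u powr ?\<theta> \<le> (\<Sum>p\<in>P. ?N (v p) powr ?\<theta>)"
    proof (rule field_le_epsilon)
      fix e :: real assume e: "e > 0"
      define d where "d = e / card P"
      have cP: "card P > 0" using P(1) Pne by (simp add: card_gt_0_iff)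
      have d: "d > 0" using e cP by (simp add: d_def)
      define A where "A = (\<lambda>p. ?N (v p) powr ?\<theta> + d)"
      have A: "A p > 0" for p using d by (simp add: A_def add_nonneg_pos)
      have "?q / 2 \<ge> 1" using n \<sigma> by (simp add: crit_exp_def field_simps)
      have q\<theta>: "?\<theta> * (?q / 2) = 1" using n \<sigma> by (simp add: crit_exp_def field_simps)
      have sq: "\<bar>t\<^sup>2\<bar> powr (?q / 2) = \<bar>t\<bar> powr ?q" for t :: real
      proof -
        have "\<bar>t\<^sup>2\<bar> powr (?q / 2) = (\<bar>t\<bar> powr 2) powr (?q / 2)" by simp
        also have "\<dots> = \<bar>t\<bar> powr ?q" by (subst powr_powr) simp
        finally show ?thesis .
      qed
      have pv: "pint (dom_measure \<Omega>) (?q / 2) (\<lambda>x. (w x)\<^sup>2) = lp_pow ?q \<Omega> w" if "w \<in> C1c \<Omega>" for w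
        using lp_pow_eq_pint[OF _ C1c_borel_measurable[OF that], of \<Omega> ?q] unfolding pint_def sq by simp
      have "pint (dom_measure \<Omega>) (?q / 2) (\<lambda>x. \<Sum>p\<in>P. (v p x)\<^sup>2) \<le> ennreal ((\<Sum>p\<in>P. A p) powr (?q / 2))"
      proof (rule Minkowski_sum[OF \<open>?q / 2 \<ge> 1\<close> P(1) Pne])
        fix p assume p: "p \<in> P"
        note [measurable] = C1c_borel_measurable[OF v(1)[OF p]]
        show "(\<lambda>x. (v p x)\<^sup>2) \<in> borel_measurable (dom_measure \<Omega>)" by measurable
        have "?N (v p) = (?N (v p) powr ?\<theta>) powr (?q / 2)" by (simp only: powr_powr q\<theta>) simp
        also have "\<dots> \<le> A p powr (?q / 2)" using q d by (intro powr_mono2) (auto simp: A_def)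
        finally have "ennreal (?N (v p)) \<le> ennreal (A p powr (?q / 2))" by (rule ennreal_leI)
        then show "pint (dom_measure \<Omega>) (?q / 2) (\<lambda>x. (v p x)\<^sup>2) \<le> ennreal (A p powr (?q / 2))"
          unfolding pv[OF v(1)[OF p]] using ennreal_enn2real[of "lp_pow ?q \<Omega> (v p)"] fin(1)[OF v(1)[OF p]]
          by (metis infinity_ennreal_def)
      qed (rule A)
      also have "pint (dom_measure \<Omega>) (?q / 2) (\<lambda>x. \<Sum>p\<in>P. (v p x)\<^sup>2) = lp_pow ?q \<Omega> u"
      proof -
        have u0: "(\<Sum>p\<in>P. (v p x)\<^sup>2) = (u x)\<^sup>2" for x
        proof (cases "x \<in> \<Omega>")
          case True
          then show ?thesis using one by (simp add: v_def power_mult_distrib sum_distrib_right[symmetric])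
        next
          case False
          then show ?thesis using C1c_zero_outside[OF u] by (simp add: v_def)
        qed
        show ?thesis unfolding u0 by (rule pv[OF u])
      qed
      finally have "?N u \<le> (\<Sum>p\<in>P. A p) powr (?q / 2)" by (intro enn2real_leI) auto
      then have "?N u powr ?\<theta> \<le> ((\<Sum>p\<in>P. A p) powr (?q / 2)) powr ?\<theta>"
        using \<theta> by (intro powr_mono2) auto
      also have "\<dots> = (\<Sum>p\<in>P. A p)"
      proof -
        have "(\<Sum>p\<in>P. A p) > 0" using A P(1) Pne by (intro sum_pos) auto
        then show ?thesis using q\<theta> by (simp only: powr_powr mult.commute[of "?q / 2"]) simp
      qed
      also have "\<dots> = (\<Sum>p\<in>P. ?N (v p) powr ?\<theta>) + e"
        using cP by (simp add: A_def sum.distrib d_def)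
      finally show "?N u powr ?\<theta> \<le> (\<Sum>p\<in>P. ?N (v p) powr ?\<theta>) + e" .
    qed
    have "S1 * ?N u powr ?\<theta> \<le> (\<Sum>p\<in>P. S1 * ?N (v p) powr ?\<theta>)"
      using mult_left_mono[OF Mink S1] by (simp add: sum_distrib_left)
    also have "\<dots> \<le> (\<Sum>p\<in>P. L powr m * ?E (v p) + c p * ?T u)"
    proof (rule sum_mono)
      fix p assume p: "p \<in> P"
      then have "p \<in> closure \<Omega>" using P(2) by blast
      then have "S1 * ?N (v p) powr ?\<theta> \<le> L powr m * ?E (v p) + c p * ?T (v p)" using v[OF p] by (rule rc(3))
      also have "\<dots> \<le> L powr m * ?E (v p) + c p * ?T u"
        using T[OF p] rc(2)[OF \<open>p \<in> closure \<Omega>\<close>] by (intro add_left_mono mult_left_mono)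
      finally show "S1 * ?N (v p) powr ?\<theta> \<le> L powr m * ?E (v p) + c p * ?T u" .
    qed
    also have "\<dots> = (S1 / S2) * (\<Sum>p\<in>P. ?E (v p)) + C2 * ?T u"
      by (simp add: sum.distrib sum_distrib_left sum_distrib_right C2_def Lm)
    also have "\<dots> \<le> (S1 / S2) * (?E u + C1 * ?T u) + C2 * ?T u"
      using S by (intro add_right_mono mult_left_mono sumE) auto
    finally have "(S2 / S1) * (S1 * ?N u powr ?\<theta>) \<le> (S2 / S1) * ((S1 / S2) * (?E u + C1 * ?T u) + C2 * ?T u)"
      using S by (intro mult_left_mono) auto
    then show "S2 * ?N u powr ?\<theta> \<le> ?E u + (C1 + C2 * (S2 / S1)) * ?T u"
      using S by (simp add: distrib_left distrib_right mult_ac)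
  qed
qed

section \<open>Compactness in square mean\<close>

text \<open>Vitali's theorem leaves a null set uncovered; continuity from above, valid because
  \<Omega> has finite measure, allows stopping after finitely many balls. Finiteness matters because
  each ball later contributes one average whose convergence must be waited for.\<close>

lemma finite_disjoint_balls_almost_cover:
  fixes \<Omega> :: "'a::euclidean_space set"
  assumes \<Omega>: "open \<Omega>" "bounded \<Omega>" and e: "e > 0"
  shows "\<exists>F. finite F \<and> (\<forall>b\<in>F. 0 < snd b \<and> snd b < e \<and> ball (fst b) (snd b) \<subseteq> \<Omega>) \<and>
     disjoint_family_on (\<lambda>b. ball (fst b) (snd b)) F \<and>
     emeasure lborel (\<Omega> - (\<Union>b\<in>F. ball (fst b) (snd b))) < ennreal e"
proof -
  let ?B = "\<lambda>b::'a \<times> real. ball (fst b) (snd b)"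
  let ?K = "{b. 0 < snd b \<and> snd b < e \<and> ?B b \<subseteq> \<Omega>}"
  obtain C where C: "countable C" "C \<subseteq> ?K"
     "pairwise (\<lambda>i j. disjnt (ball (fst i) (snd i)) (ball (fst j) (snd j))) C"
     "negligible (\<Omega> - (\<Union>i\<in>C. ?B i))"
  proof (rule Vitali_covering_theorem_balls[of \<Omega> ?K fst snd])
    fix x and d :: real assume "x \<in> \<Omega>" "0 < d"
    then obtain r where "r > 0" "ball x r \<subseteq> \<Omega>" using \<Omega> open_contains_ball by blast
    then show "\<exists>i. i \<in> ?K \<and> x \<in> ball (fst i) (snd i) \<and> snd i < d"
      using \<open>0 < d\<close> e by (intro exI[of _ "(x, min r (min (d/2) (e/2)))"]) auto
  qed blast
  have disj: "disjoint_family_on ?B C"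
    using C(3) by (auto simp: disjoint_family_on_def pairwise_def disjnt_def)
  have null: "emeasure lborel (\<Omega> - (\<Union>b\<in>C. ?B b)) = 0"
  proof -
    have "\<Omega> - (\<Union>b\<in>C. ?B b) \<in> null_sets lebesgue" using C(4) by (simp add: negligible_iff_null_sets)
    then have "emeasure lebesgue (\<Omega> - (\<Union>b\<in>C. ?B b)) = 0" by auto
    moreover have "open (\<Union>b\<in>C. ?B b)" by blast
    then have "\<Omega> - (\<Union>b\<in>C. ?B b) \<in> sets lborel"
      using \<Omega>(1) by auto
    ultimately show ?thesis by (simp add: emeasure_completion)
  qed
  show ?thesis
  proof (cases "C = {}")
    case True
    then have "emeasure lborel \<Omega> = 0" using null by simp
    then show ?thesis using e by (intro exI[of _ "{}"]) (auto simp: disjoint_family_on_def)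
  next
    case False
    let ?e = "from_nat_into C"
    have ran: "range ?e = C" using False C(1) by (rule range_from_nat_into)
    define A where "A = (\<lambda>N. \<Omega> - (\<Union>b\<in>?e ` {..<N}. ?B b))"
    have Am: "A N \<in> sets lborel" for N
      unfolding A_def using \<Omega>(1) by (intro sets.Diff sets.finite_UN) auto
    have "(\<lambda>N. emeasure lborel (A N)) \<longlonglongrightarrow> emeasure lborel (\<Inter>N. A N)"
    proof (rule Lim_emeasure_decseq)
      show "range A \<subseteq> sets lborel" using Am by auto
      show "decseq A" unfolding A_def decseq_def by (intro allI impI Diff_mono UN_mono) auto
      have "emeasure lborel (A N) \<le> emeasure lborel \<Omega>" for N
        using \<Omega>(1) by (intro emeasure_mono) (auto simp: A_def)
      then show "emeasure lborel (A N) \<noteq> \<infinity>" for N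
        using emeasure_bounded_finite[OF \<Omega>(2)] by (metis infinity_ennreal_def leD)
    qed
    also have "(\<Inter>N. A N) = \<Omega> - (\<Union>b\<in>C. ?B b)"
    proof -
      have "(\<Inter>N. A N) = \<Omega> - (\<Union>N. \<Union>b\<in>?e ` {..<N}. ?B b)" unfolding A_def by blast
      also have "(\<Union>N. \<Union>b\<in>?e ` {..<N}. ?B b) = (\<Union>b\<in>range ?e. ?B b)"
      proof (rule equalityI)
        show "(\<Union>b\<in>range ?e. ?B b) \<subseteq> (\<Union>N. \<Union>b\<in>?e ` {..<N}. ?B b)"
        proof
          fix x assume "x \<in> (\<Union>b\<in>range ?e. ?B b)"
          then obtain i where "x \<in> ?B (?e i)" by blast
          then show "x \<in> (\<Union>N. \<Union>b\<in>?e ` {..<N}. ?B b)" by (intro UN_I[of "Suc i"]) auto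
        qed
      qed blast
      finally show ?thesis unfolding ran .
    qed
    also note null
    finally have "eventually (\<lambda>N. emeasure lborel (A N) < ennreal e) sequentially"
      using e by (intro order_tendstoD(2)) auto
    then obtain N where N: "emeasure lborel (A N) < ennreal e"
      by (auto simp: eventually_sequentially)
    have sub: "?e ` {..<N} \<subseteq> C" using ran by blast
    then have "\<forall>b\<in>?e ` {..<N}. 0 < snd b \<and> snd b < e \<and> ?B b \<subseteq> \<Omega>" using C(2) by blast
    moreover have "disjoint_family_on ?B (?e ` {..<N})" using disj sub by (rule disjoint_family_on_mono[rotated])
    ultimately show ?thesis using N unfolding A_def by blast
  qed
qed

text \<open>Expanding the square turns differences into the deviation from the mean. Together with a
  lower bound of the kernel on a ball this is the Poincare inequality used for compactness.\<close>

lemma variance_identity: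
  fixes f :: "'a \<Rightarrow> real"
  assumes "finite_measure M" and [measurable]: "f \<in> borel_measurable M" and B: "\<And>x. \<bar>f x\<bar> \<le> B"
  shows "(\<integral>\<^sup>+ x. \<integral>\<^sup>+ y. ennreal ((f x - f y)\<^sup>2) \<partial>M \<partial>M)
     = ennreal (2 * measure M (space M) * (\<integral>x. (f x)\<^sup>2 \<partial>M) - 2 * (\<integral>x. f x \<partial>M)\<^sup>2)"
proof -
  interpret finite_measure M by fact
  have i: "integrable M f" using B by (intro integrable_const_bound[where B = B]) auto
  have B2: "(f x)\<^sup>2 \<le> B\<^sup>2" for x using power_mono[OF B, of x 2] by simp
  have i2: "integrable M (\<lambda>x. (f x)\<^sup>2)"
    using B2 by (intro integrable_const_bound[where B = "B\<^sup>2"]) auto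
  define m where "m = measure M (space M)"
  define G where "G = (\<integral>x. (f x)\<^sup>2 \<partial>M)"
  define F where "F = (\<integral>x. f x \<partial>M)"
  have inner: "(\<integral>\<^sup>+ y. ennreal ((f x - f y)\<^sup>2) \<partial>M) = ennreal (m * (f x)\<^sup>2 - 2 * F * f x + G)" for x
  proof -
    have eq: "(f x - f y)\<^sup>2 = (f x)\<^sup>2 - (2 * f x) * f y + (f y)\<^sup>2" for y by (simp add: power2_eq_square algebra_simps)
    have ii: "integrable M (\<lambda>y. (f x - f y)\<^sup>2)" unfolding eq using i i2 by (intro Bochner_Integration.integrable_add Bochner_Integration.integrable_diff) auto
    have "(\<integral>\<^sup>+ y. ennreal ((f x - f y)\<^sup>2) \<partial>M) = ennreal (\<integral>y. (f x - f y)\<^sup>2 \<partial>M)"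
      using ii by (rule nn_integral_eq_integral) auto
    also have "(\<integral>y. (f x - f y)\<^sup>2 \<partial>M) = m * (f x)\<^sup>2 - 2 * F * f x + G"
      unfolding eq using i i2 by (simp add: m_def F_def G_def)
    finally show ?thesis .
  qed
  have ii: "integrable M (\<lambda>x. m * (f x)\<^sup>2 - 2 * F * f x + G)"
    using i i2 by (intro Bochner_Integration.integrable_add Bochner_Integration.integrable_diff) auto
  have nn: "0 \<le> m * (f x)\<^sup>2 - 2 * F * f x + G" for x
  proof -
    have eq: "(f x - f y)\<^sup>2 = (f x)\<^sup>2 - (2 * f x) * f y + (f y)\<^sup>2" for y by (simp add: power2_eq_square algebra_simps)
    have "(\<integral>y. (f x - f y)\<^sup>2 \<partial>M) = m * (f x)\<^sup>2 - 2 * F * f x + G"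
      unfolding eq using i i2 by (simp add: m_def F_def G_def)
    moreover have "(\<integral>y. (f x - f y)\<^sup>2 \<partial>M) \<ge> 0" by (rule integral_nonneg_AE) auto
    ultimately show ?thesis by simp
  qed
  have "(\<integral>\<^sup>+ x. \<integral>\<^sup>+ y. ennreal ((f x - f y)\<^sup>2) \<partial>M \<partial>M) = (\<integral>\<^sup>+ x. ennreal (m * (f x)\<^sup>2 - 2 * F * f x + G) \<partial>M)"
    by (simp add: inner)
  also have "\<dots> = ennreal (\<integral>x. m * (f x)\<^sup>2 - 2 * F * f x + G \<partial>M)"
    using ii nn by (intro nn_integral_eq_integral) auto
  also have "(\<integral>x. m * (f x)\<^sup>2 - 2 * F * f x + G \<partial>M) = m * (\<integral>x. (f x)\<^sup>2 \<partial>M) - 2 * F * (\<integral>x. f x \<partial>M) + m * G"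
    using i i2 by (simp add: m_def)
  also have "\<dots> = 2 * m * G - 2 * F\<^sup>2"
    unfolding G_def[symmetric] F_def[symmetric] by (simp add: power2_eq_square)
  finally show ?thesis unfolding m_def G_def F_def .
qed

text \<open>Two points of a ball have distance at most its diameter, so squared differences are
  bounded by the energy density times \<open>(2 * snd b) powr (n + 2 * \<sigma>)\<close>; division
  by the volume leaves the power 2\<sigma> of the radius. Disjointness lets the energies of the
  balls add up to at most that of \<Omega>.\<close>

lemma lp_pow_two_le_averages:
  fixes \<Omega> :: "'a::euclidean_space set" and F :: "('a \<times> real) set"
  assumes \<Omega>: "open \<Omega>" and \<sigma>: "\<sigma> > 0" and e: "e > 0"
    and F: "finite F" "\<And>b. b \<in> F \<Longrightarrow> 0 < snd b \<and> snd b < e \<and> ball (fst b) (snd b) \<subseteq> \<Omega>"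
      "disjoint_family_on (\<lambda>b. ball (fst b) (snd b)) F"
    and [measurable]: "f \<in> borel_measurable borel" and B: "\<And>x. \<bar>f x\<bar> \<le> B"
  shows "lp_pow 2 \<Omega> f \<le> lp_pow 2 (\<Omega> - (\<Union>b\<in>F. ball (fst b) (snd b))) f
    + ennreal (\<Sum>b\<in>F. (\<integral>x. indicator (ball (fst b) (snd b)) x * f x \<partial>lborel)\<^sup>2 / measure lborel (ball (fst b) (snd b)))
    + ennreal (2 powr (real DIM('a) + 2 * \<sigma>) / unit_ball_vol (real DIM('a)) * e powr (2 * \<sigma>)) * gagliardo \<sigma> \<Omega> f"
proof -
  let ?B = "\<lambda>b::'a \<times> real. ball (fst b) (snd b)"
  let ?n = "DIM('a)"
  define s where "s = real ?n + 2 * \<sigma>"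
  define V where "V = unit_ball_vol (real ?n)"
  have V: "V > 0" unfolding V_def by simp
  define k where "k = 2 powr s / V * e powr (2 * \<sigma>)"
  define a where "a = (\<lambda>b. (\<integral>x. indicator (?B b) x * f x \<partial>lborel)\<^sup>2 / measure lborel (?B b))"
  define N where "N = (\<lambda>x y. ennreal ((f x - f y)\<^sup>2 / norm (x - y) powr s))"
  have [measurable]: "\<Omega> \<in> sets borel" "\<And>b. ?B b \<in> sets borel" using \<Omega> by auto
  have Nm[measurable]: "case_prod N \<in> borel_measurable (borel \<Otimes>\<^sub>M borel)" unfolding N_def by measurable
  define E where "E = (\<lambda>b. \<integral>\<^sup>+ x. \<integral>\<^sup>+ y. indicator (?B b) x * indicator (?B b) y * N x y \<partial>lborel \<partial>lborel)"
  have ball: "(\<integral>\<^sup>+ x. indicator (?B b) x * ennreal (\<bar>f x\<bar> powr 2) \<partial>lborel) \<le> ennreal (a b) + ennreal k * E b" if b: "b \<in> F" for b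
  proof -
    have r: "0 < snd b" "snd b < e" using F(2)[OF b] by auto
    let ?M = "density lborel (indicator (?B b))"
    have em: "emeasure ?M (space ?M) = ennreal (measure lborel (?B b))"
    proof -
      have "emeasure lborel (?B b) < \<infinity>" by (rule emeasure_bounded_finite) simp
      then have "emeasure lborel (?B b) = ennreal (measure lborel (?B b))"
        by (intro emeasure_eq_ennreal_measure) auto
      then show ?thesis by (simp add: emeasure_density)
    qed
    have fM: "finite_measure ?M" by (rule finite_measureI) (use em in simp)
    interpret M: finite_measure ?M by fact
    define m where "m = measure lborel (?B b)"
    have m: "m > 0" "m = V * snd b ^ ?n" using r by (auto simp: m_def V_def content_ball)
    have mm: "measure ?M (space ?M) = m" using em by (simp add: measure_def m_def)
    define G where "G = (\<integral>x. (f x)\<^sup>2 \<partial>?M)"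
    define A where "A = (\<integral>x. f x \<partial>?M)"
    have A: "A = (\<integral>x. indicator (?B b) x * f x \<partial>lborel)"
      unfolding A_def
    proof -
      have "(\<integral>x. f x \<partial>density lborel (\<lambda>x. ennreal (indicator (?B b) x))) = (\<integral>x. indicator (?B b) x *\<^sub>R f x \<partial>lborel)"
        by (rule integral_density) auto
      then show "(\<integral>x. f x \<partial>?M) = (\<integral>x. indicator (?B b) x * f x \<partial>lborel)" by (simp add: ennreal_indicator)
    qed
    have B2: "(f x)\<^sup>2 \<le> B\<^sup>2" for x using power_mono[OF B, of x 2] by simp
    have i2: "integrable ?M (\<lambda>x. (f x)\<^sup>2)"
      using B2 by (intro M.integrable_const_bound[where B = "B\<^sup>2"]) auto
    have G0: "G \<ge> 0" unfolding G_def by (rule integral_nonneg_AE) auto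
    have L: "(\<integral>\<^sup>+ x. indicator (?B b) x * ennreal (\<bar>f x\<bar> powr 2) \<partial>lborel) = ennreal G"
    proof -
      have "(\<integral>\<^sup>+ x. indicator (?B b) x * ennreal (\<bar>f x\<bar> powr 2) \<partial>lborel) = (\<integral>\<^sup>+ x. ennreal ((f x)\<^sup>2) \<partial>?M)"
        by (subst nn_integral_density) auto
      also have "\<dots> = ennreal G" unfolding G_def using i2 by (rule nn_integral_eq_integral) auto
      finally show ?thesis .
    qed
    have "ennreal (2 * m * G - 2 * A\<^sup>2) = (\<integral>\<^sup>+ x. \<integral>\<^sup>+ y. ennreal ((f x - f y)\<^sup>2) \<partial>?M \<partial>?M)"
      unfolding G_def A_def mm[symmetric] by (rule variance_identity[OF fM _ B, symmetric]) measurable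
    also have "\<dots> = (\<integral>\<^sup>+ x. indicator (?B b) x * (\<integral>\<^sup>+ y. indicator (?B b) y * ennreal ((f x - f y)\<^sup>2) \<partial>lborel) \<partial>lborel)"
      by (simp add: nn_integral_density)
    also have "\<dots> = (\<integral>\<^sup>+ x. \<integral>\<^sup>+ y. indicator (?B b) x * (indicator (?B b) y * ennreal ((f x - f y)\<^sup>2)) \<partial>lborel \<partial>lborel)"
      by (intro nn_integral_cong nn_integral_cmult[symmetric]) measurable
    also have "\<dots> \<le> (\<integral>\<^sup>+ x. \<integral>\<^sup>+ y. ennreal ((2 * snd b) powr s) * (indicator (?B b) x * indicator (?B b) y * N x y) \<partial>lborel \<partial>lborel)"
    proof (intro nn_integral_mono)
      fix x y
      show "indicator (?B b) x * (indicator (?B b) y * ennreal ((f x - f y)\<^sup>2)) \<le> ennreal ((2 * snd b) powr s) * (indicator (?B b) x * indicator (?B b) y * N x y)"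
      proof (cases "x \<in> ?B b \<and> y \<in> ?B b \<and> x \<noteq> y")
        case True
        have "dist x y \<le> dist x (fst b) + dist (fst b) y" by (rule dist_triangle)
        then have "norm (x - y) \<le> 2 * snd b" using True by (auto simp: dist_norm norm_minus_commute)
        then have p: "norm (x - y) powr s \<le> (2 * snd b) powr s" using \<sigma> by (intro powr_mono2) (auto simp: s_def)
        have p0: "norm (x - y) powr s > 0" using True by auto
        have "1 \<le> (2 * snd b) powr s / norm (x - y) powr s" using p p0 by simp
        then have "(f x - f y)\<^sup>2 * 1 \<le> (f x - f y)\<^sup>2 * ((2 * snd b) powr s / norm (x - y) powr s)"
          by (rule mult_left_mono) simp
        then have "ennreal ((f x - f y)\<^sup>2) \<le> ennreal ((2 * snd b) powr s) * N x y"
          unfolding N_def by (simp add: ennreal_mult[symmetric] ennreal_leI mult.commute)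
        then show ?thesis using True by simp
      next
        case False
        then have "indicator (?B b) x * (indicator (?B b) y * ennreal ((f x - f y)\<^sup>2)) = 0" by (auto simp: indicator_def)
        then show ?thesis by (simp only: zero_le)
      qed
    qed
    also have "\<dots> = (\<integral>\<^sup>+ x. ennreal ((2 * snd b) powr s) * (\<integral>\<^sup>+ y. indicator (?B b) x * indicator (?B b) y * N x y \<partial>lborel) \<partial>lborel)"
      by (intro nn_integral_cong nn_integral_cmult) measurable
    also have "\<dots> = ennreal ((2 * snd b) powr s) * E b"
      unfolding E_def by (rule nn_integral_cmult) measurable
    finally have le: "ennreal (2 * m * G - 2 * A\<^sup>2) \<le> ennreal ((2 * snd b) powr s) * E b" .
    \<comment> \<open>The variance identity would give half of the last term. The maximum with 0
      prepares the passage to \<open>ennreal\<close>, where negative numbers become 0.\<close>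
    have "G \<le> A\<^sup>2 / m + 1 / m * max 0 (2 * m * G - 2 * A\<^sup>2)"
      using m(1) G0 by (cases "m * G \<ge> A\<^sup>2") (auto simp: field_simps max_def)
    then have "ennreal G \<le> ennreal (A\<^sup>2 / m + 1 / m * max 0 (2 * m * G - 2 * A\<^sup>2))" by (rule ennreal_leI)
    also have "\<dots> = ennreal (A\<^sup>2 / m) + ennreal (1 / m) * ennreal (max 0 (2 * m * G - 2 * A\<^sup>2))"
      using m(1) by (subst ennreal_plus) (auto simp: ennreal_mult[symmetric])
    also have "\<dots> \<le> ennreal (A\<^sup>2 / m) + ennreal (1 / m) * (ennreal ((2 * snd b) powr s) * E b)"
      using le by (intro add_left_mono mult_left_mono) (auto simp: max_def ennreal_neg)
    also have "ennreal (1 / m) * (ennreal ((2 * snd b) powr s) * E b) = ennreal ((2 * snd b) powr s / m) * E b"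
      using m(1) by (simp add: mult.assoc[symmetric] ennreal_mult[symmetric])
    also have "(2 * snd b) powr s / m = 2 powr s / V * snd b powr (2 * \<sigma>)"
      unfolding m(2) using r V by (simp add: powr_mult s_def powr_add powr_realpow[symmetric])
    also have "ennreal (2 powr s / V * snd b powr (2 * \<sigma>)) * E b \<le> ennreal k * E b"
    proof (intro mult_right_mono ennreal_leI)
      have "snd b powr (2 * \<sigma>) \<le> e powr (2 * \<sigma>)" using r \<sigma> by (intro powr_mono2) auto
      then show "2 powr s / V * snd b powr (2 * \<sigma>) \<le> k" unfolding k_def using V by (intro mult_left_mono) auto
    qed simp
    finally show ?thesis unfolding L a_def A m_def by (simp add: add_left_mono)
  qed
  have "lp_pow 2 \<Omega> f \<le> (\<integral>\<^sup>+ x. indicator (\<Omega> - (\<Union>b\<in>F. ?B b)) x * ennreal (\<bar>f x\<bar> powr 2) + (\<Sum>b\<in>F. indicator (?B b) x * ennreal (\<bar>f x\<bar> powr 2)) \<partial>lborel)"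
    unfolding lp_pow_def
  proof (rule nn_integral_mono)
    fix x
    show "indicator \<Omega> x * ennreal (\<bar>f x\<bar> powr 2) \<le> indicator (\<Omega> - (\<Union>b\<in>F. ?B b)) x * ennreal (\<bar>f x\<bar> powr 2) + (\<Sum>b\<in>F. indicator (?B b) x * ennreal (\<bar>f x\<bar> powr 2))"
    proof (cases "x \<in> (\<Union>b\<in>F. ?B b)")
      case True
      then obtain b where b: "b \<in> F" "x \<in> ?B b" by blast
      have "indicator \<Omega> x * ennreal (\<bar>f x\<bar> powr 2) \<le> indicator (?B b) x * ennreal (\<bar>f x\<bar> powr 2)"
        using b by (simp add: indicator_def)
      also have "\<dots> \<le> (\<Sum>b\<in>F. indicator (?B b) x * ennreal (\<bar>f x\<bar> powr 2))"
        by (rule member_le_sum) (use b F in auto)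
      finally show ?thesis by (simp add: add_increasing)
    next
      case False
      then show ?thesis by (cases "x \<in> \<Omega>") (auto simp: indicator_def)
    qed
  qed
  also have "\<dots> = lp_pow 2 (\<Omega> - (\<Union>b\<in>F. ?B b)) f + (\<Sum>b\<in>F. \<integral>\<^sup>+ x. indicator (?B b) x * ennreal (\<bar>f x\<bar> powr 2) \<partial>lborel)"
  proof -
    have [measurable]: "(\<Union>b\<in>F. ?B b) \<in> sets borel" by (auto intro!: borel_open)
    show ?thesis unfolding lp_pow_def
      by (subst nn_integral_add) (auto intro!: borel_measurable_sum simp: nn_integral_sum)
  qed
  also have "(\<Sum>b\<in>F. \<integral>\<^sup>+ x. indicator (?B b) x * ennreal (\<bar>f x\<bar> powr 2) \<partial>lborel) \<le> (\<Sum>b\<in>F. ennreal (a b) + ennreal k * E b)"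
    by (rule sum_mono) (rule ball)
  also have "\<dots> = ennreal (\<Sum>b\<in>F. a b) + ennreal k * (\<Sum>b\<in>F. E b)"
    by (simp add: sum.distrib sum_distrib_left sum_ennreal a_def)
  also have "(\<Sum>b\<in>F. E b) \<le> gagliardo \<sigma> \<Omega> f"
  proof -
    have "(\<Sum>b\<in>F. E b) = (\<integral>\<^sup>+ x. (\<Sum>b\<in>F. (\<integral>\<^sup>+ y. indicator (?B b) x * indicator (?B b) y * N x y \<partial>lborel)) \<partial>lborel)"
      unfolding E_def by (rule nn_integral_sum[symmetric]) measurable
    also have "\<dots> = (\<integral>\<^sup>+ x. \<integral>\<^sup>+ y. (\<Sum>b\<in>F. indicator (?B b) x * indicator (?B b) y * N x y) \<partial>lborel \<partial>lborel)"
      by (intro nn_integral_cong nn_integral_sum[symmetric]) measurable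
    also have "\<dots> \<le> gagliardo \<sigma> \<Omega> f"
      unfolding gagliardo_def s_def[symmetric] N_def[symmetric]
    proof (intro nn_integral_mono)
      fix x y
      show "(\<Sum>b\<in>F. indicator (?B b) x * indicator (?B b) y * N x y) \<le> indicator \<Omega> x * indicator \<Omega> y * ennreal ((f x - f y)\<^sup>2 / norm (x - y) powr s)"
      proof (cases "\<exists>b\<in>F. x \<in> ?B b \<and> y \<in> ?B b")
        case True
        then obtain b where b: "b \<in> F" "x \<in> ?B b" "y \<in> ?B b" by blast
        have "indicator (?B c) x * indicator (?B c) y * N x y = 0" if "c \<in> F - {b}" for c
        proof -
          have "?B c \<inter> ?B b = {}" using F(3) that b(1) unfolding disjoint_family_on_def by blast
          then have "x \<notin> ?B c" using b(2) by blast
          then show ?thesis by (simp add: indicator_def)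
        qed
        then have "(\<Sum>b\<in>F. indicator (?B b) x * indicator (?B b) y * N x y) = indicator (?B b) x * indicator (?B b) y * N x y"
          using F(1) b(1) by (simp add: sum.remove)
        also have "\<dots> = N x y" using b by simp
        also have "\<dots> = indicator \<Omega> x * indicator \<Omega> y * ennreal ((f x - f y)\<^sup>2 / norm (x - y) powr s)"
        proof -
          have "x \<in> \<Omega>" "y \<in> \<Omega>" using F(2)[OF b(1)] b(2,3) by blast+
          then show ?thesis by (simp add: N_def)
        qed
        finally show ?thesis by simp
      next
        case False
        then have "(\<Sum>b\<in>F. indicator (?B b) x * indicator (?B b) y * N x y) = 0"
          by (intro sum.neutral) (auto simp: indicator_def)
        then show ?thesis by (simp only: zero_le)
      qed
    qed
    finally show ?thesis .
  qed
  finally show ?thesis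
    unfolding a_def k_def V_def s_def by (simp add: add.assoc add_left_mono mult_left_mono)
qed

section \<open>Extraction of convergent subsequences\<close>

lemma ennreal_tendsto_0I:
  fixes x :: "nat \<Rightarrow> ennreal"
  assumes "\<And>m. x m \<le> ennreal (b m)" "b \<longlonglongrightarrow> 0"
  shows "x \<longlonglongrightarrow> 0"
proof (rule tendsto_sandwich[of "\<lambda>_. 0" x _ "\<lambda>m. ennreal (b m)"])
  show "(\<lambda>m. ennreal (b m)) \<longlonglongrightarrow> 0" using tendsto_ennrealI[OF assms(2)] by simp
qed (use assms(1) in auto)

lemma C1c_integrable:
  fixes \<Omega> :: "'a::euclidean_space set"
  assumes "bounded \<Omega>" "open \<Omega>" "u \<in> C1c A"
  shows "integrable (dom_measure \<Omega>) u" "finite_measure (dom_measure \<Omega>)"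
proof -
  have [measurable]: "\<Omega> \<in> sets borel" using assms by simp
  have "emeasure (dom_measure \<Omega>) (space (dom_measure \<Omega>)) = emeasure lborel \<Omega>"
    by (simp add: dom_measure_def emeasure_density)
  then show fm: "finite_measure (dom_measure \<Omega>)"
    using emeasure_bounded_finite[OF assms(1)] by (intro finite_measureI) auto
  interpret finite_measure "dom_measure \<Omega>" by fact
  obtain B where "\<And>x. \<bar>u x\<bar> \<le> B" using C1c_bounded[OF assms(3)] by blast
  moreover have "u \<in> borel_measurable (dom_measure \<Omega>)"
    using C1c_borel_measurable[OF assms(3)] by measurable
  ultimately show "integrable (dom_measure \<Omega>) u" by (intro integrable_const_bound[where B = B]) auto
qed

lemma gagliardo_diff_le:
  fixes \<Omega> :: "'a::euclidean_space set"
  assumes [measurable]: "\<Omega> \<in> sets borel" "u \<in> borel_measurable borel" "v \<in> borel_measurable borel"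
  shows "gagliardo \<sigma> \<Omega> (\<lambda>x. u x - v x) \<le> 2 * (gagliardo \<sigma> \<Omega> u + gagliardo \<sigma> \<Omega> v)"
proof -
  have "pint (pair_measure_kernel \<sigma> \<Omega>) 2 (\<lambda>z. diffq u z - diffq v z)
    \<le> 2 * (pint (pair_measure_kernel \<sigma> \<Omega>) 2 (diffq u) + pint (pair_measure_kernel \<sigma> \<Omega>) 2 (diffq v))"
    by (subst pint_parallelogram[symmetric]) auto
  then show ?thesis by (simp add: gagliardo_eq_pint diffq_diff)
qed

text \<open>Three contributions are controlled separately: the uncovered set by integrability with
  exponent \<open>q > 2\<close>, oscillation inside the balls by their small radii and the energy
  bound, and the averages by a diagonal subsequence, since all the families together contain only
  countably many balls.\<close>

lemma lp_pow_two_Cauchy_subseq: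
  fixes \<Omega> :: "'a::euclidean_space set"
  assumes \<Omega>: "open \<Omega>" "bounded \<Omega>" and \<sigma>: "\<sigma> > 0" and q: "q > 2"
    and \<phi>: "\<And>k. \<phi> k \<in> C1c \<Omega>" and bd: "\<And>k. gagliardo \<sigma> \<Omega> (\<phi> k) \<le> ennreal B" "\<And>k. lp_pow q \<Omega> (\<phi> k) \<le> ennreal B" "B \<ge> 0"
  obtains r :: "nat \<Rightarrow> nat" where "strict_mono r"
    "\<And>e. e > 0 \<Longrightarrow> \<exists>N. \<forall>i\<ge>N. \<forall>j\<ge>N. lp_pow 2 \<Omega> (\<lambda>x. \<phi> (r i) x - \<phi> (r j) x) \<le> ennreal e"
proof -
  let ?B = "\<lambda>b::'a \<times> real. ball (fst b) (snd b)"
  have \<Omega>m[measurable]: "\<Omega> \<in> sets borel" using \<Omega> by simp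
  have \<phi>m[measurable]: "\<phi> k \<in> borel_measurable borel" for k using \<phi> by (rule C1c_borel_measurable)
  have "\<forall>m. \<exists>F. finite F \<and> (\<forall>b\<in>F. 0 < snd b \<and> snd b < 1 / Suc m \<and> ?B b \<subseteq> \<Omega>) \<and>
     disjoint_family_on ?B F \<and> emeasure lborel (\<Omega> - (\<Union>b\<in>F. ?B b)) < ennreal (1 / Suc m)"
    using finite_disjoint_balls_almost_cover[OF \<Omega>] by auto
  from choice[OF this] obtain F where F': "\<forall>m. finite (F m) \<and> (\<forall>b\<in>F m. 0 < snd b \<and> snd b < 1 / Suc m \<and> ?B b \<subseteq> \<Omega>) \<and>
     disjoint_family_on ?B (F m) \<and> emeasure lborel (\<Omega> - (\<Union>b\<in>F m. ?B b)) < ennreal (1 / Suc m)"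
    by blast
  have F: "\<And>m. finite (F m)" "\<And>m b. b \<in> F m \<Longrightarrow> 0 < snd b \<and> snd b < 1 / Suc m \<and> ?B b \<subseteq> \<Omega>"
    "\<And>m. disjoint_family_on ?B (F m)" "\<And>m. emeasure lborel (\<Omega> - (\<Union>b\<in>F m. ?B b)) < ennreal (1 / Suc m)"
    using F' by blast+
  define A where "A = (\<lambda>k b. \<integral>x. indicator (?B b) x * \<phi> k x \<partial>lborel)"
  define mO where "mO = measure lborel \<Omega>"
  have mO: "emeasure lborel \<Omega> = ennreal mO"
    using emeasure_bounded_finite[OF \<Omega>(2)] unfolding mO_def by (intro emeasure_eq_ennreal_measure) auto
  have intb: "integrable lborel (\<lambda>x. indicator (?B b) x * \<phi> k x)" for k b
  proof -
    obtain D where D: "\<And>x. \<bar>\<phi> k x\<bar> \<le> D" using C1c_bounded[OF \<phi>] by blast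
    have "emeasure lborel (?B b) < \<infinity>" by (rule emeasure_bounded_finite) simp
    then have "integrable lborel (\<lambda>x. indicator (?B b) x *\<^sub>R \<phi> k x)"
      using D by (intro integrableI_bounded_set_indicator[where B = D]) auto
    then show ?thesis by simp
  qed
  \<comment> \<open>The diagonal extraction needs bounded averages;
    \<open>\<bar>t\<bar> \<le> 1 + \<bar>t\<bar> powr q\<close> bounds all of them at once by volume
    and norm integral.\<close>
  have Abd: "\<bar>A k b\<bar> \<le> mO + B" if "b \<in> (\<Union>m. F m)" for k b
  proof -
    have sub: "?B b \<subseteq> \<Omega>" using that F(2) by blast
    have "ennreal \<bar>A k b\<bar> \<le> (\<integral>\<^sup>+ x. norm (indicator (?B b) x * \<phi> k x) \<partial>lborel)"
      unfolding A_def using integral_norm_bound_ennreal[OF intb] by simp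
    also have "\<dots> \<le> (\<integral>\<^sup>+ x. indicator \<Omega> x + indicator \<Omega> x * ennreal (\<bar>\<phi> k x\<bar> powr q) \<partial>lborel)"
    proof (rule nn_integral_mono)
      fix x
      have "\<bar>\<phi> k x\<bar> \<le> 1 + \<bar>\<phi> k x\<bar> powr q"
      proof (cases "\<bar>\<phi> k x\<bar> \<le> 1")
        case False
        then have "\<bar>\<phi> k x\<bar> powr 1 \<le> \<bar>\<phi> k x\<bar> powr q" using q by (intro powr_mono) auto
        then show ?thesis by simp
      qed (auto intro: add_increasing2)
      then have "ennreal \<bar>\<phi> k x\<bar> \<le> 1 + ennreal (\<bar>\<phi> k x\<bar> powr q)"
        using ennreal_leI[of "\<bar>\<phi> k x\<bar>" "1 + \<bar>\<phi> k x\<bar> powr q"] by simp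
      then show "ennreal (norm (indicator (?B b) x * \<phi> k x)) \<le> indicator \<Omega> x + indicator \<Omega> x * ennreal (\<bar>\<phi> k x\<bar> powr q)"
        using sub by (auto simp: indicator_def)
    qed
    also have "\<dots> = ennreal mO + lp_pow q \<Omega> (\<phi> k)"
      unfolding lp_pow_def by (subst nn_integral_add) (auto simp: mO)
    also have "\<dots> \<le> ennreal mO + ennreal B" using bd(2) by (rule add_left_mono)
    also have "\<dots> = ennreal (mO + B)" using bd(3) by (simp add: mO_def)
    finally have "ennreal \<bar>A k b\<bar> \<le> ennreal (mO + B)" .
    moreover have "0 \<le> mO + B" using bd(3) by (simp add: mO_def)
    ultimately show ?thesis by (subst (asm) ennreal_le_iff)
  qed
  obtain r :: "nat \<Rightarrow> nat" where r: "strict_mono r" "\<And>b. b \<in> (\<Union>m. F m) \<Longrightarrow> \<exists>l. (\<lambda>n. A (r n) b) \<longlonglongrightarrow> l"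
  proof (rule function_convergent_subsequence[of "\<Union>m. F m" A "mO + B"])
    show "countable (\<Union>m. F m)" using F(1) by (intro countable_UN) (auto intro: countable_finite)
  qed (use Abd in auto)
  obtain C0 where C0: "C0 \<ge> 0" "\<And>M f g. f \<in> borel_measurable M \<Longrightarrow> g \<in> borel_measurable M \<Longrightarrow>
      pint M q (\<lambda>x. f x + g x :: real) \<le> ennreal (1 + 1) * pint M q f + ennreal C0 * pint M q (g :: 'a \<Rightarrow> real)"
  proof (rule pint_add_le[of q 1])
    show "1 < q" using q by simp
  qed (rule zero_less_one, rule that)
  define B' where "B' = (2 + C0) * B"
  have B': "B' \<ge> 0" using C0 bd(3) by (simp add: B'_def)
  have lpd: "lp_pow q \<Omega> (\<lambda>x. \<phi> i x - \<phi> j x) \<le> ennreal B'" for i j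
  proof -
    have "lp_pow q \<Omega> (\<lambda>x. \<phi> i x - \<phi> j x) \<le> ennreal (1 + 1) * lp_pow q \<Omega> (\<phi> i) + ennreal C0 * lp_pow q \<Omega> (\<phi> j)"
      using C0(2)[of "\<phi> i" "dom_measure \<Omega>" "\<lambda>x. - \<phi> j x"] by (simp add: lp_pow_eq_pint pint_minus)
    also have "\<dots> \<le> ennreal (1 + 1) * ennreal B + ennreal C0 * ennreal B"
      by (intro add_mono mult_left_mono bd) auto
    also have "\<dots> = ennreal B'"
      unfolding B'_def distrib_right using C0(1) bd(3) by (subst ennreal_plus) (auto simp: ennreal_mult)
    finally show ?thesis .
  qed
  have gd: "gagliardo \<sigma> \<Omega> (\<lambda>x. \<phi> i x - \<phi> j x) \<le> ennreal (4 * B)" for i j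
  proof -
    have "gagliardo \<sigma> \<Omega> (\<lambda>x. \<phi> i x - \<phi> j x) \<le> 2 * (gagliardo \<sigma> \<Omega> (\<phi> i) + gagliardo \<sigma> \<Omega> (\<phi> j))"
      by (rule gagliardo_diff_le) measurable
    also have "\<dots> \<le> 2 * (ennreal B + ennreal B)" by (intro mult_left_mono add_mono bd) auto
    also have "\<dots> = ennreal (4 * B)" using bd(3) by (simp add: ennreal_plus[symmetric] ennreal_mult'[symmetric] del: ennreal_plus) (simp add: ennreal_mult)
    finally show ?thesis .
  qed
  define kk where "kk = 2 powr (real DIM('a) + 2 * \<sigma>) / unit_ball_vol (real DIM('a))"
  have kk: "kk > 0" unfolding kk_def by simp
  show thesis
  proof (rule that[OF r(1)])
    fix e :: real assume e: "e > 0"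
    \<comment> \<open>The budget is four quarters of \<open>e\<close>: two for the uncovered set,
      one for the averages, one for the oscillation. First \<open>d\<close> is taken large against
      the norm bound, then \<open>m\<close> large depending on \<open>d\<close>, and finally the
      indices depending on the fixed finite family \<open>F m\<close>.\<close>
    have "((\<lambda>d. d powr ((2 - q) / 2) * B') \<longlongrightarrow> 0 * B') at_top"
      using q by (intro tendsto_mult tendsto_const tendsto_neg_powr filterlim_ident) auto
    then have "eventually (\<lambda>d. d powr ((2 - q) / 2) * B' < e / 4) at_top"
      using e by (intro order_tendstoD(2)[where y = 0]) auto
    then obtain d where d: "d > 0" "d powr ((2 - q) / 2) * B' < e / 4"
      using eventually_happens'[OF _ eventually_conj[OF _ eventually_gt_at_top[of 0]]] trivial_limit_at_top_linorder by blast
    have lim1: "(\<lambda>m. 1 / real (Suc m)) \<longlonglongrightarrow> 0" by (rule LIMSEQ_Suc[OF lim_1_over_n])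
    have l1: "eventually (\<lambda>m. d * (1 / real (Suc m)) < e / 4) sequentially"
      using e tendsto_mult_right_zero[OF lim1, of d] by (intro order_tendstoD(2)[where y = 0]) auto
    have "(\<lambda>m. kk * (1 / real (Suc m)) powr (2 * \<sigma>) * (4 * B)) \<longlonglongrightarrow> kk * 0 powr (2 * \<sigma>) * (4 * B)"
      by (intro tendsto_intros tendsto_powr' lim1) (use \<sigma> in auto)
    then have l2: "eventually (\<lambda>m. kk * (1 / real (Suc m)) powr (2 * \<sigma>) * (4 * B) < e / 4) sequentially"
      using e by (intro order_tendstoD(2)[where y = 0]) auto
    obtain m where m: "d * (1 / real (Suc m)) < e / 4" "kk * (1 / real (Suc m)) powr (2 * \<sigma>) * (4 * B) < e / 4"
      using eventually_happens'[OF sequentially_bot eventually_conj[OF l1 l2]] by blast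
    \<comment> \<open>The \<open>+ 1\<close> keeps \<open>W\<close> positive when the family of
      balls is empty.\<close>
    define W where "W = (\<Sum>b\<in>F m. 1 / measure lborel (?B b)) + 1"
    have W: "W > 0" unfolding W_def by (intro add_nonneg_pos sum_nonneg) auto
    define h where "h = sqrt (e / (4 * W))"
    have h: "h > 0" "h\<^sup>2 = e / (4 * W)" using e W by (auto simp: h_def)
    have "\<exists>N. \<forall>i\<ge>N. \<forall>j\<ge>N. \<bar>A (r i) b - A (r j) b\<bar> < h" if "b \<in> F m" for b
    proof -
      have "Cauchy (\<lambda>n. A (r n) b)" using r(2)[of b] that by (auto intro: LIMSEQ_imp_Cauchy)
      then show ?thesis using h(1) unfolding Cauchy_def dist_real_def by blast
    qed
    then obtain N where N: "\<And>b i j. b \<in> F m \<Longrightarrow> i \<ge> N b \<Longrightarrow> j \<ge> N b \<Longrightarrow> \<bar>A (r i) b - A (r j) b\<bar> < h" by metis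
    define N0 where "N0 = Max (insert 0 (N ` F m))"
    have N0: "N b \<le> N0" if "b \<in> F m" for b unfolding N0_def using F(1) that by (intro Max_ge) auto
    have "lp_pow 2 \<Omega> (\<lambda>x. \<phi> (r i) x - \<phi> (r j) x) \<le> ennreal e" if ij: "i \<ge> N0" "j \<ge> N0" for i j
    proof -
      let ?f = "\<lambda>x. \<phi> (r i) x - \<phi> (r j) x"
      let ?R = "\<Omega> - (\<Union>b\<in>F m. ?B b)"
      have fC: "?f \<in> C1c \<Omega>" using \<phi> by (intro C1c_diff)
      obtain D where D: "\<And>x. \<bar>?f x\<bar> \<le> D" using C1c_bounded[OF fC] by blast
      have "open (\<Union>b\<in>F m. ?B b)" by blast
      then have [measurable]: "?R \<in> sets borel" using \<Omega> by auto
      have "lp_pow 2 \<Omega> ?f \<le> lp_pow 2 ?R ?f + ennreal (\<Sum>b\<in>F m. (\<integral>x. indicator (?B b) x * ?f x \<partial>lborel)\<^sup>2 / measure lborel (?B b))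
         + ennreal (kk * (1 / Suc m) powr (2 * \<sigma>)) * gagliardo \<sigma> \<Omega> ?f"
        unfolding kk_def
        by (rule lp_pow_two_le_averages[OF \<Omega>(1) \<sigma> _ F(1) F(2) F(3) _ D]) auto
      also have "lp_pow 2 ?R ?f \<le> ennreal (e / 4 + e / 4)"
      proof -
        have "lp_pow 2 ?R ?f \<le> ennreal d * emeasure lborel ?R + ennreal (d powr ((2 - q) / 2)) * lp_pow q ?R ?f"
          by (rule lp_pow_two_le[OF q d(1)]) measurable
        also have "\<dots> \<le> ennreal d * ennreal (1 / Suc m) + ennreal (d powr ((2 - q) / 2)) * ennreal B'"
        proof (intro add_mono mult_left_mono)
          show "emeasure lborel ?R \<le> ennreal (1 / Suc m)" using F(4)[of m] by simp
          have "lp_pow q ?R ?f \<le> lp_pow q \<Omega> ?f"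
            unfolding lp_pow_def by (intro nn_integral_mono mult_right_mono) (auto simp: indicator_def)
          then show "lp_pow q ?R ?f \<le> ennreal B'" using lpd order_trans by blast
        qed auto
        also have "\<dots> = ennreal (d * (1 / Suc m) + d powr ((2 - q) / 2) * B')"
          using d(1) B' by (subst ennreal_plus) (auto simp: ennreal_mult[symmetric])
        also have "\<dots> \<le> ennreal (e / 4 + e / 4)" using m(1) d(2) by (intro ennreal_leI add_mono) auto
        finally show ?thesis .
      qed
      also have "ennreal (\<Sum>b\<in>F m. (\<integral>x. indicator (?B b) x * ?f x \<partial>lborel)\<^sup>2 / measure lborel (?B b)) \<le> ennreal (e / 4)"
      proof (rule ennreal_leI)
        have "(\<Sum>b\<in>F m. (\<integral>x. indicator (?B b) x * ?f x \<partial>lborel)\<^sup>2 / measure lborel (?B b)) \<le> (\<Sum>b\<in>F m. h\<^sup>2 * (1 / measure lborel (?B b)))"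
        proof (rule sum_mono)
          fix b assume b: "b \<in> F m"
          have "(\<integral>x. indicator (?B b) x * ?f x \<partial>lborel) = A (r i) b - A (r j) b"
            unfolding A_def right_diff_distrib by (rule Bochner_Integration.integral_diff[OF intb intb])
          then have "\<bar>\<integral>x. indicator (?B b) x * ?f x \<partial>lborel\<bar> \<le> h"
            using N[OF b, of i j] N0[OF b] ij by simp
          then have "(\<integral>x. indicator (?B b) x * ?f x \<partial>lborel)\<^sup>2 \<le> h\<^sup>2"
            using power_mono[of "\<bar>\<integral>x. indicator (?B b) x * ?f x \<partial>lborel\<bar>" h 2] by simp
          then have "(\<integral>x. indicator (?B b) x * ?f x \<partial>lborel)\<^sup>2 / measure lborel (?B b) \<le> h\<^sup>2 / measure lborel (?B b)"
            by (rule divide_right_mono) simp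
          then show "(\<integral>x. indicator (?B b) x * ?f x \<partial>lborel)\<^sup>2 / measure lborel (?B b) \<le> h\<^sup>2 * (1 / measure lborel (?B b))" by simp
        qed
        also have "\<dots> = h\<^sup>2 * (W - 1)" unfolding W_def by (simp add: sum_distrib_left)
        also have "\<dots> \<le> h\<^sup>2 * W" by (intro mult_left_mono) auto
        also have "\<dots> = e / 4" using W by (simp add: h(2))
        finally show "(\<Sum>b\<in>F m. (\<integral>x. indicator (?B b) x * ?f x \<partial>lborel)\<^sup>2 / measure lborel (?B b)) \<le> e / 4" .
      qed
      also have "ennreal (kk * (1 / Suc m) powr (2 * \<sigma>)) * gagliardo \<sigma> \<Omega> ?f \<le> ennreal (e / 4)"
      proof -
        have "ennreal (kk * (1 / Suc m) powr (2 * \<sigma>)) * gagliardo \<sigma> \<Omega> ?f \<le> ennreal (kk * (1 / Suc m) powr (2 * \<sigma>)) * ennreal (4 * B)"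
          by (intro mult_left_mono gd) auto
        also have "\<dots> = ennreal (kk * (1 / Suc m) powr (2 * \<sigma>) * (4 * B))"
          using kk bd(3) by (simp add: ennreal_mult)
        also have "\<dots> \<le> ennreal (e / 4)" using m(2) by (intro ennreal_leI) simp
        finally show ?thesis .
      qed
      finally show ?thesis using e by (simp add: ennreal_plus[symmetric] add_mono del: ennreal_plus)
    qed
    then show "\<exists>N. \<forall>i\<ge>N. \<forall>j\<ge>N. lp_pow 2 \<Omega> (\<lambda>x. \<phi> (r i) x - \<phi> (r j) x) \<le> ennreal e" by blast
  qed
qed

text \<open>On a set of finite measure the Cauchy property in square mean passes to the mean, whence
  a further subsequence is Cauchy almost everywhere. Fatou's lemma in the second index identifies
  the pointwise limit as the limit in square mean.\<close>

lemma lp_pow_two_compactness: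
  fixes \<Omega> :: "'a::euclidean_space set"
  assumes \<Omega>: "open \<Omega>" "bounded \<Omega>" and \<sigma>: "\<sigma> > 0" and q: "q > 2"
    and \<phi>: "\<And>k. \<phi> k \<in> C1c \<Omega>" and bd: "\<And>k. gagliardo \<sigma> \<Omega> (\<phi> k) \<le> ennreal B" "\<And>k. lp_pow q \<Omega> (\<phi> k) \<le> ennreal B" "B \<ge> 0"
  obtains r :: "nat \<Rightarrow> nat" and g where "strict_mono r" "g \<in> borel_measurable borel"
    "AE x in dom_measure \<Omega>. (\<lambda>k. \<phi> (r k) x) \<longlonglongrightarrow> g x"
    "(\<lambda>k. lp_pow 2 \<Omega> (\<lambda>x. \<phi> (r k) x - g x)) \<longlonglongrightarrow> 0"
proof -
  have \<Omega>m[measurable]: "\<Omega> \<in> sets borel" using \<Omega> by simp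
  have \<phi>m[measurable]: "\<phi> k \<in> borel_measurable borel" for k using \<phi> by (rule C1c_borel_measurable)
  obtain r1 :: "nat \<Rightarrow> nat" where r1: "strict_mono r1"
    "\<And>e. e > 0 \<Longrightarrow> \<exists>N. \<forall>i\<ge>N. \<forall>j\<ge>N. lp_pow 2 \<Omega> (\<lambda>x. \<phi> (r1 i) x - \<phi> (r1 j) x) \<le> ennreal e"
    by (rule lp_pow_two_Cauchy_subseq[where \<phi> = \<phi>, OF \<Omega> \<sigma> q \<phi> bd]) blast
  define mO where "mO = measure lborel \<Omega>"
  have mO: "emeasure lborel \<Omega> = ennreal mO" "mO \<ge> 0"
    using emeasure_bounded_finite[OF \<Omega>(2)] unfolding mO_def by (auto intro!: emeasure_eq_ennreal_measure)
  obtain r2 where r2: "strict_mono r2" "AE x in dom_measure \<Omega>. Cauchy (\<lambda>i. \<phi> (r1 (r2 i)) x)"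
  proof (rule cauchy_L1_AE_cauchy_subseq[of "dom_measure \<Omega>" "\<lambda>n. \<phi> (r1 n)"])
    show "integrable (dom_measure \<Omega>) (\<phi> (r1 n))" for n by (rule C1c_integrable[OF \<Omega>(2,1) \<phi>])
    fix e :: real assume e: "e > 0"
    \<comment> \<open>Tuned to the bound of \<open>\<bar>t\<bar>\<close> by
      \<open>d + 1 / d * t\<^sup>2\<close>: the constant integrates to less than
      \<open>e / 2\<close>, and square norms up to \<open>d * (e / 2)\<close> give the other
      half.\<close>
    define d where "d = e / (2 * (mO + 1))"
    have d: "d > 0" "d * mO < e / 2"
    proof -
      show "d > 0" using e mO by (simp add: d_def)
      then have "d * mO < d * (mO + 1)" by simp
      also have "\<dots> = e / 2" using mO by (simp add: d_def field_simps)
      finally show "d * mO < e / 2" .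
    qed
    obtain N where N: "\<And>i j. i \<ge> N \<Longrightarrow> j \<ge> N \<Longrightarrow> lp_pow 2 \<Omega> (\<lambda>x. \<phi> (r1 i) x - \<phi> (r1 j) x) \<le> ennreal (d * (e / 2))"
      using r1(2)[of "d * (e / 2)"] d e by auto
    have "(\<integral>x. norm (\<phi> (r1 i) x - \<phi> (r1 j) x) \<partial>dom_measure \<Omega>) < e" if ij: "i \<ge> N" "j \<ge> N" for i j
    proof -
      let ?f = "\<lambda>x. \<phi> (r1 i) x - \<phi> (r1 j) x"
      have "integrable (dom_measure \<Omega>) ?f" using \<phi> by (intro C1c_integrable[OF \<Omega>(2,1)] C1c_diff)
      then have "ennreal (\<integral>x. norm (?f x) \<partial>dom_measure \<Omega>) = (\<integral>\<^sup>+ x. norm (?f x) \<partial>dom_measure \<Omega>)"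
        by (intro nn_integral_eq_integral[symmetric]) auto
      also have "\<dots> \<le> (\<integral>\<^sup>+ x. ennreal d + ennreal (1 / d) * ennreal (\<bar>?f x\<bar> powr 2) \<partial>dom_measure \<Omega>)"
      proof (rule nn_integral_mono)
        fix x
        have "\<bar>t\<bar> \<le> d + 1 / d * t\<^sup>2" for t :: real
        proof (cases "\<bar>t\<bar> \<le> d")
          case False
          then have "\<bar>t\<bar> * d \<le> \<bar>t\<bar> * \<bar>t\<bar>" by (intro mult_left_mono) auto
          then have "\<bar>t\<bar> \<le> 1 / d * t\<^sup>2" using d(1) by (simp add: field_simps power2_eq_square)
          then show ?thesis using d(1) by linarith
        qed (use d(1) in \<open>auto intro: add_increasing2\<close>)
        from ennreal_leI[OF this[of "?f x"]]
        show "ennreal (norm (?f x)) \<le> ennreal d + ennreal (1 / d) * ennreal (\<bar>?f x\<bar> powr 2)"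
          using d(1) by (simp add: ennreal_mult[symmetric])
      qed
      also have "\<dots> = ennreal d * emeasure lborel \<Omega> + ennreal (1 / d) * lp_pow 2 \<Omega> ?f"
      proof -
        have "emeasure (dom_measure \<Omega>) (space (dom_measure \<Omega>)) = emeasure lborel \<Omega>"
          by (simp add: dom_measure_def emeasure_density)
        then show ?thesis by (simp add: nn_integral_add nn_integral_cmult lp_pow_eq_pint pint_def)
      qed
      also have "\<dots> \<le> ennreal d * ennreal mO + ennreal (1 / d) * ennreal (d * (e / 2))"
        unfolding mO(1) by (intro add_left_mono mult_left_mono N ij) auto
      also have "\<dots> = ennreal (d * mO + e / 2)"
        using d(1) e mO(2) by (simp add: ennreal_mult[symmetric] ennreal_plus[symmetric] del: ennreal_plus)
      finally have "(\<integral>x. norm (?f x) \<partial>dom_measure \<Omega>) \<le> d * mO + e / 2"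
        using d(1) e mO(2) by (subst (asm) ennreal_le_iff) auto
      then show ?thesis using d(2) by simp
    qed
    then show "\<exists>N. \<forall>i\<ge>N. \<forall>j\<ge>N. (\<integral>x. norm (\<phi> (r1 i) x - \<phi> (r1 j) x) \<partial>dom_measure \<Omega>) < e" by blast
  qed
  define r where "r = r1 \<circ> r2"
  have r: "strict_mono r" unfolding r_def using r1(1) r2(1) by (rule strict_mono_o)
  define g where "g = (\<lambda>x. lim (\<lambda>k. \<phi> (r k) x))"
  have gm[measurable]: "g \<in> borel_measurable borel" unfolding g_def by measurable
  have lim: "AE x in dom_measure \<Omega>. (\<lambda>k. \<phi> (r k) x) \<longlonglongrightarrow> g x"
    using r2(2) by eventually_elim (simp add: g_def r_def convergent_LIMSEQ_iff[symmetric] Cauchy_convergent_iff)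
  have "(\<lambda>k. lp_pow 2 \<Omega> (\<lambda>x. \<phi> (r k) x - g x)) \<longlonglongrightarrow> 0"
  proof (rule order_tendstoI)
    fix a :: ennreal assume "0 < a"
    then obtain e' where e': "0 < e'" "e' < a" using dense by blast
    obtain e where e: "e > 0" "ennreal e < a"
    proof (cases e' rule: ennreal_cases)
      case (real t)
      then show thesis using that[of t] e' by simp
    next
      case top
      then show thesis using e'(2) by simp
    qed
    obtain N where N: "\<And>i j. i \<ge> N \<Longrightarrow> j \<ge> N \<Longrightarrow> lp_pow 2 \<Omega> (\<lambda>x. \<phi> (r1 i) x - \<phi> (r1 j) x) \<le> ennreal e"
      using r1(2)[OF e(1)] by blast
    have "lp_pow 2 \<Omega> (\<lambda>x. \<phi> (r k) x - g x) \<le> ennreal e" if k: "k \<ge> N" for k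
    proof -
      have "pint (dom_measure \<Omega>) 2 (\<lambda>x. \<phi> (r k) x - g x) \<le> ennreal e"
      proof (rule pint_Fatou_bound[where f = "\<lambda>l x. \<phi> (r k) x - \<phi> (r l) x"])
        show "AE x in dom_measure \<Omega>. (\<lambda>l. \<phi> (r k) x - \<phi> (r l) x) \<longlonglongrightarrow> \<phi> (r k) x - g x"
          using lim by eventually_elim (intro tendsto_intros)
        show "eventually (\<lambda>l. pint (dom_measure \<Omega>) 2 (\<lambda>x. \<phi> (r k) x - \<phi> (r l) x) \<le> ennreal e) sequentially"
          using eventually_ge_at_top[of N]
        proof eventually_elim
          case (elim l)
          have "r2 k \<ge> N" "r2 l \<ge> N" using seq_suble[OF r2(1), of k] seq_suble[OF r2(1), of l] k elim by auto
          then show ?case using N[of "r2 k" "r2 l"] by (simp add: r_def lp_pow_eq_pint)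
        qed
      qed (auto intro: \<phi>m gm)
      then show ?thesis by (simp add: lp_pow_eq_pint)
    qed
    then show "eventually (\<lambda>k. lp_pow 2 \<Omega> (\<lambda>x. \<phi> (r k) x - g x) < a) sequentially"
      using e(2) by (auto simp: eventually_sequentially intro: le_less_trans)
  qed simp
  then show thesis using that[OF r gm lim] by blast
qed

section \<open>Limits of bounded sequences\<close>

text \<open>Closure under midpoints replaces the convex hull: the parallelogram law never uses other
  combinations, and induction then has just two cases.\<close>

inductive_set tail_hull :: "(nat \<Rightarrow> 'a \<Rightarrow> real) \<Rightarrow> nat \<Rightarrow> ('a \<Rightarrow> real) set" for \<phi> m where
  tail: "m \<le> k \<Longrightarrow> \<phi> k \<in> tail_hull \<phi> m"
| midpoint: "f \<in> tail_hull \<phi> m \<Longrightarrow> g \<in> tail_hull \<phi> m \<Longrightarrow> (\<lambda>x. (f x + g x) / 2) \<in> tail_hull \<phi> m"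

lemma tail_hull_C1c:
  assumes "f \<in> tail_hull \<phi> m" "\<And>k. \<phi> k \<in> C1c \<Omega>"
  shows "f \<in> C1c \<Omega>"
  using assms(1)
proof induction
  case (midpoint f g)
  then show ?case using C1c_cmult[OF C1c_add[OF midpoint.IH], of "1/2"] by (simp add: add_divide_distrib)
qed (rule assms(2))

lemma tail_hull_antimono:
  assumes "f \<in> tail_hull \<phi> l" "m \<le> l"
  shows "f \<in> tail_hull \<phi> m"
  using assms(1) by induction (use assms(2) in \<open>auto intro: tail_hull.intros\<close>)

text \<open>An interval centred at \<open>c\<close> is closed under midpoints. Consequently any
  choice of one element from each tail hull inherits the pointwise limit.\<close>

lemma tail_hull_close:
  assumes "f \<in> tail_hull \<phi> m" "\<And>k. k \<ge> m \<Longrightarrow> \<bar>\<phi> k x - c\<bar> \<le> e"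
  shows "\<bar>f x - c\<bar> \<le> e"
  using assms(1)
proof induction
  case (midpoint f g)
  have "\<bar>(f x + g x) / 2 - c\<bar> = \<bar>(f x - c) + (g x - c)\<bar> / 2" by (simp add: field_simps)
  also have "\<dots> \<le> (\<bar>f x - c\<bar> + \<bar>g x - c\<bar>) / 2" by (intro divide_right_mono abs_triangle_ineq) simp
  also have "\<dots> \<le> e" using midpoint.IH by simp
  finally show ?case .
qed (use assms(2) in auto)

lemma tail_hull_tendsto:
  assumes "\<And>m. v m \<in> tail_hull \<phi> m" "(\<lambda>k. \<phi> k x) \<longlonglongrightarrow> c"
  shows "(\<lambda>m. v m x) \<longlonglongrightarrow> c"
proof (rule LIMSEQ_I)
  fix e :: real assume "e > 0"
  then obtain N where N: "\<And>k. k \<ge> N \<Longrightarrow> norm (\<phi> k x - c) < e / 2"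
    using LIMSEQ_D[OF assms(2), of "e / 2"] by auto
  have "\<bar>v m x - c\<bar> \<le> e / 2" if "m \<ge> N" for m
    by (rule tail_hull_close[OF assms(1)]) (use N that in \<open>force intro: less_imp_le\<close>)
  then show "\<exists>N. \<forall>m\<ge>N. norm (v m x - c) < e" using \<open>e > 0\<close> by (intro exI[of _ N]) force
qed

text \<open>Mazur's argument: near-minimizers of the energy in the midpoint-convex hulls of the tails
  form a Cauchy sequence by the parallelogram law, and they have the same pointwise limit.\<close>

lemma C1c_approximation_of_limit:
  fixes \<Omega> :: "'a::euclidean_space set"
  assumes n: "DIM('a) \<ge> 2" and \<sigma>: "0 < \<sigma>" "\<sigma> < 1" and \<Omega>: "open \<Omega>" "bounded \<Omega>"
    and S: "0 < S" "ereal S \<le> S_const \<sigma> \<Omega>"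
    and \<phi>: "\<And>k. \<phi> k \<in> C1c \<Omega>" and bd: "\<And>k. gagliardo \<sigma> \<Omega> (\<phi> k) \<le> ennreal B" "B \<ge> 0"
    and gm: "g \<in> borel_measurable borel" and lim: "AE x in dom_measure \<Omega>. (\<lambda>k. \<phi> k x) \<longlonglongrightarrow> g x"
  obtains \<psi> where "\<And>m. \<psi> m \<in> C1c \<Omega>" "(\<lambda>m. gagliardo \<sigma> \<Omega> (\<lambda>x. \<psi> m x - g x)) \<longlonglongrightarrow> 0"
    "(\<lambda>m. lp_pow (crit_exp DIM('a) \<sigma>) \<Omega> (\<lambda>x. \<psi> m x - g x)) \<longlonglongrightarrow> 0"
proof -
  let ?q = "crit_exp DIM('a) \<sigma>" and ?\<theta> = "(real DIM('a) - 2 * \<sigma>) / real DIM('a)"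
  have \<theta>: "?\<theta> > 0" using n \<sigma> by auto
  have q: "?q > 0" using n \<sigma> by (simp add: crit_exp_def)
  have sn: "2 \<le> real DIM('a) + 2 * \<sigma>" using n \<sigma> by simp
  have \<Omega>m[measurable]: "\<Omega> \<in> sets borel" using \<Omega> by simp
  note [measurable] = gm
  define K where "K = tail_hull \<phi>"
  have KC: "f \<in> C1c \<Omega>" if "f \<in> K m" for f m using tail_hull_C1c that \<phi> unfolding K_def by blast
  define e where "e = (\<lambda>f. enn2real (gagliardo \<sigma> \<Omega> f))"
  have fin: "gagliardo \<sigma> \<Omega> f < \<infinity>" "lp_pow ?q \<Omega> f < \<infinity>" if "f \<in> C1c \<Omega>" for f
    using gagliardo_C1c_finite[OF \<Omega> \<sigma>(2) sn that] lp_pow_C1c_finite[OF \<Omega> that] q by auto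
  have e0: "e f \<ge> 0" for f by (simp add: e_def)
  have \<phi>K: "\<phi> m \<in> K m" for m unfolding K_def by (rule tail_hull.tail) simp
  have e\<phi>: "e (\<phi> m) \<le> B" for m unfolding e_def using bd by (intro enn2real_leI)
  have par: "e (\<lambda>x. f x - h x) = 2 * e f + 2 * e h - 4 * e (\<lambda>x. (f x + h x) / 2)"
    if f: "f \<in> C1c \<Omega>" and h: "h \<in> C1c \<Omega>" for f h
  proof -
    note [measurable] = C1c_borel_measurable[OF f] C1c_borel_measurable[OF h]
    let ?M = "pair_measure_kernel \<sigma> \<Omega>"
    have mid: "gagliardo \<sigma> \<Omega> (\<lambda>x. (f x + h x) / 2) = ennreal (1/4) * pint ?M 2 (\<lambda>z. diffq f z + diffq h z)"
    proof -
      have "gagliardo \<sigma> \<Omega> (\<lambda>x. (f x + h x) / 2) = pint ?M 2 (diffq (\<lambda>x. (1/2) * (f x + h x)))"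
        by (subst gagliardo_eq_pint) auto
      also have "\<dots> = pint ?M 2 (\<lambda>z. (1/2) * (diffq f z + diffq h z))"
        unfolding diffq_cmult diffq_add ..
      also have "\<dots> = ennreal (\<bar>1/2\<bar> powr 2) * pint ?M 2 (\<lambda>z. diffq f z + diffq h z)"
        by (rule pint_cmult) measurable
      finally show ?thesis by (simp add: power2_eq_square)
    qed
    have fh: "gagliardo \<sigma> \<Omega> (\<lambda>x. (f x + h x) / 2) < \<infinity>"
      using fin(1)[OF C1c_cmult[OF C1c_add[OF f h], of "1/2"]] by (simp add: add_divide_distrib)
    have d: "gagliardo \<sigma> \<Omega> (\<lambda>x. f x - h x) < \<infinity>" by (rule fin(1)[OF C1c_diff[OF f h]])
    have "ennreal 4 * gagliardo \<sigma> \<Omega> (\<lambda>x. (f x + h x) / 2) = pint ?M 2 (\<lambda>z. diffq f z + diffq h z)"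
      unfolding mid mult.assoc[symmetric] by (subst ennreal_mult[symmetric]) auto
    then have "ennreal 4 * gagliardo \<sigma> \<Omega> (\<lambda>x. (f x + h x) / 2) + gagliardo \<sigma> \<Omega> (\<lambda>x. f x - h x)
       = 2 * (gagliardo \<sigma> \<Omega> f + gagliardo \<sigma> \<Omega> h)"
      using pint_parallelogram[of "diffq f" ?M "diffq h"] by (simp add: gagliardo_eq_pint diffq_diff)
    then have "enn2real (ennreal 4 * gagliardo \<sigma> \<Omega> (\<lambda>x. (f x + h x) / 2) + gagliardo \<sigma> \<Omega> (\<lambda>x. f x - h x))
       = enn2real (2 * (gagliardo \<sigma> \<Omega> f + gagliardo \<sigma> \<Omega> h))" by simp
    then have "4 * e (\<lambda>x. (f x + h x) / 2) + e (\<lambda>x. f x - h x) = 2 * (e f + e h)"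
      unfolding e_def using fh d fin(1)[OF f] fin(1)[OF h]
      by (simp add: enn2real_plus enn2real_mult ennreal_mult_less_top)
    then show ?thesis by simp
  qed
  define d where "d = (\<lambda>m. Inf (e ` K m))"
  have bb: "bdd_below (e ` K m)" for m using e0 by (intro bdd_belowI2[of _ 0]) auto
  have d_le: "d m \<le> e f" if "f \<in> K m" for m f unfolding d_def using that bb by (intro cInf_lower) auto
  have dB: "d m \<le> B" for m using d_le[OF \<phi>K] e\<phi> order_trans by blast
  have inc: "incseq d"
    unfolding incseq_def
  proof (intro allI impI)
    fix m l :: nat assume "m \<le> l"
    show "d m \<le> d l"
      unfolding d_def
    proof (rule cInf_greatest)
      show "e ` K l \<noteq> {}" using \<phi>K by blast
      fix x assume "x \<in> e ` K l"
      then obtain f where f: "f \<in> K l" "x = e f" by blast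
      then have "f \<in> K m" using tail_hull_antimono \<open>m \<le> l\<close> unfolding K_def by blast
      then show "Inf (e ` K m) \<le> x" using d_le f(2) unfolding d_def by blast
    qed
  qed
  obtain D where D: "d \<longlonglongrightarrow> D" "\<And>m. d m \<le> D"
    by (rule incseq_convergent[OF inc, of B]) (use dB in auto)
  have "\<exists>f\<in>K m. e f < d m + 1 / Suc m" for m
  proof -
    have "Inf (e ` K m) < d m + 1 / Suc m" unfolding d_def by simp
    then obtain y where "y \<in> e ` K m" "y < d m + 1 / Suc m"
      using cInf_lessD[of "e ` K m"] \<phi>K by blast
    then show ?thesis by blast
  qed
  then obtain v where v: "\<And>m. v m \<in> K m" "\<And>m. e (v m) < d m + 1 / Suc m" by metis
  have vC: "v m \<in> C1c \<Omega>" for m using KC v(1) by blast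
  have vm[measurable]: "v m \<in> borel_measurable borel" for m using vC by (rule C1c_borel_measurable)
  \<comment> \<open>The parallelogram law bounds the energy of \<open>v m - v l\<close> by
    \<open>2 * (d m + s) + 2 * (D + s) - 4 * d m\<close> with \<open>s = 1 / Suc m\<close>, because
    the midpoint still lies in the hull \<open>K m\<close> and has energy at least
    \<open>d m\<close>.\<close>
  define \<beta> where "\<beta> = (\<lambda>m. 2 * (D - d m) + 4 * (1 / real (Suc m)))"
  have "(\<lambda>m. \<beta> m) \<longlonglongrightarrow> 2 * (D - D) + 4 * 0"
    unfolding \<beta>_def by (intro tendsto_intros D(1) LIMSEQ_Suc[OF lim_1_over_n])
  then have \<beta>: "\<beta> \<longlonglongrightarrow> 0" by simp
  have \<beta>0: "\<beta> m \<ge> 0" for m unfolding \<beta>_def using D(2)[of m] by simp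
  have evl: "e (\<lambda>x. v m x - v l x) \<le> \<beta> m" if "m \<le> l" for m l
  proof -
    have "v l \<in> K m" using v(1)[of l] tail_hull_antimono that unfolding K_def by blast
    then have "(\<lambda>x. (v m x + v l x) / 2) \<in> K m" using v(1)[of m] unfolding K_def by (intro tail_hull.midpoint)
    then have "d m \<le> e (\<lambda>x. (v m x + v l x) / 2)" by (rule d_le)
    moreover have "1 / real (Suc l) \<le> 1 / real (Suc m)" using that by (simp add: frac_le)
    moreover have "2 * a + 2 * b - 4 * c \<le> 2 * (D - x) + 4 * s"
      if "x \<le> c" "s' \<le> s" "a < x + s" "b < y + s'" "y \<le> D" for a b c x y s s' :: real
      using that by (simp add: algebra_simps)
    ultimately show ?thesis
      unfolding par[OF vC vC] \<beta>_def using v(2)[of m] v(2)[of l] D(2)[of l] by blast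
  qed
  have limv: "AE x in dom_measure \<Omega>. (\<lambda>m. v m x) \<longlonglongrightarrow> g x"
    using lim by eventually_elim (rule tail_hull_tendsto[OF v(1)[unfolded K_def]])
  have gag: "gagliardo \<sigma> \<Omega> (\<lambda>x. v m x - g x) \<le> ennreal (\<beta> m)" for m
  proof -
    have "pint (pair_measure_kernel \<sigma> \<Omega>) 2 (diffq (\<lambda>x. v m x - g x)) \<le> ennreal (\<beta> m)"
    proof (rule pint_Fatou_bound[where f = "\<lambda>l. diffq (\<lambda>x. v m x - v l x)"])
      show "AE z in pair_measure_kernel \<sigma> \<Omega>. (\<lambda>l. diffq (\<lambda>x. v m x - v l x) z) \<longlonglongrightarrow> diffq (\<lambda>x. v m x - g x) z"
      proof (rule AE_pair_measure_kernel_diffq)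
        show "AE x in dom_measure \<Omega>. (\<lambda>l. v m x - v l x) \<longlonglongrightarrow> v m x - g x"
          using limv by eventually_elim (intro tendsto_intros)
      qed measurable
      show "eventually (\<lambda>l. pint (pair_measure_kernel \<sigma> \<Omega>) 2 (diffq (\<lambda>x. v m x - v l x)) \<le> ennreal (\<beta> m)) sequentially"
        using eventually_ge_at_top[of m]
      proof eventually_elim
        case (elim l)
        have "gagliardo \<sigma> \<Omega> (\<lambda>x. v m x - v l x) = ennreal (e (\<lambda>x. v m x - v l x))"
          unfolding e_def using fin(1)[OF C1c_diff[OF vC vC]] by simp
        also have "\<dots> \<le> ennreal (\<beta> m)" using evl[OF elim] by (rule ennreal_leI)
        finally show ?case by (simp add: gagliardo_eq_pint)
      qed
    qed (auto)
    then show ?thesis by (simp add: gagliardo_eq_pint)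
  qed
  \<comment> \<open>Energy differences control norm differences through the Sobolev inequality on
    \<Omega>. Here positivity of \<open>S\<close> is essential: it makes Cauchy sequences in energy
    converge in norm.\<close>
  have lp: "lp_pow ?q \<Omega> (\<lambda>x. v m x - g x) \<le> ennreal ((\<beta> m / S) powr (1 / ?\<theta>))" for m
  proof -
    have "pint (dom_measure \<Omega>) ?q (\<lambda>x. v m x - g x) \<le> ennreal ((\<beta> m / S) powr (1 / ?\<theta>))"
    proof (rule pint_Fatou_bound[where f = "\<lambda>l x. v m x - v l x"])
      show "AE x in dom_measure \<Omega>. (\<lambda>l. v m x - v l x) \<longlonglongrightarrow> v m x - g x"
        using limv by eventually_elim (intro tendsto_intros)
      show "eventually (\<lambda>l. pint (dom_measure \<Omega>) ?q (\<lambda>x. v m x - v l x) \<le> ennreal ((\<beta> m / S) powr (1 / ?\<theta>))) sequentially"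
        using eventually_ge_at_top[of m]
      proof eventually_elim
        case (elim l)
        let ?N = "enn2real (lp_pow ?q \<Omega> (\<lambda>x. v m x - v l x))"
        have "S * ?N powr ?\<theta> \<le> \<beta> m"
          using Sobolev_C1c[OF C1c_diff[OF vC vC] S(2), of m l] evl[OF elim] unfolding e_def by linarith
        then have "?N powr ?\<theta> \<le> \<beta> m / S" using S(1) by (simp add: pos_le_divide_eq mult.commute)
        then have "(?N powr ?\<theta>) powr (1 / ?\<theta>) \<le> (\<beta> m / S) powr (1 / ?\<theta>)"
          using divide_pos_pos[OF zero_less_one \<theta>] by (intro powr_mono2) auto
        moreover have "(?N powr ?\<theta>) powr (1 / ?\<theta>) = ?N"
        proof -
          have "t * (1 / t) = 1" if "t > 0" for t :: real using that by simp
          note this[OF \<theta>]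
          then show ?thesis by (simp only: powr_powr) simp
        qed
        ultimately have "ennreal ?N \<le> ennreal ((\<beta> m / S) powr (1 / ?\<theta>))" by (intro ennreal_leI) simp
        moreover have "ennreal ?N = lp_pow ?q \<Omega> (\<lambda>x. v m x - v l x)"
          using fin(2)[OF C1c_diff[OF vC vC]] by simp
        ultimately have "lp_pow ?q \<Omega> (\<lambda>x. v m x - v l x) \<le> ennreal ((\<beta> m / S) powr (1 / ?\<theta>))" by (simp only:)
        then show ?case by (simp add: lp_pow_eq_pint)
      qed
    qed (use q in auto)
    then show ?thesis by (simp add: lp_pow_eq_pint)
  qed
  show thesis
  proof (rule that[of v])
    show "(\<lambda>m. gagliardo \<sigma> \<Omega> (\<lambda>x. v m x - g x)) \<longlonglongrightarrow> 0"
      using gag \<beta> by (rule ennreal_tendsto_0I)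
    have "(\<lambda>m. (\<beta> m / S) powr (1 / ?\<theta>)) \<longlonglongrightarrow> (0 / S) powr (1 / ?\<theta>)"
      by (intro tendsto_powr' tendsto_divide \<beta> tendsto_const) (use divide_pos_pos[OF zero_less_one \<theta>] S \<beta>0 in auto)
    then show "(\<lambda>m. lp_pow ?q \<Omega> (\<lambda>x. v m x - g x)) \<longlonglongrightarrow> 0"
      using lp by (intro ennreal_tendsto_0I) auto
  qed (rule vC)
qed

text \<open>A number in \<open>[0, 1]\<close> does not decrease when raised to a positive power
  \<open>t \<le> 1\<close>; this is applied to the shares \<open>a / (a + b)\<close> and
  \<open>b / (a + b)\<close>.\<close>

lemma powr_add_le_concave:
  fixes a b t :: real
  assumes "a \<ge> 0" "b \<ge> 0" "0 < t" "t \<le> 1"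
  shows "(a + b) powr t \<le> a powr t + b powr t"
proof (cases "a + b = 0")
  case False
  then have s: "a + b > 0" using assms by simp
  have *: "x / (a + b) * (a + b) powr t \<le> x powr t" if "0 \<le> x" "x \<le> a + b" for x
  proof (cases "x = 0")
    case False
    have "(x / (a + b)) powr 1 \<le> (x / (a + b)) powr t"
      using that s assms False by (intro powr_mono') auto
    then have "(x / (a + b)) * (a + b) powr t \<le> (x / (a + b)) powr t * (a + b) powr t"
      using that s by (intro mult_right_mono) auto
    also have "\<dots> = x powr t" using that s by (simp add: powr_mult[symmetric])
    finally show ?thesis .
  qed simp
  have "(a + b) powr t = a / (a + b) * (a + b) powr t + b / (a + b) * (a + b) powr t"
    using s by (simp add: distrib_right[symmetric] add_divide_distrib[symmetric])
  also have "\<dots> \<le> a powr t + b powr t" using assms by (intro add_mono *) auto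
  finally show ?thesis .
qed simp

lemma lp_pow_two_tendsto_0:
  fixes \<Omega> :: "'a::euclidean_space set"
  assumes \<Omega>: "open \<Omega>" "bounded \<Omega>" and q: "q > 2" and hm[measurable]: "\<And>k. h k \<in> borel_measurable borel"
    and lim: "(\<lambda>k. lp_pow q \<Omega> (h k)) \<longlonglongrightarrow> 0"
  shows "(\<lambda>k. lp_pow 2 \<Omega> (h k)) \<longlonglongrightarrow> 0"
proof (rule order_tendstoI)
  have [measurable]: "\<Omega> \<in> sets borel" using \<Omega> by simp
  define mO where "mO = measure lborel \<Omega>"
  have mO: "emeasure lborel \<Omega> = ennreal mO" "mO \<ge> 0"
    using emeasure_bounded_finite[OF \<Omega>(2)] unfolding mO_def by (auto intro!: emeasure_eq_ennreal_measure)
  fix a :: ennreal assume "0 < a"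
  then obtain e' where e': "0 < e'" "e' < a" using dense by blast
  obtain e where e: "e > 0" "ennreal e < a"
  proof (cases e' rule: ennreal_cases)
    case (real t)
    then show thesis using that[of t] e' by simp
  next
    case top
    then show thesis using e'(2) by simp
  qed
  define d where "d = e / (2 * (mO + 1))"
  have d: "d > 0" "d * mO \<le> e / 2"
  proof -
    show "d > 0" using e mO by (simp add: d_def)
    then have "d * mO \<le> d * (mO + 1)" by simp
    also have "\<dots> = e / 2" using mO by (simp add: d_def field_simps)
    finally show "d * mO \<le> e / 2" .
  qed
  define c where "c = d powr ((2 - q) / 2)"
  have c: "c > 0" using d by (simp add: c_def)
  have "eventually (\<lambda>k. lp_pow q \<Omega> (h k) < ennreal (e / 2 / c)) sequentially"
    using lim e c by (intro order_tendstoD(2)) auto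
  then show "eventually (\<lambda>k. lp_pow 2 \<Omega> (h k) < a) sequentially"
  proof eventually_elim
    case (elim k)
    have "lp_pow 2 \<Omega> (h k) \<le> ennreal d * emeasure lborel \<Omega> + ennreal c * lp_pow q \<Omega> (h k)"
      unfolding c_def by (rule lp_pow_two_le[OF q d(1)]) measurable
    also have "\<dots> \<le> ennreal d * ennreal mO + ennreal c * ennreal (e / 2 / c)"
      unfolding mO(1) using elim by (intro add_left_mono mult_left_mono) auto
    also have "\<dots> = ennreal (d * mO + e / 2)"
      using d c e mO(2) by (simp add: ennreal_mult[symmetric] ennreal_plus[symmetric] del: ennreal_plus)
    also have "\<dots> \<le> ennreal e" using d(2) by (intro ennreal_leI) simp
    finally show ?case using e(2) by (rule le_less_trans)
  qed
qed simp

section \<open>Minimizing sequences\<close>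

lemma ennreal_tendsto_0_le:
  fixes x y :: "nat \<Rightarrow> ennreal"
  assumes "y \<longlonglongrightarrow> 0" "\<And>k. x k \<le> y k"
  shows "x \<longlonglongrightarrow> 0"
  by (rule tendsto_sandwich[OF _ _ tendsto_const assms(1)]) (auto simp: assms(2))

text \<open>Normalization is required only in the limit, so that the result covers both
  \<open>C1c\<close> approximants of a given minimizing sequence, whose energies merely tend to 1,
  and rescaled test functions. Minimality is encoded in the relation between \<open>S\<close> and
  \<open>P\<close>.\<close>

lemma C1c_minimizing_sequence_compact:
  fixes \<Omega> :: "'a::euclidean_space set"
  assumes n: "DIM('a) \<ge> 2" and \<sigma>: "0 < \<sigma>" "\<sigma> < 1" and \<Omega>: "open \<Omega>" "bounded \<Omega>" "C1_boundary \<Omega>" "\<Omega> \<noteq> {}"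
    and S: "0 < S" "S_const \<sigma> \<Omega> = ereal S" "S < S1" "ereal S1 \<le> S_const \<sigma> (half_space :: 'a set)"
    and \<phi>: "\<And>k. \<phi> k \<in> C1c \<Omega>" and E1: "(\<lambda>k. enn2real (gagliardo \<sigma> \<Omega> (\<phi> k))) \<longlonglongrightarrow> 1"
    and NP: "(\<lambda>k. enn2real (lp_pow (crit_exp DIM('a) \<sigma>) \<Omega> (\<phi> k))) \<longlonglongrightarrow> P"
    and P: "P > 0" "S * P powr ((real DIM('a) - 2 * \<sigma>) / real DIM('a)) = 1"
  obtains r :: "nat \<Rightarrow> nat" and g where "strict_mono r" "g \<in> H0 \<sigma> \<Omega>" "g \<in> borel_measurable borel"
    "(\<lambda>k. gagliardo \<sigma> \<Omega> (\<lambda>x. \<phi> (r k) x - g x)) \<longlonglongrightarrow> 0"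
    "lp_pow (crit_exp DIM('a) \<sigma>) \<Omega> g > 0" "ereal (sob_quot \<sigma> \<Omega> g) = S_const \<sigma> \<Omega>"
proof -
  let ?q = "crit_exp DIM('a) \<sigma>" and ?\<theta> = "(real DIM('a) - 2 * \<sigma>) / real DIM('a)"
  let ?M = "dom_measure \<Omega>" and ?K = "pair_measure_kernel \<sigma> \<Omega>"
  have \<theta>: "?\<theta> > 0" "?\<theta> \<le> 1" using n \<sigma> by auto
  have q2: "?q > 2" using n \<sigma> by (simp add: crit_exp_def field_simps)
  then have q: "?q > 0" "?q > 1" by auto
  have sn: "2 \<le> real DIM('a) + 2 * \<sigma>" using n \<sigma> by simp
  have \<Omega>m[measurable]: "\<Omega> \<in> sets borel" using \<Omega> by simp
  have S0: "ereal S \<le> S_const \<sigma> \<Omega>" using S(2) by simp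
  have finE: "gagliardo \<sigma> \<Omega> f < \<infinity>" and finN: "lp_pow ?q \<Omega> f < \<infinity>"
    if "f \<in> C1c \<Omega>" for f
    using gagliardo_C1c_finite[OF \<Omega>(1,2) \<sigma>(2) sn that] lp_pow_C1c_finite[OF \<Omega>(1,2) that] q by auto
  have "bounded (range (\<lambda>k. enn2real (gagliardo \<sigma> \<Omega> (\<phi> k))))" "bounded (range (\<lambda>k. enn2real (lp_pow ?q \<Omega> (\<phi> k))))"
    using convergent_imp_bounded E1 NP by blast+
  then obtain B1 B2 where "\<And>k. \<bar>enn2real (gagliardo \<sigma> \<Omega> (\<phi> k))\<bar> \<le> B1" "\<And>k. \<bar>enn2real (lp_pow ?q \<Omega> (\<phi> k))\<bar> \<le> B2"
    unfolding bounded_iff by auto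
  then have B12: "enn2real (gagliardo \<sigma> \<Omega> (\<phi> k)) \<le> max 0 (max B1 B2)" "enn2real (lp_pow ?q \<Omega> (\<phi> k)) \<le> max 0 (max B1 B2)" for k
    by (auto simp: le_max_iff_disj)
  define B where "B = max 0 (max B1 B2)"
  have B: "gagliardo \<sigma> \<Omega> (\<phi> k) \<le> ennreal B" "lp_pow ?q \<Omega> (\<phi> k) \<le> ennreal B" "B \<ge> 0" for k
  proof -
    have aux: "x \<le> ennreal b" if "enn2real x \<le> b" "x < \<infinity>" for x b
      using that by (metis ennreal_leI ennreal_enn2real infinity_ennreal_def)
    show "gagliardo \<sigma> \<Omega> (\<phi> k) \<le> ennreal B" "lp_pow ?q \<Omega> (\<phi> k) \<le> ennreal B"
      unfolding B_def by (rule aux[OF B12(1) finE[OF \<phi>]] aux[OF B12(2) finN[OF \<phi>]])+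
    show "B \<ge> 0" by (simp add: B_def)
  qed
  obtain r :: "nat \<Rightarrow> nat" and g where r: "strict_mono r" and gm[measurable]: "g \<in> borel_measurable borel"
    and lim: "AE x in ?M. (\<lambda>k. \<phi> (r k) x) \<longlonglongrightarrow> g x"
    and T: "(\<lambda>k. lp_pow 2 \<Omega> (\<lambda>x. \<phi> (r k) x - g x)) \<longlonglongrightarrow> 0"
    by (rule lp_pow_two_compactness[where \<phi> = \<phi>, OF \<Omega>(1,2) \<sigma>(1) q2 \<phi> B]) blast
  define f where "f = (\<lambda>k. \<phi> (r k))"
  have fC: "f k \<in> C1c \<Omega>" for k unfolding f_def by (rule \<phi>)
  have fm[measurable]: "f k \<in> borel_measurable borel" for k using fC by (rule C1c_borel_measurable)
  have fE: "(\<lambda>k. enn2real (gagliardo \<sigma> \<Omega> (f k))) \<longlonglongrightarrow> 1" and fN: "(\<lambda>k. enn2real (lp_pow ?q \<Omega> (f k))) \<longlonglongrightarrow> P"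
    using LIMSEQ_subseq_LIMSEQ[OF E1 r] LIMSEQ_subseq_LIMSEQ[OF NP r] by (auto simp: f_def o_def)
  have fT: "(\<lambda>k. lp_pow 2 \<Omega> (\<lambda>x. f k x - g x)) \<longlonglongrightarrow> 0" using T unfolding f_def .
  have flim: "AE x in ?M. (\<lambda>k. f k x) \<longlonglongrightarrow> g x" using lim unfolding f_def .
  obtain \<psi> where \<psi>C: "\<And>m. \<psi> m \<in> C1c \<Omega>" and \<psi>E: "(\<lambda>m. gagliardo \<sigma> \<Omega> (\<lambda>x. \<psi> m x - g x)) \<longlonglongrightarrow> 0"
    and \<psi>N: "(\<lambda>m. lp_pow ?q \<Omega> (\<lambda>x. \<psi> m x - g x)) \<longlonglongrightarrow> 0"
    by (rule C1c_approximation_of_limit[where \<phi> = f and g = g, OF n \<sigma> \<Omega>(1,2) S(1) S0 fC _ B(3) gm flim])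
      (use B(1) in \<open>auto simp: f_def\<close>)
  have \<psi>m[measurable]: "\<psi> k \<in> borel_measurable borel" for k using \<psi>C by (rule C1c_borel_measurable)
  define ag where "ag = enn2real (lp_pow ?q \<Omega> g)"
  define eg where "eg = enn2real (gagliardo \<sigma> \<Omega> g)"
  note BLN = Brezis_Lieb[where f = f and g = g and M = ?M and P = P, OF q(2)]
  have gN: "lp_pow ?q \<Omega> g < \<infinity>" and BN: "(\<lambda>k. enn2real (lp_pow ?q \<Omega> (\<lambda>x. f k x - g x))) \<longlonglongrightarrow> P - ag"
  proof -
    have 1: "pint ?M ?q (f k) < \<infinity>" for k using finN[OF fC] by (simp add: lp_pow_eq_pint)
    have 2: "(\<lambda>k. enn2real (pint ?M ?q (f k))) \<longlonglongrightarrow> P" using fN by (simp add: lp_pow_eq_pint)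
    show "lp_pow ?q \<Omega> g < \<infinity>"
      using BLN(1)[OF _ _ 1 flim 2] by (simp add: lp_pow_eq_pint)
    show "(\<lambda>k. enn2real (lp_pow ?q \<Omega> (\<lambda>x. f k x - g x))) \<longlonglongrightarrow> P - ag"
      using BLN(2)[OF _ _ 1 flim 2] by (simp add: lp_pow_eq_pint ag_def)
  qed
  have two: "(1::real) < 2" by simp
  note BLE = Brezis_Lieb[where f = "\<lambda>k. diffq (f k)" and g = "diffq g" and M = ?K and P = 1, OF two]
  have gE: "gagliardo \<sigma> \<Omega> g < \<infinity>" and BE: "(\<lambda>k. enn2real (gagliardo \<sigma> \<Omega> (\<lambda>x. f k x - g x))) \<longlonglongrightarrow> 1 - eg"
  proof -
    have 1: "pint ?K 2 (diffq (f k)) < \<infinity>" for k using finE[OF fC] by (simp add: gagliardo_eq_pint)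
    have 2: "(\<lambda>k. enn2real (pint ?K 2 (diffq (f k)))) \<longlonglongrightarrow> 1" using fE by (simp add: gagliardo_eq_pint)
    have 3: "AE z in ?K. (\<lambda>k. diffq (f k) z) \<longlonglongrightarrow> diffq g z"
      by (rule AE_pair_measure_kernel_diffq[OF _ _ _ flim]) measurable
    show "gagliardo \<sigma> \<Omega> g < \<infinity>"
      using BLE(1)[OF _ _ 1 3 2] by (simp add: gagliardo_eq_pint)
    show "(\<lambda>k. enn2real (gagliardo \<sigma> \<Omega> (\<lambda>x. f k x - g x))) \<longlonglongrightarrow> 1 - eg"
      using BLE(2)[OF _ _ 1 3 2] by (simp add: gagliardo_eq_pint diffq_diff eg_def)
  qed
  have pertN: "(\<lambda>k. enn2real (lp_pow ?q \<Omega> (h k))) \<longlonglongrightarrow> l"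
    if [measurable]: "\<And>k. h k \<in> borel_measurable borel" "\<And>k. h' k \<in> borel_measurable borel"
      and "\<And>k. lp_pow ?q \<Omega> (h k) < \<infinity>" "\<And>k. lp_pow ?q \<Omega> (h' k) < \<infinity>"
      "(\<lambda>k. lp_pow ?q \<Omega> (\<lambda>x. h k x - h' k x)) \<longlonglongrightarrow> 0" "(\<lambda>k. enn2real (lp_pow ?q \<Omega> (h' k))) \<longlonglongrightarrow> l" for h h' l
    using pint_tendsto_perturb[OF q(2), of h ?M h' l] that by (simp add: lp_pow_eq_pint)
  have pertE: "(\<lambda>k. enn2real (gagliardo \<sigma> \<Omega> (h k))) \<longlonglongrightarrow> l"
    if [measurable]: "\<And>k. h k \<in> borel_measurable borel" "\<And>k. h' k \<in> borel_measurable borel"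
      and "\<And>k. gagliardo \<sigma> \<Omega> (h k) < \<infinity>" "\<And>k. gagliardo \<sigma> \<Omega> (h' k) < \<infinity>"
      "(\<lambda>k. gagliardo \<sigma> \<Omega> (\<lambda>x. h k x - h' k x)) \<longlonglongrightarrow> 0" "(\<lambda>k. enn2real (gagliardo \<sigma> \<Omega> (h' k))) \<longlonglongrightarrow> l" for h h' l
    using pint_tendsto_perturb[OF two, of "\<lambda>k. diffq (h k)" ?K "\<lambda>k. diffq (h' k)" l] that
    by (simp add: gagliardo_eq_pint diffq_diff)
  have subN: "lp_pow ?q \<Omega> (\<lambda>x. h x - g x) < \<infinity>" if "h \<in> C1c \<Omega>" for h
    using pint_diff_finite[OF q(2), of h ?M g] finN[OF that] gN C1c_borel_measurable[OF that]
    by (simp add: lp_pow_eq_pint)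
  have subE: "gagliardo \<sigma> \<Omega> (\<lambda>x. h x - g x) < \<infinity>" if "h \<in> C1c \<Omega>" for h
    using pint_diff_finite[OF two, of "diffq h" ?K "diffq g"] finE[OF that] gE C1c_borel_measurable[OF that]
    by (simp add: gagliardo_eq_pint diffq_diff)
  have symN: "lp_pow s \<Omega> (\<lambda>x. a x - b x) = lp_pow s \<Omega> (\<lambda>x. b x - a x)" for s a b
    by (simp add: lp_pow_def abs_minus_commute)
  have symE: "gagliardo \<sigma> \<Omega> (\<lambda>x. a x - b x) = gagliardo \<sigma> \<Omega> (\<lambda>x. b x - a x)" for a b
  proof -
    have "((a x - b x) - (a y - b y))\<^sup>2 = ((b x - a x) - (b y - a y))\<^sup>2" for x y
      by (simp add: power2_eq_square algebra_simps)
    then show ?thesis unfolding gagliardo_def by simp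
  qed
  \<comment> \<open>The inequality is known for \<open>C1c\<close> only and reaches the limit
    function through its approximants \<open>\<psi> k\<close>, whose norms and energies
    converge.\<close>
  have A: "S * ag powr ?\<theta> \<le> eg"
  proof -
    have 1: "(\<lambda>k. enn2real (lp_pow ?q \<Omega> (\<psi> k))) \<longlonglongrightarrow> ag"
      by (rule pertN[where h' = "\<lambda>k. g"]) (use finN[OF \<psi>C] gN \<psi>N in \<open>auto simp: ag_def\<close>)
    have 2: "(\<lambda>k. enn2real (gagliardo \<sigma> \<Omega> (\<psi> k))) \<longlonglongrightarrow> eg"
      by (rule pertE[where h' = "\<lambda>k. g"]) (use finE[OF \<psi>C] gE \<psi>E in \<open>auto simp: eg_def\<close>)
    have 3: "(\<lambda>k. S * enn2real (lp_pow ?q \<Omega> (\<psi> k)) powr ?\<theta>) \<longlonglongrightarrow> S * ag powr ?\<theta>"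
      by (intro tendsto_mult tendsto_powr' 1 tendsto_const) (use \<theta> in auto)
    show ?thesis
      by (rule LIMSEQ_le[OF 3 2]) (use Sobolev_C1c[OF \<psi>C S0] in auto)
  qed
  \<comment> \<open>Strictly below \<open>S1\<close>, to leave room for the charts, and strictly
    above \<open>S\<close>, to make the final comparison strict.\<close>
  define S2 where "S2 = (S + S1) / 2"
  have S2: "0 < S2" "S2 < S1" "S < S2" using S by (auto simp: S2_def)
  obtain C where C: "C \<ge> 0" "\<And>u. u \<in> C1c \<Omega> \<Longrightarrow>
     S2 * enn2real (lp_pow ?q \<Omega> u) powr ?\<theta> \<le> enn2real (gagliardo \<sigma> \<Omega> u) + C * enn2real (lp_pow 2 \<Omega> u)"
    by (rule refined_Sobolev[OF n \<sigma> \<Omega> S2(1,2) S(4)]) blast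
  \<comment> \<open>The remainder \<open>f k - g\<close> need not lie in \<open>C1c\<close>, but
    \<open>f k - \<psi> k\<close> does and differs from it by quantities vanishing in energy, norm
    and square norm. In the limit the square-norm term drops out.\<close>
  have B': "S2 * (P - ag) powr ?\<theta> \<le> 1 - eg"
  proof -
    have wC: "(\<lambda>x. f k x - \<psi> k x) \<in> C1c \<Omega>" for k by (rule C1c_diff[OF fC \<psi>C])
    have 1: "(\<lambda>k. enn2real (lp_pow ?q \<Omega> (\<lambda>x. f k x - \<psi> k x))) \<longlonglongrightarrow> P - ag"
      by (rule pertN[where h' = "\<lambda>k x. f k x - g x"])
        (use finN[OF wC] subN[OF fC] \<psi>N BN symN[of ?q g] in auto)
    have 2: "(\<lambda>k. enn2real (gagliardo \<sigma> \<Omega> (\<lambda>x. f k x - \<psi> k x))) \<longlonglongrightarrow> 1 - eg"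
      by (rule pertE[where h' = "\<lambda>k x. f k x - g x"])
        (use finE[OF wC] subE[OF fC] \<psi>E BE symE[of g] in auto)
    have 3: "(\<lambda>k. enn2real (lp_pow 2 \<Omega> (\<lambda>x. f k x - \<psi> k x))) \<longlonglongrightarrow> 0"
    proof -
      have t: "(\<lambda>k. lp_pow 2 \<Omega> (\<lambda>x. \<psi> k x - g x)) \<longlonglongrightarrow> 0"
        by (rule lp_pow_two_tendsto_0[OF \<Omega>(1,2) q2 _ \<psi>N]) measurable
      have le: "lp_pow 2 \<Omega> (\<lambda>x. f k x - \<psi> k x) \<le> 2 * (lp_pow 2 \<Omega> (\<lambda>x. f k x - g x) + lp_pow 2 \<Omega> (\<lambda>x. \<psi> k x - g x))" for k
      proof -
        have "pint ?M 2 (\<lambda>x. (f k x - g x) - (\<psi> k x - g x)) \<le> 2 * (pint ?M 2 (\<lambda>x. f k x - g x) + pint ?M 2 (\<lambda>x. \<psi> k x - g x))"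
          by (subst pint_parallelogram[symmetric]) auto
        then show ?thesis by (simp add: lp_pow_eq_pint)
      qed
      have "(\<lambda>k. 2 * (lp_pow 2 \<Omega> (\<lambda>x. f k x - g x) + lp_pow 2 \<Omega> (\<lambda>x. \<psi> k x - g x))) \<longlonglongrightarrow> 2 * (0 + 0)"
        by (intro ennreal_tendsto_cmult tendsto_add fT t) auto
      then have "(\<lambda>k. lp_pow 2 \<Omega> (\<lambda>x. f k x - \<psi> k x)) \<longlonglongrightarrow> 0"
        unfolding add_0_right mult_zero_right by (rule ennreal_tendsto_0_le[OF _ le])
      then show ?thesis by (intro tendsto_enn2real) auto
    qed
    have 4: "(\<lambda>k. S2 * enn2real (lp_pow ?q \<Omega> (\<lambda>x. f k x - \<psi> k x)) powr ?\<theta>) \<longlonglongrightarrow> S2 * (P - ag) powr ?\<theta>"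
      by (intro tendsto_mult tendsto_powr' 1 tendsto_const) (use \<theta> in auto)
    have 5: "(\<lambda>k. enn2real (gagliardo \<sigma> \<Omega> (\<lambda>x. f k x - \<psi> k x)) + C * enn2real (lp_pow 2 \<Omega> (\<lambda>x. f k x - \<psi> k x))) \<longlonglongrightarrow> (1 - eg) + C * 0"
      by (intro tendsto_add tendsto_mult 2 3 tendsto_const)
    have "S2 * (P - ag) powr ?\<theta> \<le> (1 - eg) + C * 0"
      by (rule LIMSEQ_le[OF 4 5]) (use C(2)[OF wC] in auto)
    then show ?thesis by simp
  qed
  have b0: "P - ag \<ge> 0" using BN by (rule LIMSEQ_le_const) auto
  have e0: "1 - eg \<ge> 0" using BE by (rule LIMSEQ_le_const) auto
  have ag0: "ag \<ge> 0" by (simp add: ag_def)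
  \<comment> \<open>If mass were left in the remainder, replacing \<open>S\<close> by the larger
    \<open>S2\<close> there would be a strict gain, and the two parts together would need energy
    more than the available 1.\<close>
  have agP: "ag = P"
  proof (rule ccontr)
    assume "ag \<noteq> P"
    then have pos: "(P - ag) powr ?\<theta> > 0" using b0 by simp
    have "1 = S * (ag + (P - ag)) powr ?\<theta>" using P(2) by simp
    also have "\<dots> \<le> S * (ag powr ?\<theta> + (P - ag) powr ?\<theta>)"
      using S(1) by (intro mult_left_mono powr_add_le_concave[OF ag0 b0 \<theta>]) auto
    also have "\<dots> = S * ag powr ?\<theta> + S * (P - ag) powr ?\<theta>" by (rule distrib_left)
    also have "\<dots> < S * ag powr ?\<theta> + S2 * (P - ag) powr ?\<theta>" using pos S2(3) by simp
    also have "\<dots> \<le> eg + (1 - eg)" using A B' by (rule add_mono)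
    finally show False by simp
  qed
  \<comment> \<open>With no mass lost, \<open>A\<close> reads \<open>1 \<le> eg\<close>. The
    remainder energy \<open>1 - eg\<close> is therefore 0, which upgrades pointwise convergence to
    convergence in energy.\<close>
  have eg1: "eg = 1" using A e0 P(2) unfolding agP by simp
  show thesis
  proof (rule that[OF r])
    show "g \<in> borel_measurable borel" by (rule gm)
    have "(\<lambda>x. indicator \<Omega> x * g x) \<in> borel_measurable lborel" by measurable
    then show "g \<in> H0 \<sigma> \<Omega>" unfolding H0_def using gN \<psi>C \<psi>E \<psi>N by blast
    have "(\<lambda>k. ennreal (enn2real (gagliardo \<sigma> \<Omega> (\<lambda>x. f k x - g x)))) \<longlonglongrightarrow> ennreal (1 - eg)"
      using BE by (rule tendsto_ennrealI)
    then show "(\<lambda>k. gagliardo \<sigma> \<Omega> (\<lambda>x. \<phi> (r k) x - g x)) \<longlonglongrightarrow> 0"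
      using subE[OF fC] by (simp add: eg1 f_def)
    show "lp_pow ?q \<Omega> g > 0" using agP P(1) unfolding ag_def by (metis enn2real_0 less_irrefl not_gr_zero)
    have "sob_quot \<sigma> \<Omega> g = 1 / P powr ?\<theta>"
      unfolding sob_quot_def by (simp only: ag_def[symmetric] eg_def[symmetric] agP eg1)
    also have "\<dots> = S"
    proof -
      have "P powr ?\<theta> \<noteq> 0" using P(2) by auto
      then show ?thesis using P(2) by (simp only: divide_eq_eq) simp
    qed
    finally show "ereal (sob_quot \<sigma> \<Omega> g) = S_const \<sigma> \<Omega>" using S(2) by simp
  qed
qed

theorem theorem1p4:
  fixes \<sigma> :: real and \<Omega> :: "'a::euclidean_space set"
  assumes "DIM('a) \<ge> 2"
    and "1/2 \<le> \<sigma>" and "\<sigma> < 1"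
    and "open \<Omega>" and "bounded \<Omega>" and "C1_boundary \<Omega>"
    and "0 < S_const \<sigma> \<Omega>" and "S_const \<sigma> \<Omega> < S_const \<sigma> (half_space :: 'a set)"
  shows "(\<forall>u :: nat \<Rightarrow> 'a \<Rightarrow> real.
            (\<forall>k. u k \<in> H0 \<sigma> \<Omega> \<and> lp_pow (crit_exp DIM('a) \<sigma>) \<Omega> (u k) > 0
                 \<and> gagliardo \<sigma> \<Omega> (u k) = 1) \<and>
            (\<lambda>k. ereal (sob_quot \<sigma> \<Omega> (u k))) \<longlonglongrightarrow> S_const \<sigma> \<Omega>
            \<longrightarrow> (\<forall>r :: nat \<Rightarrow> nat. strict_mono r \<longrightarrow> (\<exists>(r' :: nat \<Rightarrow> nat) v. strict_mono r' \<and> v \<in> H0 \<sigma> \<Omega> \<and>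
                   (\<lambda>k. gagliardo \<sigma> \<Omega> (\<lambda>x. u (r (r' k)) x - v x)) \<longlonglongrightarrow> 0)))
       \<and> (\<exists>v \<in> H0 \<sigma> \<Omega>. lp_pow (crit_exp DIM('a) \<sigma>) \<Omega> v > 0 \<and>
              ereal (sob_quot \<sigma> \<Omega> v) = S_const \<sigma> \<Omega>)"
proof -
  let ?q = "crit_exp DIM('a) \<sigma>" and ?\<theta> = "(real DIM('a) - 2 * \<sigma>) / real DIM('a)"
  note n = assms(1)
  have \<sigma>: "0 < \<sigma>" "\<sigma> < 1" using assms by auto
  note \<Omega> = assms(4-6)
  have \<theta>: "?\<theta> > 0" using n \<sigma> by auto
  have \<theta>1: "1 / ?\<theta> > 0" using \<theta> by (rule divide_pos_pos[OF zero_less_one])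
  have "t * (1 / t) = 1" "(1 / t) * t = 1" if "t > 0" for t :: real using that by auto
  note \<theta>\<theta> = this[OF \<theta>]
  have q\<theta>: "?q * ?\<theta> = 2" using n \<sigma> by (simp add: crit_exp_def field_simps)
  have q: "?q > 1" using n \<sigma> by (simp add: crit_exp_def field_simps)
  have sn: "2 \<le> real DIM('a) + 2 * \<sigma>" using n \<sigma> by simp
  have \<Omega>m[measurable]: "\<Omega> \<in> sets borel" using \<Omega> by simp
  have two: "(1::real) < 2" by simp
  obtain S where S: "S_const \<sigma> \<Omega> = ereal S" "S > 0"
    using assms(7,8) by (cases "S_const \<sigma> \<Omega>") auto
  obtain S1 where S1: "S < S1" "ereal S1 \<le> S_const \<sigma> (half_space :: 'a set)"
    using ereal_dense2[OF assms(8)] S by (auto intro: less_imp_le)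
  \<comment> \<open>On the empty set there are no competitors and the infimum is infinite.\<close>
  have ne: "\<Omega> \<noteq> {}"
  proof
    assume "\<Omega> = {}"
    then have "{u \<in> C1c \<Omega>. \<exists>x. u x \<noteq> 0} = {}" using C1c_zero_outside by blast
    then have "S_const \<sigma> \<Omega> = top" unfolding S_const_def by (simp only: INF_empty)
    then show False using S(1) by (simp add: top_ereal_def)
  qed
  have finE: "gagliardo \<sigma> \<Omega> f < \<infinity>" and finN: "lp_pow ?q \<Omega> f < \<infinity>" if "f \<in> C1c \<Omega>" for f
    using gagliardo_C1c_finite[OF \<Omega>(1,2) \<sigma>(2) sn that] lp_pow_C1c_finite[OF \<Omega>(1,2) that] q by auto
  \<comment> \<open>The norm integral forced on a function with energy 1 and quotient
    \<open>S\<close>.\<close>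
  define P where "P = (1 / S) powr (1 / ?\<theta>)"
  have P: "P > 0" "S * P powr ?\<theta> = 1"
    using S(2) unfolding P_def powr_powr \<theta>\<theta>(2) by auto
  note compact = C1c_minimizing_sequence_compact[OF n \<sigma> \<Omega> ne S(2,1) S1, where P = P, OF _ _ _ P]
  have limP: "x \<longlonglongrightarrow> P" if "\<And>k. x k \<ge> 0" "(\<lambda>k. 1 / x k powr ?\<theta>) \<longlonglongrightarrow> S" for x :: "nat \<Rightarrow> real"
  proof -
    have "(\<lambda>k. (1 / (1 / x k powr ?\<theta>)) powr (1 / ?\<theta>)) \<longlonglongrightarrow> (1 / S) powr (1 / ?\<theta>)"
      using S(2) \<theta>1 by (intro tendsto_powr' tendsto_divide that(2) tendsto_const) auto
    moreover have "(1 / (1 / x k powr ?\<theta>)) powr (1 / ?\<theta>) = x k" for k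
    proof -
      \<comment> \<open>Double inversion is the identity even if \<open>x k = 0\<close>, by the
        convention for division by zero.\<close>
      have "1 / (1 / x k powr ?\<theta>) = x k powr ?\<theta>" by simp
      then have "(1 / (1 / x k powr ?\<theta>)) powr (1 / ?\<theta>) = (x k powr ?\<theta>) powr (1 / ?\<theta>)" by (simp only:)
      also have "\<dots> = x k" using that(1)[of k] by (simp only: powr_powr \<theta>\<theta>(1)) simp
      finally show ?thesis .
    qed
    ultimately show ?thesis unfolding P_def by simp
  qed
  have part1: "\<exists>(r' :: nat \<Rightarrow> nat) v. strict_mono r' \<and> v \<in> H0 \<sigma> \<Omega> \<and>
                   (\<lambda>k. gagliardo \<sigma> \<Omega> (\<lambda>x. u (r' k) x - v x)) \<longlonglongrightarrow> 0"
    if u: "\<And>k. u k \<in> H0 \<sigma> \<Omega>" "\<And>k. gagliardo \<sigma> \<Omega> (u k) = 1"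
      and quot: "(\<lambda>k. ereal (sob_quot \<sigma> \<Omega> (u k))) \<longlonglongrightarrow> S_const \<sigma> \<Omega>" for u :: "nat \<Rightarrow> 'a \<Rightarrow> real"
  proof -
    \<comment> \<open>Membership in \<open>H0\<close> gives measurability only after multiplication
      by the indicator. Extension by zero is Borel on the whole space and changes none of the
      integrals over \<Omega>.\<close>
    define w where "w = (\<lambda>k x. indicator \<Omega> x * u k x)"
    have wm[measurable]: "w k \<in> borel_measurable borel" for k
      using u(1)[of k] unfolding H0_def w_def by simp
    have wu: "w k x = u k x" if "x \<in> \<Omega>" for k x using that by (simp add: w_def)
    have wE: "gagliardo \<sigma> \<Omega> (w k) = 1" for k using gagliardo_cong[of \<Omega> "w k" "u k"] wu u(2) by simp
    have wNu: "lp_pow ?q \<Omega> (w k) = lp_pow ?q \<Omega> (u k)" for k by (rule lp_pow_cong) (rule wu)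
    have wN: "lp_pow ?q \<Omega> (w k) < \<infinity>" for k using u(1)[of k] unfolding wNu H0_def by blast
    \<comment> \<open>The k-th element is traded for a test function at distance at most
      \<open>1 / Suc k\<close> in both senses. Energies then tend to 1 without being 1, which the
      compactness result allows.\<close>
    have "\<exists>\<phi>\<in>C1c \<Omega>. gagliardo \<sigma> \<Omega> (\<lambda>x. \<phi> x - w k x) \<le> ennreal (1 / Suc k) \<and> lp_pow ?q \<Omega> (\<lambda>x. \<phi> x - w k x) \<le> ennreal (1 / Suc k)" for k
    proof -
      obtain \<phi> where \<phi>: "\<And>j. \<phi> j \<in> C1c \<Omega>" "(\<lambda>j. gagliardo \<sigma> \<Omega> (\<lambda>x. \<phi> j x - u k x)) \<longlonglongrightarrow> 0"
         "(\<lambda>j. lp_pow ?q \<Omega> (\<lambda>x. \<phi> j x - u k x)) \<longlonglongrightarrow> 0"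
        using u(1)[of k] unfolding H0_def by blast
      have p: "0 < ennreal (1 / Suc k)" by simp
      obtain j where j: "gagliardo \<sigma> \<Omega> (\<lambda>x. \<phi> j x - u k x) < ennreal (1 / Suc k)" "lp_pow ?q \<Omega> (\<lambda>x. \<phi> j x - u k x) < ennreal (1 / Suc k)"
        using eventually_happens'[OF sequentially_bot eventually_conj[OF order_tendstoD(2)[OF \<phi>(2) p] order_tendstoD(2)[OF \<phi>(3) p]]] by blast
      have "gagliardo \<sigma> \<Omega> (\<lambda>x. \<phi> j x - w k x) = gagliardo \<sigma> \<Omega> (\<lambda>x. \<phi> j x - u k x)"
        "lp_pow ?q \<Omega> (\<lambda>x. \<phi> j x - w k x) = lp_pow ?q \<Omega> (\<lambda>x. \<phi> j x - u k x)"
        by (intro gagliardo_cong lp_pow_cong; simp add: wu)+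
      then have "gagliardo \<sigma> \<Omega> (\<lambda>x. \<phi> j x - w k x) \<le> ennreal (1 / Suc k)" "lp_pow ?q \<Omega> (\<lambda>x. \<phi> j x - w k x) \<le> ennreal (1 / Suc k)"
        using j by (simp_all only: less_imp_le)
      then show ?thesis using \<phi>(1) by blast
    qed
    then have "\<forall>k. \<exists>\<phi>. \<phi> \<in> C1c \<Omega> \<and> gagliardo \<sigma> \<Omega> (\<lambda>x. \<phi> x - w k x) \<le> ennreal (1 / Suc k) \<and> lp_pow ?q \<Omega> (\<lambda>x. \<phi> x - w k x) \<le> ennreal (1 / Suc k)"
      by blast
    from choice[OF this] obtain \<phi> where \<phi>: "\<forall>k. \<phi> k \<in> C1c \<Omega> \<and> gagliardo \<sigma> \<Omega> (\<lambda>x. \<phi> k x - w k x) \<le> ennreal (1 / Suc k) \<and> lp_pow ?q \<Omega> (\<lambda>x. \<phi> k x - w k x) \<le> ennreal (1 / Suc k)"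
      by blast
    then have \<phi>C: "\<And>k. \<phi> k \<in> C1c \<Omega>" and \<phi>E: "\<And>k. gagliardo \<sigma> \<Omega> (\<lambda>x. \<phi> k x - w k x) \<le> ennreal (1 / Suc k)"
      and \<phi>N: "\<And>k. lp_pow ?q \<Omega> (\<lambda>x. \<phi> k x - w k x) \<le> ennreal (1 / Suc k)" by blast+
    have \<phi>m[measurable]: "\<phi> k \<in> borel_measurable borel" for k using \<phi>C by (rule C1c_borel_measurable)
    have lim1: "(\<lambda>m. 1 / real (Suc m)) \<longlonglongrightarrow> 0" by (rule LIMSEQ_Suc[OF lim_1_over_n])
    have dE: "(\<lambda>k. gagliardo \<sigma> \<Omega> (\<lambda>x. \<phi> k x - w k x)) \<longlonglongrightarrow> 0" by (rule ennreal_tendsto_0I[OF \<phi>E lim1])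
    have dN: "(\<lambda>k. lp_pow ?q \<Omega> (\<lambda>x. \<phi> k x - w k x)) \<longlonglongrightarrow> 0" by (rule ennreal_tendsto_0I[OF \<phi>N lim1])
    have E1: "(\<lambda>k. enn2real (gagliardo \<sigma> \<Omega> (\<phi> k))) \<longlonglongrightarrow> 1"
    proof -
      have "(\<lambda>k. enn2real (pint (pair_measure_kernel \<sigma> \<Omega>) 2 (diffq (\<phi> k)))) \<longlonglongrightarrow> 1"
        by (rule pint_tendsto_perturb[OF two, where g = "\<lambda>k. diffq (w k)"])
          (use finE[OF \<phi>C] wE dE in \<open>auto simp: gagliardo_eq_pint diffq_diff\<close>)
      then show ?thesis by (simp add: gagliardo_eq_pint)
    qed
    have NP: "(\<lambda>k. enn2real (lp_pow ?q \<Omega> (\<phi> k))) \<longlonglongrightarrow> P"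
    proof -
      have "(\<lambda>k. sob_quot \<sigma> \<Omega> (u k)) \<longlonglongrightarrow> S" using quot unfolding S(1) by simp
      moreover have "sob_quot \<sigma> \<Omega> (u k) = 1 / enn2real (lp_pow ?q \<Omega> (w k)) powr ?\<theta>" for k
        unfolding sob_quot_def wNu u(2) by simp
      ultimately have "(\<lambda>k. enn2real (lp_pow ?q \<Omega> (w k))) \<longlonglongrightarrow> P" by (intro limP) auto
      then have "(\<lambda>k. enn2real (pint (dom_measure \<Omega>) ?q (\<phi> k))) \<longlonglongrightarrow> P"
        by (intro pint_tendsto_perturb[OF q, where g = w and f = \<phi>])
          (use finN[OF \<phi>C] wN dN in \<open>auto simp: lp_pow_eq_pint\<close>)
      then show ?thesis by (simp add: lp_pow_eq_pint)
    qed
    obtain r' :: "nat \<Rightarrow> nat" and g where r': "strict_mono r'" and gH: "g \<in> H0 \<sigma> \<Omega>" and gm[measurable]: "g \<in> borel_measurable borel"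
      and lim: "(\<lambda>k. gagliardo \<sigma> \<Omega> (\<lambda>x. \<phi> (r' k) x - g x)) \<longlonglongrightarrow> 0"
      by (rule compact[OF \<phi>C E1 NP]) blast
    have le: "gagliardo \<sigma> \<Omega> (\<lambda>x. u (r' k) x - g x) \<le> 2 * (gagliardo \<sigma> \<Omega> (\<lambda>x. \<phi> (r' k) x - g x) + gagliardo \<sigma> \<Omega> (\<lambda>x. \<phi> (r' k) x - w (r' k) x))" for k
    proof -
      have "gagliardo \<sigma> \<Omega> (\<lambda>x. u (r' k) x - g x) = gagliardo \<sigma> \<Omega> (\<lambda>x. (\<phi> (r' k) x - g x) - (\<phi> (r' k) x - w (r' k) x))"
        by (rule gagliardo_cong) (simp add: wu)
      also have "\<dots> \<le> 2 * (gagliardo \<sigma> \<Omega> (\<lambda>x. \<phi> (r' k) x - g x) + gagliardo \<sigma> \<Omega> (\<lambda>x. \<phi> (r' k) x - w (r' k) x))"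
        by (rule gagliardo_diff_le) measurable
      finally show ?thesis .
    qed
    have "(\<lambda>k. 2 * (gagliardo \<sigma> \<Omega> (\<lambda>x. \<phi> (r' k) x - g x) + gagliardo \<sigma> \<Omega> (\<lambda>x. \<phi> (r' k) x - w (r' k) x))) \<longlonglongrightarrow> 2 * (0 + 0)"
      by (intro ennreal_tendsto_cmult tendsto_add lim LIMSEQ_subseq_LIMSEQ[OF dE r', unfolded o_def]) auto
    then have "(\<lambda>k. gagliardo \<sigma> \<Omega> (\<lambda>x. u (r' k) x - g x)) \<longlonglongrightarrow> 0"
      unfolding add_0_right mult_zero_right by (rule ennreal_tendsto_0_le[OF _ le])
    then show ?thesis using r' gH by blast
  qed
  have part2: "\<exists>v \<in> H0 \<sigma> \<Omega>. lp_pow ?q \<Omega> v > 0 \<and> ereal (sob_quot \<sigma> \<Omega> v) = S_const \<sigma> \<Omega>"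
  proof -
    have "\<exists>\<phi>\<in>C1c \<Omega>. S \<le> sob_quot \<sigma> \<Omega> \<phi> \<and> sob_quot \<sigma> \<Omega> \<phi> < S + 1 / Suc k" for k
    proof -
      have "S_const \<sigma> \<Omega> < ereal (S + 1 / Suc k)" using S(1) by simp
      then obtain \<phi> where \<phi>: "\<phi> \<in> C1c \<Omega>" "\<exists>x. \<phi> x \<noteq> 0" "ereal (sob_quot \<sigma> \<Omega> \<phi>) < ereal (S + 1 / Suc k)"
        unfolding S_const_def by (auto simp: INF_less_iff)
      moreover have "S_const \<sigma> \<Omega> \<le> ereal (sob_quot \<sigma> \<Omega> \<phi>)"
        unfolding S_const_def by (rule INF_lower) (use \<phi> in auto)
      ultimately show ?thesis using S(1) by auto
    qed
    then obtain \<phi> where \<phi>C: "\<And>k. \<phi> k \<in> C1c \<Omega>" and \<phi>q: "\<And>k. S \<le> sob_quot \<sigma> \<Omega> (\<phi> k)" "\<And>k. sob_quot \<sigma> \<Omega> (\<phi> k) < S + 1 / Suc k"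
      by metis
    have \<phi>m[measurable]: "\<phi> k \<in> borel_measurable borel" for k using \<phi>C by (rule C1c_borel_measurable)
    have lq: "(\<lambda>k. sob_quot \<sigma> \<Omega> (\<phi> k)) \<longlonglongrightarrow> S"
    proof (rule tendsto_sandwich[of "\<lambda>_. S" _ _ "\<lambda>k. S + 1 / Suc k"])
      show "(\<lambda>k. S + 1 / Suc k) \<longlonglongrightarrow> S"
        using tendsto_add[OF tendsto_const LIMSEQ_Suc[OF lim_1_over_n], of S] by simp
    qed (use \<phi>q(1) \<phi>q(2)[THEN less_imp_le] in auto)
    define E where "E = (\<lambda>k. enn2real (gagliardo \<sigma> \<Omega> (\<phi> k)))"
    define N where "N = (\<lambda>k. enn2real (lp_pow ?q \<Omega> (\<phi> k)))"
    have quot: "sob_quot \<sigma> \<Omega> (\<phi> k) = E k / N k powr ?\<theta>" for k by (simp add: sob_quot_def E_def N_def)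
    \<comment> \<open>Vanishing energy would give quotient 0, below \<open>S\<close>; so rescaling
      to energy 1 is possible.\<close>
    have E0: "E k > 0" for k
    proof -
      have "E k \<noteq> 0" using \<phi>q(1)[of k] S(2) unfolding quot by auto
      then show ?thesis by (simp add: E_def less_le)
    qed
    \<comment> \<open>Rescales the energy to 1. The quotient is unaffected because
      \<open>?q * ?\<theta> = 2\<close>, so the norm integrals are again determined by the
      quotients.\<close>
    define c where "c = (\<lambda>k. 1 / sqrt (E k))"
    have c: "c k > 0" "(c k)\<^sup>2 = 1 / E k" for k using E0[of k] by (auto simp: c_def power_divide)
    define w where "w = (\<lambda>k x. c k * \<phi> k x)"
    have wC: "w k \<in> C1c \<Omega>" for k unfolding w_def by (rule C1c_cmult[OF \<phi>C])
    have wE: "enn2real (gagliardo \<sigma> \<Omega> (w k)) = 1" for k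
    proof -
      have "gagliardo \<sigma> \<Omega> (w k) = ennreal (\<bar>c k\<bar> powr 2) * gagliardo \<sigma> \<Omega> (\<phi> k)"
        unfolding w_def by (simp only: gagliardo_eq_pint[OF \<Omega>m] \<phi>m borel_measurable_times borel_measurable_const diffq_cmult)
          (rule pint_cmult, measurable)
      moreover have "enn2real (gagliardo \<sigma> \<Omega> (\<phi> k)) = E k" by (simp add: E_def)
      ultimately show ?thesis using c[of k] E0[of k] by (simp add: enn2real_mult)
    qed
    have wN: "enn2real (lp_pow ?q \<Omega> (w k)) = (c k) powr ?q * N k" for k
    proof -
      have "lp_pow ?q \<Omega> (w k) = ennreal (\<bar>c k\<bar> powr ?q) * lp_pow ?q \<Omega> (\<phi> k)"
        unfolding w_def by (simp only: lp_pow_eq_pint[OF \<Omega>m] \<phi>m borel_measurable_times borel_measurable_const)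
          (rule pint_cmult, measurable)
      then show ?thesis using c(1)[of k] by (simp add: enn2real_mult N_def)
    qed
    have "1 / enn2real (lp_pow ?q \<Omega> (w k)) powr ?\<theta> = sob_quot \<sigma> \<Omega> (\<phi> k)" for k
    proof -
      have "enn2real (lp_pow ?q \<Omega> (w k)) powr ?\<theta> = ((c k) powr ?q) powr ?\<theta> * N k powr ?\<theta>"
        unfolding wN by (rule powr_mult)
      also have "((c k) powr ?q) powr ?\<theta> = 1 / E k"
        unfolding powr_powr q\<theta> using c[of k] by simp
      finally show ?thesis unfolding quot by simp
    qed
    then have NP: "(\<lambda>k. enn2real (lp_pow ?q \<Omega> (w k))) \<longlonglongrightarrow> P"
      using lq by (intro limP) auto
    have E1: "(\<lambda>k. enn2real (gagliardo \<sigma> \<Omega> (w k))) \<longlonglongrightarrow> 1" by (simp add: wE)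
    show ?thesis by (rule compact[OF wC E1 NP]) blast
  qed
  show ?thesis
  proof (intro conjI part2 allI impI)
    fix u :: "nat \<Rightarrow> 'a \<Rightarrow> real" and r :: "nat \<Rightarrow> nat"
    assume u: "(\<forall>k. u k \<in> H0 \<sigma> \<Omega> \<and> lp_pow ?q \<Omega> (u k) > 0 \<and> gagliardo \<sigma> \<Omega> (u k) = 1) \<and>
            (\<lambda>k. ereal (sob_quot \<sigma> \<Omega> (u k))) \<longlonglongrightarrow> S_const \<sigma> \<Omega>" and r: "strict_mono r"
    show "\<exists>(r' :: nat \<Rightarrow> nat) v. strict_mono r' \<and> v \<in> H0 \<sigma> \<Omega> \<and>
                   (\<lambda>k. gagliardo \<sigma> \<Omega> (\<lambda>x. u (r (r' k)) x - v x)) \<longlonglongrightarrow> 0"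
    proof (rule part1[of "\<lambda>k. u (r k)"])
      show "(\<lambda>k. ereal (sob_quot \<sigma> \<Omega> (u (r k)))) \<longlonglongrightarrow> S_const \<sigma> \<Omega>"
        using LIMSEQ_subseq_LIMSEQ[OF conjunct2[OF u] r] by (simp add: o_def)
    qed (use u in auto)
  qed
qed

end
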